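(* For every $0\le t<1$ and $x\in\mathbb{R}$, $$V(t,x):=\sup_{t\le\tau_1\le\tau_2<1}\mathbb{E}_{t,x}\left[X_{\tau_2}-X_{\tau_1}\right]$$ equals $V^*(t,x)$, where $$V^*(t,x)=\begin{cases}\sqrt{1-t}\,\sqrt{2\pi}\,\Phi\!\left(-\frac{x}{\sqrt{1-t}}\right)e^{x^2/(2(1-t))}\,v(C^* ), & x>C^*\sqrt{1-t},\\ f(t,x), & x\le C^*\sqrt{1-t}.\end{cases}$$ Moreover, the pair $$\tau_1^*:=\inf\{s\ge t: X_s\le C^*\sqrt{1-s}\},\qquad \tau_2^*:=\inf\{s\ge\tau_1^*: X_s\ge B^*\sqrt{1-s}\}$$ is optimal, i.e. attains the supremum defining $V(t,x)$.
   Context: For $0\le t<1$ and $x\in\mathbb{R}$, let $\{X_s\}_{t\le s\le1}$ be the Brownian bridge solving $\mathrm{d}X_s=-\frac{X_s}{1-s}\mathrm{d}s+\mathrm{d}W_s$ for $t\le s<1$, with $X_t=x$. Here $W$ is a standard Brownian motion. Write $\mathbb{P}_{t,x},\mathbb{E}_{t,x}$ for probability and expectation under $X_t=x$. The supremum is over pairs of stopping times $t\le\tau_1\le\tau_2<1$ a.s. with respect to the filtration generated by $X$. $\Phi$ denotes the standard normal distribution function. $B^*\approx0.84$ is the unique positive solution of $\sqrt{2\pi}(1-B^2)e^{B^2/2}\Phi(B)=B$. Define $U(t,x)=\sqrt{2\pi(1-t)}(1-(B^* )^2)e^{x^2/(2(1-t))}\Phi(x/\sqrt{1-t})$ if $x<B^*\sqrt{1-t}$,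 and $U(t,x)=x$ otherwise. Set $f(t,x):=U(t,x)-x$. For $C\le B^*$ define $$v(C):=\frac{1}{\Phi(-C)}\left[(1-(B^* )^2)\Phi(C)-C\frac{e^{-C^2/2}}{\sqrt{2\pi}}\right],$$ $$u(C):=1-(B^* )^2-(1-C^2)\Phi(-C)-\frac{C}{\sqrt{2\pi}}e^{-C^2/2}.$$ $C^*$ is the unique negative zero of $u$; it is the maximizer of $v$ on $(-\infty,B^*]$. *)

theory Defs
  imports "HOL-Probability.Probability"
begin

definition Phi :: "real \<Rightarrow> real" where
  "Phi x = (LBINT y:{..x}. std_normal_density y)"

definition normal_law :: "real \<Rightarrow> real \<Rightarrow> real measure" where
  "normal_law mu s2 =
     (if s2 = 0 then return borel mu else density lborel (normal_density mu (sqrt s2)))"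

text \<open>Brownian bridge on [t,1) started at X_t = x (pinned to 0 at time 1), i.e. the
  law of the solution of dX_s = -X_s/(1-s) ds + dW_s, X_t = x: a Gaussian process with
  continuous paths, mean x(1-s)/(1-t) and covariance (min s r - t)(1 - max s r)/(1-t).\<close>
definition bb_mean :: "real \<Rightarrow> real \<Rightarrow> real \<Rightarrow> real" where
  "bb_mean t x s = x * (1 - s) / (1 - t)"

definition bb_cov :: "real \<Rightarrow> real \<Rightarrow> real \<Rightarrow> real" where
  "bb_cov t s r = (min s r - t) * (1 - max s r) / (1 - t)"

definition brownian_bridge ::
  "'a measure \<Rightarrow> real \<Rightarrow> real \<Rightarrow> (real \<Rightarrow> 'a \<Rightarrow> real) \<Rightarrow> bool" where
  "brownian_bridge M t x X \<longleftrightarrow>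
     prob_space M \<and>
     (\<forall>s\<in>{t..<1}. X s \<in> borel_measurable M) \<and>
     (\<forall>\<omega>\<in>space M. continuous_on {t..<1} (\<lambda>s. X s \<omega>)) \<and>
     (\<forall>S c. finite S \<longrightarrow> S \<subseteq> {t..<1} \<longrightarrow>
        distr M borel (\<lambda>\<omega>. \<Sum>s\<in>S. c s * X s \<omega>) =
        normal_law (\<Sum>s\<in>S. c s * bb_mean t x s)
                   (\<Sum>s\<in>S. \<Sum>r\<in>S. c s * c r * bb_cov t s r))"

definition nat_filtration ::
  "'a measure \<Rightarrow> real \<Rightarrow> (real \<Rightarrow> 'a \<Rightarrow> real) \<Rightarrow> real \<Rightarrow> 'a measure" where
  "nat_filtration M t X s =
     sigma (space M) (\<Union>r\<in>{t..min s 1}\<inter>{t..<1}. {X r -` A \<inter> space M | A. A \<in> sets borel})"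

text \<open>Value of the process at a (random) time; the process only lives on [t,1), so
  outside of it (a null event for admissible stopping times) we put 0.\<close>
definition proc_at :: "real \<Rightarrow> (real \<Rightarrow> 'a \<Rightarrow> real) \<Rightarrow> ('a \<Rightarrow> real) \<Rightarrow> 'a \<Rightarrow> real" where
  "proc_at t X \<tau> \<omega> = (if t \<le> \<tau> \<omega> \<and> \<tau> \<omega> < 1 then X (\<tau> \<omega>) \<omega> else 0)"

definition admissible ::
  "'a measure \<Rightarrow> real \<Rightarrow> (real \<Rightarrow> 'a \<Rightarrow> real) \<Rightarrow> ('a \<Rightarrow> real) \<Rightarrow> ('a \<Rightarrow> real) \<Rightarrow> bool" where
  "admissible M t X \<tau>1 \<tau>2 \<longleftrightarrow>
     stopping_time (nat_filtration M t X) \<tau>1 \<and> stopping_time (nat_filtration M t X) \<tau>2 \<and>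
     (AE \<omega> in M. t \<le> \<tau>1 \<omega> \<and> \<tau>1 \<omega> \<le> \<tau>2 \<omega> \<and> \<tau>2 \<omega> < 1)"

definition gain :: "'a measure \<Rightarrow> real \<Rightarrow> (real \<Rightarrow> 'a \<Rightarrow> real) \<Rightarrow> ('a \<Rightarrow> real) \<Rightarrow> ('a \<Rightarrow> real) \<Rightarrow> real" where
  "gain M t X \<tau>1 \<tau>2 = (\<integral>\<omega>. proc_at t X \<tau>2 \<omega> - proc_at t X \<tau>1 \<omega> \<partial>M)"

definition V :: "'a measure \<Rightarrow> real \<Rightarrow> (real \<Rightarrow> 'a \<Rightarrow> real) \<Rightarrow> ereal" where
  "V M t X = (SUP p\<in>{(\<tau>1, \<tau>2). admissible M t X \<tau>1 \<tau>2}. ereal (gain M t X (fst p) (snd p)))"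

definition Bstar :: real where
  "Bstar = (THE B. B > 0 \<and> sqrt (2*pi) * (1 - B^2) * exp (B^2/2) * Phi B = B)"

definition U :: "real \<Rightarrow> real \<Rightarrow> real" where
  "U t x = (if x < Bstar * sqrt (1 - t)
            then sqrt (2*pi*(1 - t)) * (1 - Bstar^2) * exp (x^2/(2*(1 - t))) * Phi (x / sqrt (1 - t))
            else x)"

definition f :: "real \<Rightarrow> real \<Rightarrow> real" where
  "f t x = U t x - x"

definition v :: "real \<Rightarrow> real" where
  "v C = 1 / Phi (-C) * ((1 - Bstar^2) * Phi C - C * exp (- (C^2) / 2) / sqrt (2*pi))"

definition u :: "real \<Rightarrow> real" where
  "u C = 1 - Bstar^2 - (1 - C^2) * Phi (-C) - C / sqrt (2*pi) * exp (- (C^2) / 2)"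

definition Cstar :: real where
  "Cstar = (THE C. C < 0 \<and> u C = 0)"

definition Vstar :: "real \<Rightarrow> real \<Rightarrow> real" where
  "Vstar t x = (if x > Cstar * sqrt (1 - t)
     then sqrt (1 - t) * sqrt (2*pi) * Phi (- x / sqrt (1 - t)) * exp (x^2/(2*(1 - t))) * v Cstar
     else f t x)"

definition hit :: "real \<Rightarrow> (real \<Rightarrow> bool) \<Rightarrow> real" where
  "hit a P = (if {s\<in>{a..<1}. P s} = {} then 1 else Inf {s\<in>{a..<1}. P s})"

definition tau1star :: "real \<Rightarrow> (real \<Rightarrow> 'a \<Rightarrow> real) \<Rightarrow> 'a \<Rightarrow> real" where
  "tau1star t X \<omega> = hit t (\<lambda>s. X s \<omega> \<le> Cstar * sqrt (1 - s))"

definition tau2star :: "real \<Rightarrow> (real \<Rightarrow> 'a \<Rightarrow> real) \<Rightarrow> 'a \<Rightarrow> real" where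
  "tau2star t X \<omega> = hit (tau1star t X \<omega>) (\<lambda>s. X s \<omega> \<ge> Bstar * sqrt (1 - s))"

end

theory Submission
  imports Defs
begin

text \<open>
  In the coordinate \<open>Z\<^sub>s = X\<^sub>s / sqrt (1 - s)\<close> the bridge is an Ornstein--Uhlenbeck process: along the grid
  \<open>1 - s\<^sub>k = (1 - t) \<rho> ^ k\<close> it satisfies \<open>Z' = sqrt \<rho> * Z + sqrt (1 - \<rho>) * N\<close> with a standard normal \<open>N\<close>
  independent of the past, and the value functions have the form \<open>sqrt (1 - s) * G Z\<^sub>s\<close>. The function
  \<open>psi z = \<integral>\<^sub>0\<^sup>\<infinity> exp (z y - y\<^sup>2 / 2) dy\<close> (the Mills ratio of the normal law at \<open>- z\<close>) and its reflection are
  exactly invariant under the corresponding one-step operator \<open>P\<close>, and up to such an invariant function both value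
  functions are, possibly after a reflection, of the form ``invariant to the left of \<open>b\<close>, identity to the
  right'' (call it \<open>A\<close>) with smooth fit at \<open>b\<close>. Comparison with the invariant function to the left of \<open>b\<close>, and monotonicity
  of \<open>z \<mapsto> P A z - z\<close> to the right of it, give superharmonicity for all small steps, without stochastic
  calculus. Optional stopping along the grids and a limit \<open>\<rho> \<rightarrow> 1\<close> with uniform integrability yield the upper
  bound; for the two hitting times the accumulated defect from invariance vanishes in the limit.
\<close>

section \<open>The Gaussian integral \<open>psi\<close>\<close>

text \<open>Two stopping problems are nested here. After the first stop at \<open>z\<close> the best
  further gain is proportional to \<open>GU z - z\<close>, so the first stopping time faces a
  problem with that reward, whose value is \<open>GV\<close>. \<open>GU\<close> has the form
  \<open>A\<close> with \<open>b = Bstar\<close> directly. \<open>GV\<close> does not, but to the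
  left of \<open>Cstar\<close> it equals \<open>(1 - Bstar\<^sup>2) * psi z - z\<close>: subtracting
  the invariant part \<open>(1 - Bstar\<^sup>2) * psi z\<close> leaves \<open>- z\<close>, and the
  reflection of \<open>z\<close> to \<open>- z\<close> makes this the identity, so the remainder has
  the form \<open>A\<close> with \<open>b = c_star = - Cstar\<close>. One analysis then serves both
  problems, at a price: the second \<open>A\<close> tends to minus infinity like
  \<open>- exp (z\<^sup>2 / 2)\<close> at the left end and its slope is unbounded there. This is why
  the estimates carry Gaussian weights such as \<open>exp (y\<^sup>2 / 4)\<close>, why monotonicity
  to the right of \<open>b\<close> holds only for small steps, and why growth has to be controlled
  for \<open>GV\<close> and not for its summands. The existence of \<open>c_star\<close> rests on
  the numerical fact \<open>1 / 2 < Bstar\<^sup>2\<close>.\<close>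

definition psi :: "real \<Rightarrow> real" where
  "psi z = (LINT y:{0..}|lborel. exp (z * y - y\<^sup>2 / 2))"

lemma exp_eq_normal_density:
  "exp (z * y - y\<^sup>2 / 2) = sqrt (2 * pi) * exp (z\<^sup>2 / 2) * std_normal_density (z - y)"
proof -
  have "exp (z * y - y\<^sup>2 / 2) = exp (z\<^sup>2 / 2 + - (z - y)\<^sup>2 / 2)"
    by (rule arg_cong[where f=exp]) (simp add: power2_eq_square field_simps)
  also have "\<dots> = exp (z\<^sup>2 / 2) * exp (- (z - y)\<^sup>2 / 2)"
    by (rule exp_add)
  finally show ?thesis
    by (simp add: std_normal_density_def)
qed

lemma integrable_std_normal_density_reflect:
  "integrable lborel (\<lambda>y. std_normal_density (z - y))"
  using lborel_integrable_real_affine[of "normal_density 0 1" "-1" z] by simp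

lemma integrable_psi_integrand:
  "set_integrable lborel {0..} (\<lambda>y::real. exp (z * y - y\<^sup>2 / 2))"
  unfolding exp_eq_normal_density set_integrable_def
  by (intro integrable_mult_indicator integrable_mult_right integrable_std_normal_density_reflect) auto

text \<open>Completing the square turns the integrand into a multiple of the normal density
  reflected at \<open>z\<close>. The integral form is the one suited to Fubini and monotonicity; the
  closed form is the one occurring in \<open>U\<close> and \<open>Vstar\<close>.\<close>

lemma psi_eq: "psi z = sqrt (2 * pi) * exp (z\<^sup>2 / 2) * Phi z"
proof -
  have "Phi z = (\<integral>y. indicator {..z} y * std_normal_density y \<partial>lborel)"
    by (simp add: Phi_def set_lebesgue_integral_def)
  also have "\<dots> = (\<integral>y. indicator {..z} (z + - 1 * y) * std_normal_density (z + - 1 * y) \<partial>lborel)"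
    by (subst lborel_integral_real_affine[where c="-1" and t=z]) auto
  also have "\<dots> = (\<integral>y. indicator {0..} y * std_normal_density (z - y) \<partial>lborel)"
    by (intro Bochner_Integration.integral_cong) (auto simp: indicator_def)
  finally have "Phi z = (\<integral>y. indicator {0..} y * std_normal_density (z - y) \<partial>lborel)" .
  moreover have "indicator {0..} y * (sqrt (2 * pi) * exp (z\<^sup>2 / 2) * std_normal_density (z - y))
     = sqrt (2 * pi) * exp (z\<^sup>2 / 2) * (indicator {0..} y * std_normal_density (z - y))" for y
    by simp
  ultimately show ?thesis
    unfolding psi_def set_lebesgue_integral_def exp_eq_normal_density real_scaleR_def
    by (simp only: integral_mult_right_zero)
qed

text \<open>The nonnegative version allows the exchange of integrals in
  \<open>nn_integral_ou_psi\<close> without any prior joint integrability.\<close>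

lemma nn_integral_psi:
  "(\<integral>\<^sup>+y. ennreal (indicator {0..} y * exp (z * y - y\<^sup>2 / 2)) \<partial>lborel) = ennreal (psi z)"
proof -
  have "integrable lborel (\<lambda>y. indicator {0..} y * exp (z * y - y\<^sup>2 / 2))"
    using integrable_psi_integrand[of z] by (simp add: set_integrable_def)
  then show ?thesis
    unfolding psi_def set_lebesgue_integral_def real_scaleR_def
    by (intro nn_integral_eq_integral) auto
qed

lemma Phi_has_real_derivative:
  "(Phi has_real_derivative std_normal_density x) (at x)"
proof -
  \<comment> \<open>Any base point below \<open>x\<close> works: the mass to the left of
    \<open>a\<close> is constant near \<open>x\<close>, and the fundamental theorem of calculus
    applies on the compact rest.\<close>
  define a where "a = x - 1"
  have cont: "continuous_on S (normal_density 0 1)" for S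
    unfolding normal_density_def by (intro continuous_intros) auto
  have int: "set_integrable lborel S std_normal_density" if "S \<in> sets borel" for S
    using that unfolding set_integrable_def
    by (intro integrable_mult_indicator) auto
  have eq: "Phi y = Phi a + integral {a..y} std_normal_density" if "a \<le> y" for y
  proof -
    have "Phi y = (LINT z:{..<a} \<union> {a..y}|lborel. std_normal_density z)"
      unfolding Phi_def using that by (intro arg_cong2[where f="set_lebesgue_integral lborel"]) auto
    also have "\<dots> = (LINT z:{..<a}|lborel. std_normal_density z) + (LINT z:{a..y}|lborel. std_normal_density z)"
      by (intro set_integral_Un int) auto
    also have "(LINT z:{a..y}|lborel. std_normal_density z) = integral {a..y} std_normal_density"
      by (intro set_borel_integral_eq_integral int) auto
    also have "(LINT z:{..<a}|lborel. std_normal_density z) = Phi a"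
      unfolding Phi_def set_lebesgue_integral_def
      by (intro integral_cong_AE) (use AE_lborel_singleton[of a] in \<open>auto simp: indicator_def\<close>)
    finally show ?thesis .
  qed
  have "((\<lambda>y. integral {a..y} std_normal_density) has_real_derivative std_normal_density x)
      (at x within {a..x+1})"
    by (intro integral_has_real_derivative cont) (auto simp: a_def)
  then have "((\<lambda>y. integral {a..y} std_normal_density) has_real_derivative std_normal_density x) (at x)"
    by (subst (asm) at_within_interior) (auto simp: a_def)
  then have *: "((\<lambda>y. Phi a + integral {a..y} std_normal_density) has_real_derivative std_normal_density x) (at x)"
    by (auto intro!: derivative_eq_intros)
  show ?thesis
  proof (rule has_field_derivative_transform_within_open[OF *])
    show "open {a<..}" "x \<in> {a<..}" by (auto simp: a_def)
    show "\<And>y. y \<in> {a<..} \<Longrightarrow> Phi a + integral {a..y} std_normal_density = Phi y"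
      by (rule eq[symmetric]) simp
  qed
qed

text \<open>The factor \<open>sqrt (2 * pi) * exp (z\<^sup>2 / 2)\<close> is the reciprocal of the
  normal density, so the derivative of \<open>Phi\<close> contributes exactly \<open>1\<close>. All
  slope estimates below come from this first-order equation.\<close>

lemma psi_has_real_derivative [derivative_intros]:
  "(psi has_real_derivative 1 + z * psi z) (at z)"
proof -
  have "sqrt (2 * pi) * exp (z\<^sup>2 / 2) * std_normal_density z = exp (z\<^sup>2 / 2) * exp (- z\<^sup>2 / 2)"
    by (simp add: std_normal_density_def)
  also have "\<dots> = 1"
    by (simp add: exp_add[symmetric])
  finally have "sqrt (2 * pi) * exp (z\<^sup>2 / 2) * std_normal_density z = 1" .
  moreover have "((\<lambda>z. sqrt (2 * pi) * exp (z\<^sup>2 / 2) * Phi z) has_real_derivative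
      sqrt (2 * pi) * exp (z\<^sup>2 / 2) * std_normal_density z + z * (sqrt (2 * pi) * exp (z\<^sup>2 / 2) * Phi z)) (at z)"
    using DERIV_mult[of "\<lambda>z. sqrt (2 * pi) * exp (z\<^sup>2 / 2)" "z * (sqrt (2 * pi) * exp (z\<^sup>2 / 2))" z UNIV Phi]
      Phi_has_real_derivative[of z]
    by (auto intro!: derivative_eq_intros simp: algebra_simps)
  ultimately show ?thesis
    by (simp add: psi_eq[abs_def])
qed

lemma isCont_psi [continuous_intros]: "isCont psi z"
  using psi_has_real_derivative by (rule DERIV_isCont)

lemma continuous_on_psi: "continuous_on S psi"
  by (simp add: continuous_at_imp_continuous_on isCont_psi)

lemma borel_measurable_psi [measurable]: "psi \<in> borel_measurable borel"
  by (intro borel_measurable_continuous_onI continuous_on_psi)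

lemma psi_mono: "z \<le> w \<Longrightarrow> psi z \<le> psi w"
  unfolding psi_def
  by (intro set_integral_mono integrable_psi_integrand) (auto intro: mult_right_mono)

lemma psi_nonneg: "0 \<le> psi z"
  unfolding psi_def set_lebesgue_integral_def by (intro Bochner_Integration.integral_nonneg) auto

lemma Phi_nonneg: "0 \<le> Phi z"
  unfolding Phi_def set_lebesgue_integral_def by (intro Bochner_Integration.integral_nonneg) auto

lemma Phi_le_1: "Phi z \<le> 1"
proof -
  have "Phi z \<le> (\<integral>y. std_normal_density y \<partial>lborel)"
    unfolding Phi_def set_lebesgue_integral_def
    by (intro integral_mono integrable_mult_indicator) (auto simp: indicator_def)
  then show ?thesis by simp
qed

lemma Phi_uminus: "Phi (- z) = 1 - Phi z"
proof -
  have int: "integrable lborel (\<lambda>y. indicator S y * std_normal_density y)" if "S \<in> sets borel" for S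
    using integrable_mult_indicator[of S lborel std_normal_density] that by simp
  have "Phi (- z) = (\<integral>y. indicator {..-z} y * std_normal_density y \<partial>lborel)"
    by (simp add: Phi_def set_lebesgue_integral_def)
  also have "\<dots> = (\<integral>y. indicator {..-z} (0 + - 1 * y) * std_normal_density (0 + - 1 * y) \<partial>lborel)"
    by (subst lborel_integral_real_affine[where c="-1" and t=0]) auto
  also have "\<dots> = (\<integral>y. indicator {z..} y * std_normal_density y \<partial>lborel)"
    by (intro Bochner_Integration.integral_cong) (auto simp: indicator_def std_normal_density_def)
  finally have "Phi z + Phi (- z)
      = (\<integral>y. indicator {..z} y * std_normal_density y + indicator {z..} y * std_normal_density y \<partial>lborel)"
    by (subst Bochner_Integration.integral_add)
       (auto simp: int Phi_def set_lebesgue_integral_def)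
  also have "\<dots> = (\<integral>y. std_normal_density y \<partial>lborel)"
    by (intro integral_cong_AE) (use AE_lborel_singleton[of z] in \<open>auto simp: indicator_def\<close>)
  finally show ?thesis by simp
qed

lemma Phi_mono: "z \<le> w \<Longrightarrow> Phi z \<le> Phi w"
  by (rule DERIV_nonneg_imp_nondecreasing) (auto intro!: Phi_has_real_derivative exI conjI)

lemma Phi_0: "Phi 0 = 1 / 2"
  using Phi_uminus[of 0] by simp

lemma Phi_ge_half: "0 \<le> z \<Longrightarrow> 1 / 2 \<le> Phi z"
  using Phi_mono[of 0 z] by (simp add: Phi_0)

lemma psi_le_exp: "psi z \<le> sqrt (2 * pi) * exp (z\<^sup>2 / 2)"
  unfolding psi_eq by (intro mult_left_le) (auto simp: Phi_nonneg Phi_le_1)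

subsection \<open>One step of the Ornstein--Uhlenbeck chain\<close>

text \<open>The prefactor belongs to the time weight: a step of relative size \<open>e\<close>
  multiplies \<open>sqrt (1 - s)\<close> by \<open>sqrt (1 - e)\<close>. Hence
  \<open>ou e G z = G z\<close> expresses the martingale property of
  \<open>sqrt (1 - s) * G Z\<^sub>s\<close> over that step.\<close>

definition ou :: "real \<Rightarrow> (real \<Rightarrow> real) \<Rightarrow> real \<Rightarrow> real" where
  "ou e G z = sqrt (1 - e) * (\<integral>y. G (sqrt (1 - e) * z + sqrt e * y) \<partial>std_normal_distribution)"

lemma prob_space_std_normal: "prob_space std_normal_distribution"
  by (rule prob_space_normal_density) simp

lemma sets_std_normal [measurable_cong]: "sets std_normal_distribution = sets borel"
  by simp

section \<open>Moments and exponential integrals of the standard normal law\<close>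

lemma integrable_std_normal_iff:
  fixes g :: "real \<Rightarrow> real"
  assumes [measurable]: "g \<in> borel_measurable borel"
  shows "integrable std_normal_distribution g \<longleftrightarrow> integrable lborel (\<lambda>y. std_normal_density y * g y)"
  by (subst integrable_density) auto

lemma integral_std_normal:
  fixes g :: "real \<Rightarrow> real"
  assumes [measurable]: "g \<in> borel_measurable borel"
  shows "(\<integral>y. g y \<partial>std_normal_distribution) = (\<integral>y. std_normal_density y * g y \<partial>lborel)"
  by (subst integral_density) auto

lemma integrable_std_normal_power:
  "integrable std_normal_distribution (\<lambda>y. y ^ k)" "integrable std_normal_distribution (\<lambda>y. \<bar>y\<bar> ^ k)"
  using integrable_std_normal_moment[of k] integrable_std_normal_moment_abs[of k]
  by (auto simp: integrable_std_normal_iff)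

lemma integral_std_normal_id: "(\<integral>y. y \<partial>std_normal_distribution) = 0"
  using integral_std_normal_moment_odd[of 0] by (simp add: integral_std_normal)

lemma integral_std_normal_square: "(\<integral>y. y\<^sup>2 \<partial>std_normal_distribution) = 1"
  using integral_std_normal_moment_even[of 1] by (simp add: integral_std_normal fact_2)

text \<open>The weight merely widens the normal law to variance \<open>2\<close>, so every
  polynomial moment survives. It will absorb growth of order \<open>exp (w\<^sup>2)\<close> at the
  position \<open>w\<close> reached after a small step.\<close>

lemma integrable_std_normal_power_exp:
  "integrable std_normal_distribution (\<lambda>y. y ^ k * exp (y\<^sup>2 / 4))"
proof -
  have *: "std_normal_density y * (y ^ k * exp (y\<^sup>2 / 4)) = sqrt 2 * (normal_density 0 (sqrt 2) y * y ^ k)" for y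
  proof -
    have "exp (- y\<^sup>2 / 2) * exp (y\<^sup>2 / 4) = exp (- y\<^sup>2 / 4)"
      by (simp add: exp_add[symmetric])
    then show ?thesis
      by (simp add: normal_density_def field_simps real_sqrt_mult)
  qed
  show ?thesis
    using integrable_normal_moment[of "sqrt 2" 0 k]
    by (subst integrable_std_normal_iff) (auto simp: *)
qed

lemma integrable_std_normal_quadratic:
  fixes G :: "real \<Rightarrow> real"
  assumes [measurable]: "G \<in> borel_measurable borel" and b: "\<And>z. \<bar>G z\<bar> \<le> a * (1 + z\<^sup>2)"
  shows "integrable std_normal_distribution (\<lambda>y. G (p + q * y))"
proof (rule Bochner_Integration.integrable_bound)
  have "integrable std_normal_distribution (\<lambda>y. a * (1 + p\<^sup>2) + 2 * a * p * q * y ^ 1 + a * q\<^sup>2 * y ^ 2)"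
    using prob_space.finite_measure[OF prob_space_std_normal]
    by (intro Bochner_Integration.integrable_add integrable_mult_right integrable_std_normal_power
        finite_measure.integrable_const)
  then show "integrable std_normal_distribution (\<lambda>y. a * (1 + (p + q * y)\<^sup>2))"
    by (simp add: power2_eq_square algebra_simps)
  show "AE y in std_normal_distribution. norm (G (p + q * y)) \<le> norm (a * (1 + (p + q * y)\<^sup>2))"
    using b by (auto intro!: always_eventually order_trans[OF b])
qed simp

lemma nn_integral_std_normal_exp:
  "(\<integral>\<^sup>+y. ennreal (exp (c * y)) \<partial>std_normal_distribution) = ennreal (exp (c\<^sup>2 / 2))"
proof -
  have *: "std_normal_density y * exp (c * y) = exp (c\<^sup>2 / 2) * normal_density c 1 y" for y
  proof -
    have "exp (- y\<^sup>2 / 2) * exp (c * y) = exp (c\<^sup>2 / 2) * exp (- (y - c)\<^sup>2 / 2)"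
      unfolding exp_add[symmetric]
      by (rule arg_cong[where f=exp]) (simp add: power2_eq_square field_simps)
    then show ?thesis
      by (simp add: normal_density_def)
  qed
  have "(\<integral>\<^sup>+y. ennreal (exp (c * y)) \<partial>std_normal_distribution)
      = (\<integral>\<^sup>+y. ennreal (exp (c\<^sup>2 / 2)) * ennreal (normal_density c 1 y) \<partial>lborel)"
    by (subst nn_integral_density) (auto simp: * ennreal_mult[symmetric])
  also have "\<dots> = ennreal (exp (c\<^sup>2 / 2)) * (\<integral>\<^sup>+y. ennreal (normal_density c 1 y) \<partial>lborel)"
    by (rule nn_integral_cmult) simp
  also have "(\<integral>\<^sup>+y. ennreal (normal_density c 1 y) \<partial>lborel) = 1"
    by (subst nn_integral_eq_integral) auto
  finally show ?thesis by simp
qed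

text \<open>With \<open>psi\<close> written as an integral over \<open>w\<close>, integrating the
  normal variable first yields the factor \<open>exp (e * w\<^sup>2 / 2)\<close>. The exponent
  becomes \<open>z * (r * w) - (r * w)\<^sup>2 / 2\<close> with \<open>r = sqrt (1 - e)\<close>, and
  rescaling \<open>w\<close> produces the factor \<open>1 / r\<close> that the prefactor of
  \<open>ou\<close> cancels.\<close>

lemma nn_integral_ou_psi:
  assumes "0 < e" "e < 1"
  shows "(\<integral>\<^sup>+y. ennreal (psi (sqrt (1 - e) * z + sqrt e * y)) \<partial>std_normal_distribution)
    = ennreal (psi z / sqrt (1 - e))"
proof -
  interpret N: prob_space std_normal_distribution by (rule prob_space_std_normal)
  interpret pair_sigma_finite lborel std_normal_distribution ..
  define r where "r = sqrt (1 - e)"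
  have r: "0 < r" "r\<^sup>2 = 1 - e" using assms by (auto simp: r_def)
  have "(\<integral>\<^sup>+y. ennreal (psi (r * z + sqrt e * y)) \<partial>std_normal_distribution)
    = (\<integral>\<^sup>+y. \<integral>\<^sup>+w. ennreal (indicator {0..} w * exp ((r * z + sqrt e * y) * w - w\<^sup>2 / 2)) \<partial>lborel \<partial>std_normal_distribution)"
    by (simp add: nn_integral_psi)
  also have "\<dots> = (\<integral>\<^sup>+w. \<integral>\<^sup>+y. ennreal (indicator {0..} w * exp ((r * z + sqrt e * y) * w - w\<^sup>2 / 2)) \<partial>std_normal_distribution \<partial>lborel)"
    by (rule Fubini') measurable
  also have "\<dots> = (\<integral>\<^sup>+w. ennreal (indicator {0..} w * exp (z * (r * w) - (r * w)\<^sup>2 / 2)) \<partial>lborel)"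
  proof (rule nn_integral_cong)
    fix w :: real
    have eq: "ennreal (indicator {0..} w * exp ((r * z + sqrt e * y) * w - w\<^sup>2 / 2))
      = ennreal (indicator {0..} w * exp (r * z * w - w\<^sup>2 / 2)) * ennreal (exp (sqrt e * w * y))" for y
    proof -
      have "exp ((r * z + sqrt e * y) * w - w\<^sup>2 / 2) = exp ((r * z * w - w\<^sup>2 / 2) + sqrt e * w * y)"
        by (rule arg_cong[where f=exp]) (simp add: algebra_simps)
      also have "\<dots> = exp (r * z * w - w\<^sup>2 / 2) * exp (sqrt e * w * y)"
        by (rule exp_add)
      finally show ?thesis by (simp add: ennreal_mult[symmetric])
    qed
    have eq2: "exp (r * z * w - w\<^sup>2 / 2) * exp ((sqrt e * w)\<^sup>2 / 2) = exp (z * (r * w) - (r * w)\<^sup>2 / 2)"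
      unfolding exp_add[symmetric] using assms r
      by (intro arg_cong[where f=exp]) (simp add: power_mult_distrib, simp add: field_simps)
    have "(\<integral>\<^sup>+y. ennreal (indicator {0..} w * exp ((r * z + sqrt e * y) * w - w\<^sup>2 / 2)) \<partial>std_normal_distribution)
      = ennreal (indicator {0..} w * exp (r * z * w - w\<^sup>2 / 2)) * ennreal (exp ((sqrt e * w)\<^sup>2 / 2))"
      unfolding eq
      by (subst nn_integral_cmult) (auto simp only: nn_integral_std_normal_exp, measurable)
    also have "\<dots> = ennreal (indicator {0..} w * (exp (r * z * w - w\<^sup>2 / 2) * exp ((sqrt e * w)\<^sup>2 / 2)))"
      by (simp add: ennreal_mult[symmetric])
    finally show "(\<integral>\<^sup>+y. ennreal (indicator {0..} w * exp ((r * z + sqrt e * y) * w - w\<^sup>2 / 2)) \<partial>std_normal_distribution)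
      = ennreal (indicator {0..} w * exp (z * (r * w) - (r * w)\<^sup>2 / 2))"
      unfolding eq2 .
  qed
  also have "\<dots> = ennreal (1 / r) * (\<integral>\<^sup>+w. ennreal (indicator {0..} w * exp (z * w - w\<^sup>2 / 2)) \<partial>lborel)"
    using r(1)
    by (subst nn_integral_real_affine[where c="1/r" and t=0])
       (auto simp: indicator_def zero_le_divide_iff intro!: arg_cong2[where f="(*)"] nn_integral_cong)
  finally show ?thesis
    using r(1) psi_nonneg[of z] by (simp add: nn_integral_psi ennreal_mult[symmetric] r_def)
qed

lemma integral_std_normal_uminus:
  fixes g :: "real \<Rightarrow> real"
  assumes [measurable]: "g \<in> borel_measurable borel"
  shows "(\<integral>y. g (- y) \<partial>std_normal_distribution) = (\<integral>y. g y \<partial>std_normal_distribution)"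
proof -
  have "(\<integral>y. std_normal_density y * g y \<partial>lborel)
      = (\<integral>y. std_normal_density (0 + - 1 * y) * g (0 + - 1 * y) \<partial>lborel)"
    by (subst lborel_integral_real_affine[where c="-1" and t=0]) auto
  also have "\<dots> = (\<integral>y. std_normal_density y * g (- y) \<partial>lborel)"
    by (simp add: std_normal_density_def)
  finally show ?thesis by (simp add: integral_std_normal)
qed

lemma integrable_std_normal_uminus:
  fixes g :: "real \<Rightarrow> real"
  assumes [measurable]: "g \<in> borel_measurable borel"
  shows "integrable std_normal_distribution (\<lambda>y. g (- y)) \<longleftrightarrow> integrable std_normal_distribution g"
proof -
  have "integrable lborel (\<lambda>y. std_normal_density y * g y)
      \<longleftrightarrow> integrable lborel (\<lambda>y. std_normal_density (0 + - 1 * y) * g (0 + - 1 * y))"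
    using lborel_integrable_real_affine_iff[where c="-1" and t=0
        and f="\<lambda>y. std_normal_density y * g y"] by simp
  also have "\<dots> \<longleftrightarrow> integrable lborel (\<lambda>y. std_normal_density y * g (- y))"
    by (simp add: std_normal_density_def)
  finally show ?thesis by (simp add: integrable_std_normal_iff)
qed

lemma ou_uminus:
  fixes G :: "real \<Rightarrow> real"
  assumes [measurable]: "G \<in> borel_measurable borel"
  shows "ou e (\<lambda>z. G (- z)) z = ou e G (- z)"
  using integral_std_normal_uminus[of "\<lambda>y. G (sqrt (1 - e) * (- z) + sqrt e * y)"]
  by (simp add: ou_def algebra_simps)

lemma
  assumes "0 < e" "e < 1"
  shows integrable_ou_psi: "integrable std_normal_distribution (\<lambda>y. psi (sqrt (1 - e) * z + sqrt e * y))"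
    and ou_psi: "ou e psi z = psi z"
proof -
  have 1: "has_bochner_integral std_normal_distribution (\<lambda>y. psi (sqrt (1 - e) * z + sqrt e * y)) (psi z / sqrt (1 - e))"
    using assms
    by (intro has_bochner_integral_nn_integral nn_integral_ou_psi) (auto simp: psi_nonneg)
  then show "integrable std_normal_distribution (\<lambda>y. psi (sqrt (1 - e) * z + sqrt e * y))"
    by (rule integrable.intros)
  show "ou e psi z = psi z"
    using has_bochner_integral_integral_eq[OF 1] assms by (simp add: ou_def)
qed

lemma
  assumes "0 < e" "e < 1"
  shows integrable_ou_psi_uminus: "integrable std_normal_distribution (\<lambda>y. psi (- (sqrt (1 - e) * z + sqrt e * y)))"
    and ou_psi_uminus: "ou e (\<lambda>z. psi (- z)) z = psi (- z)"
proof -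
  show "integrable std_normal_distribution (\<lambda>y. psi (- (sqrt (1 - e) * z + sqrt e * y)))"
    using integrable_std_normal_uminus[of "\<lambda>y. psi (- (sqrt (1 - e) * z + sqrt e * y))"]
      integrable_ou_psi[OF assms, of "- z"]
    by (simp add: algebra_simps)
  show "ou e (\<lambda>z. psi (- z)) z = psi (- z)"
    by (simp add: ou_uminus ou_psi[OF assms])
qed

section \<open>Smooth fit\<close>

lemma abs_le_exp_square: "\<bar>w::real\<bar> \<le> exp (w\<^sup>2 / 2)"
proof -
  have "0 \<le> (\<bar>w\<bar> - 1)\<^sup>2" by simp
  then have "\<bar>w\<bar> \<le> 1 + w\<^sup>2 / 2" by (simp add: power2_eq_square algebra_simps)
  also have "\<dots> \<le> exp (w\<^sup>2 / 2)" by (rule exp_ge_add_one_self)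
  finally show ?thesis .
qed

lemma one_plus_square_le_exp: "1 + (w::real)\<^sup>2 \<le> 2 * exp (w\<^sup>2 / 2)"
proof -
  have "1 + w\<^sup>2 \<le> 2 * (1 + w\<^sup>2 / 2)" by (simp add: field_simps)
  also have "\<dots> \<le> 2 * exp (w\<^sup>2 / 2)" by (intro mult_left_mono exp_ge_add_one_self) auto
  finally show ?thesis .
qed

text \<open>Since \<open>psi' z = 1 + z * psi z\<close>, assumption \<open>fit'\<close> says that \<open>h\<close> below has slope \<open>1\<close> at \<open>b\<close>.\<close>
locale smooth_fit =
  fixes al be b :: real
  assumes al: "0 \<le> al" and be: "be \<le> 0" and b: "0 < b"
    and fit: "al * psi b + be * psi (- b) = b" and fit': "al - be = 1 - b\<^sup>2"
begin

definition h :: "real \<Rightarrow> real" where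
  "h w = al * psi w + be * psi (- w)"

definition A :: "real \<Rightarrow> real" where
  "A w = (if w < b then h w else w)"

lemma h_b: "h b = b"
  using fit by (simp add: h_def)

lemma h_has_real_derivative: "(h has_real_derivative w * h w + (1 - b\<^sup>2)) (at w)"
proof -
  have "((\<lambda>w. psi (- w)) has_real_derivative (1 + (- w) * psi (- w)) * (- 1)) (at w)"
    by (rule DERIV_chain2[where f=psi]) (auto intro!: psi_has_real_derivative derivative_eq_intros)
  then have "(h has_real_derivative al * (1 + w * psi w) + be * ((1 + (- w) * psi (- w)) * (- 1))) (at w)"
    unfolding h_def[abs_def]
    by (intro DERIV_add DERIV_cmult psi_has_real_derivative)
  moreover have "al * (1 + w * psi w) + be * ((1 + (- w) * psi (- w)) * (- 1)) = w * h w + (1 - b\<^sup>2)"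
    by (simp add: h_def fit'[symmetric] algebra_simps)
  ultimately show ?thesis by simp
qed

lemma continuous_on_h: "continuous_on S h"
  using h_has_real_derivative by (meson DERIV_isCont continuous_at_imp_continuous_on)

lemma borel_measurable_h [measurable]: "h \<in> borel_measurable borel"
  by (intro borel_measurable_continuous_onI continuous_on_h)

lemma borel_measurable_A [measurable]: "A \<in> borel_measurable borel"
  unfolding A_def[abs_def] by measurable

lemma continuous_on_A: "continuous_on UNIV A"
proof -
  have "continuous_on ({..b} \<union> {b..}) (\<lambda>w. if w \<le> b then h w else w)"
    by (intro continuous_on_If continuous_on_h continuous_intros) (auto simp: h_b)
  moreover have "{..b} \<union> {b..} = UNIV" by auto
  moreover have "(\<lambda>w. if w \<le> b then h w else w) = A"
    by (auto simp: A_def h_b fun_eq_iff)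
  ultimately show ?thesis by metis
qed

lemma h_mono: "z \<le> w \<Longrightarrow> h z \<le> h w"
  using al be unfolding h_def
  by (intro add_mono mult_left_mono mult_left_mono_neg psi_mono) auto

text \<open>The slope of \<open>h y - y\<close> is \<open>y * h y - b\<^sup>2\<close>, whose sign is
  known because \<open>h\<close> increases and \<open>h b = b\<close>. Together with
  \<open>gap_mono\<close> this makes \<open>b\<close> the minimum point of the gap on the
  nonnegative half line, with minimum \<open>0\<close>.\<close>

lemma gap_antimono:
  assumes "0 \<le> z" "z \<le> w" "w \<le> b"
  shows "h w - w \<le> h z - z"
proof (rule DERIV_nonpos_imp_nonincreasing[OF assms(2)])
  fix y assume y: "z \<le> y" "y \<le> w"
  have "h y \<le> b" using h_mono[of y b] y assms by (simp add: h_b)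
  then have "y * h y \<le> b\<^sup>2"
    using mult_left_mono[of "h y" b y] mult_right_mono[of y b b] y assms b
    unfolding power2_eq_square by linarith
  then show "\<exists>D. ((\<lambda>y. h y - y) has_real_derivative D) (at y) \<and> D \<le> 0"
    by (intro exI[of _ "y * h y + (1 - b\<^sup>2) - 1"])
       (auto intro!: derivative_eq_intros h_has_real_derivative)
qed

lemma gap_mono:
  assumes "b \<le> z" "z \<le> w"
  shows "h z - z \<le> h w - w"
proof (rule DERIV_nonneg_imp_nondecreasing[OF assms(2)])
  fix y assume y: "z \<le> y" "y \<le> w"
  have "b \<le> h y" using h_mono[of b y] y assms by (simp add: h_b)
  then have "b\<^sup>2 \<le> y * h y"
    using mult_mono[of b y b "h y"] y assms b by (simp add: power2_eq_square)
  then show "\<exists>D. ((\<lambda>y. h y - y) has_real_derivative D) (at y) \<and> 0 \<le> D"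
    by (intro exI[of _ "y * h y + (1 - b\<^sup>2) - 1"])
       (auto intro!: derivative_eq_intros h_has_real_derivative)
qed

lemma gap_nonneg: "0 \<le> w \<Longrightarrow> w \<le> h w"
  using gap_antimono[of w b] gap_mono[of b w] h_b b by (cases "w \<le> b") auto

lemma A_le_h: "A w \<le> h w"
  using gap_nonneg[of w] b by (auto simp: A_def)

text \<open>On the nonnegative half line \<open>A w - w\<close> decreases to \<open>0\<close> at
  \<open>b\<close> and stays there. For negative arguments the bound can fail: if
  \<open>be < 0\<close>, the slope of \<open>h\<close> is unbounded towards minus infinity.\<close>

lemma A_slope:
  assumes "0 \<le> z" "z \<le> w"
  shows "A w - A z \<le> w - z"
proof -
  consider "w < b" | "z < b" "b \<le> w" | "b \<le> z" by linarith
  then show ?thesis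
  proof cases
    case 1
    then show ?thesis using gap_antimono[of z w] assms by (simp add: A_def)
  next
    case 2
    then show ?thesis using gap_antimono[of z b] assms by (simp add: A_def h_b)
  qed (use assms in \<open>simp add: A_def\<close>)
qed

section \<open>Growth bounds for \<open>h\<close>, its slope and its gap to the identity\<close>

definition M0 :: real where "M0 = (al - be) * sqrt (2 * pi)"

definition L1 :: real where "L1 = M0 + \<bar>1 - b\<^sup>2\<bar>"

text \<open>Constant for the second derivative
  \<open>(1 + w\<^sup>2) * h w + w * (1 - b\<^sup>2)\<close> of \<open>h\<close>, which is at most
  \<open>L2 * exp (w\<^sup>2)\<close> for \<open>w > 0\<close>; \<open>M0\<close> and
  \<open>L1\<close> play the same role for \<open>h\<close> and its slope.\<close>

definition L2 :: real where "L2 = 2 * M0 + \<bar>1 - b\<^sup>2\<bar>"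

lemma M0_nonneg: "0 \<le> M0"
  using al be by (simp add: M0_def)

lemma L1_nonneg: "0 \<le> L1" and L2_nonneg: "0 \<le> L2"
  using M0_nonneg by (auto simp: L1_def L2_def)

lemma abs_h_le: "\<bar>h w\<bar> \<le> M0 * exp (w\<^sup>2 / 2)"
proof -
  have "\<bar>h w\<bar> \<le> al * psi w + - be * psi (- w)"
    using al be psi_nonneg[of w] psi_nonneg[of "- w"]
    by (simp add: h_def abs_le_iff mult_nonneg_nonpos2 mult_nonpos_nonneg)
  also have "\<dots> \<le> al * (sqrt (2 * pi) * exp (w\<^sup>2 / 2)) + - be * (sqrt (2 * pi) * exp (w\<^sup>2 / 2))"
    using al be psi_le_exp[of w] psi_le_exp[of "- w"]
    by (intro add_mono mult_left_mono) auto
  finally show ?thesis by (simp add: M0_def algebra_simps)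
qed

lemma exp_half_mult: "exp (w\<^sup>2 / 2) * exp (w\<^sup>2 / 2) = exp ((w::real)\<^sup>2)"
  by (simp add: exp_add[symmetric])

lemma abs_deriv_h_le: "\<bar>w * h w + (1 - b\<^sup>2)\<bar> \<le> L1 * exp (w\<^sup>2)"
proof -
  have "\<bar>w * h w\<bar> \<le> exp (w\<^sup>2 / 2) * (M0 * exp (w\<^sup>2 / 2))"
    unfolding abs_mult by (intro mult_mono abs_le_exp_square abs_h_le) auto
  also have "\<dots> = M0 * exp (w\<^sup>2)"
    using exp_half_mult[of w] by simp
  finally have "\<bar>w * h w\<bar> \<le> M0 * exp (w\<^sup>2)" .
  moreover have "\<bar>1 - b\<^sup>2\<bar> * 1 \<le> \<bar>1 - b\<^sup>2\<bar> * exp (w\<^sup>2)"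
    by (intro mult_left_mono) auto
  ultimately show ?thesis
    by (simp add: L1_def distrib_right)
qed

text \<open>By smooth fit the gap and its slope both vanish at \<open>b\<close>, so two applications
  of the mean value theorem leave a second derivative at some point between \<open>b\<close> and
  \<open>w\<close>. The square is essential: with a merely linear gap a single step could cost order
  \<open>sqrt e\<close> instead of \<open>e\<close>.\<close>

lemma gap_le:
  assumes "b \<le> w"
  shows "h w - w \<le> L2 * exp (w\<^sup>2) * (w - b)\<^sup>2"
proof (cases "w = b")
  case False
  then have bw: "b < w" using assms by simp
  have "\<exists>y>b. y < w \<and> (h w - w) - (h b - b) = (w - b) * (y * h y + (1 - b\<^sup>2) - 1)"
    by (rule MVT2[OF bw]) (auto intro!: derivative_eq_intros h_has_real_derivative)
  then obtain y where y: "b < y" "y < w" "h w - w = (w - b) * (y * h y - b\<^sup>2)"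
    by (auto simp: h_b)
  have "\<exists>x>b. x < y \<and> y * h y - b * h b = (y - b) * (h x + x * (x * h x + (1 - b\<^sup>2)))"
    by (rule MVT2[OF y(1)]) (auto intro!: derivative_eq_intros h_has_real_derivative)
  then obtain x where x: "b < x" "x < y" "y * h y - b\<^sup>2 = (y - b) * (h x + x * (x * h x + (1 - b\<^sup>2)))"
    by (auto simp: h_b power2_eq_square)
  have "h x + x * (x * h x + (1 - b\<^sup>2)) = (1 + x\<^sup>2) * h x + x * (1 - b\<^sup>2)"
    by (simp add: power2_eq_square algebra_simps)
  also have "\<dots> \<le> (2 * exp (x\<^sup>2 / 2)) * (M0 * exp (x\<^sup>2 / 2)) + exp (x\<^sup>2) * \<bar>1 - b\<^sup>2\<bar>"
  proof (rule add_mono)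
    have "(1 + x\<^sup>2) * h x \<le> (1 + x\<^sup>2) * (M0 * exp (x\<^sup>2 / 2))"
      using abs_h_le[of x] by (intro mult_left_mono) auto
    also have "\<dots> \<le> (2 * exp (x\<^sup>2 / 2)) * (M0 * exp (x\<^sup>2 / 2))"
      using M0_nonneg by (intro mult_right_mono one_plus_square_le_exp) auto
    finally show "(1 + x\<^sup>2) * h x \<le> (2 * exp (x\<^sup>2 / 2)) * (M0 * exp (x\<^sup>2 / 2))" .
    have "x \<le> exp (x\<^sup>2)"
      using abs_le_exp_square[of x] order_trans[of "\<bar>x\<bar>" "exp (x\<^sup>2 / 2)" "exp (x\<^sup>2)"] by auto
    then show "x * (1 - b\<^sup>2) \<le> exp (x\<^sup>2) * \<bar>1 - b\<^sup>2\<bar>"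
      using x b mult_mono[of x "exp (x\<^sup>2)" "\<bar>1 - b\<^sup>2\<bar>" "\<bar>1 - b\<^sup>2\<bar>"]
        mult_left_mono[of "1 - b\<^sup>2" "\<bar>1 - b\<^sup>2\<bar>" x]
      by (meson abs_ge_self abs_ge_zero less_eq_real_def order_refl order_trans)
  qed
  also have "\<dots> = L2 * exp (x\<^sup>2)"
    using exp_half_mult[of x] by (simp add: L2_def algebra_simps)
  also have "\<dots> \<le> L2 * exp (w\<^sup>2)"
    using x y b L2_nonneg by (intro mult_left_mono) (auto intro!: power_mono)
  finally have "y * h y - b\<^sup>2 \<le> (y - b) * (L2 * exp (w\<^sup>2))"
    using x y by (auto intro!: mult_left_mono)
  also have "\<dots> \<le> (w - b) * (L2 * exp (w\<^sup>2))"
    using y L2_nonneg by (intro mult_right_mono) auto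
  finally have "h w - w \<le> (w - b) * ((w - b) * (L2 * exp (w\<^sup>2)))"
    unfolding y(3) using bw by (intro mult_left_mono) auto
  then show ?thesis by (simp add: power2_eq_square mult_ac)
qed (simp add: h_b)

section \<open>The one-step defect of \<open>A\<close> and its superharmonicity\<close>

lemma
  assumes "0 < e" "e < 1"
  shows integrable_ou_h: "integrable std_normal_distribution (\<lambda>y. h (sqrt (1 - e) * z + sqrt e * y))"
    and ou_h: "ou e h z = h z"
proof -
  note i = integrable_ou_psi[OF assms, of z] integrable_ou_psi_uminus[OF assms, of z]
  show "integrable std_normal_distribution (\<lambda>y. h (sqrt (1 - e) * z + sqrt e * y))"
    unfolding h_def by (intro Bochner_Integration.integrable_add integrable_mult_right i)
  have "ou e h z = al * ou e psi z + be * ou e (\<lambda>z. psi (- z)) z"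
    unfolding ou_def h_def
    by (subst Bochner_Integration.integral_add) (use i in \<open>auto simp: algebra_simps\<close>)
  then show "ou e h z = h z"
    by (simp add: ou_psi[OF assms] ou_psi_uminus[OF assms] h_def)
qed

lemma integrable_ou_A:
  assumes "0 < e" "e < 1"
  shows "integrable std_normal_distribution (\<lambda>y. A (sqrt (1 - e) * z + sqrt e * y))"
proof (rule Bochner_Integration.integrable_bound)
  have lin: "\<bar>\<bar>w\<bar>\<bar> \<le> 1 * (1 + w\<^sup>2)" for w :: real
  proof -
    have "0 \<le> (\<bar>w\<bar> - 1)\<^sup>2" by simp
    then have "2 * \<bar>w\<bar> \<le> 1 + w\<^sup>2" by (simp add: power2_eq_square algebra_simps)
    moreover have "0 \<le> \<bar>w\<bar>" by simp
    ultimately show ?thesis by (simp only: abs_abs mult_1)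
  qed
  show "integrable std_normal_distribution
      (\<lambda>y. \<bar>h (sqrt (1 - e) * z + sqrt e * y)\<bar> + \<bar>sqrt (1 - e) * z + sqrt e * y\<bar>)"
    by (intro Bochner_Integration.integrable_add integrable_abs integrable_ou_h assms
        integrable_std_normal_quadratic[where G="\<lambda>w. \<bar>w\<bar>", OF _ lin]) auto
qed (auto simp: A_def)

text \<open>Since \<open>h\<close> is invariant, the defect left of \<open>b\<close> is
  \<open>sqrt (1 - e)\<close> times the mean of the gap \<open>h - A\<close> after the step, and
  this gap is zero unless the step crosses \<open>b\<close>. A crossing costs order
  \<open>e * y\<^sup>2\<close>, which gives the first bound. It also requires
  \<open>sqrt e * y\<close> to be at least the distance \<open>d\<close>, so a factor
  \<open>e * y\<^sup>2 / d\<^sup>2 \<ge> 1\<close> may be inserted, which gives the second. The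
  integrand of \<open>I\<close> dominates both cases.\<close>

lemma
  assumes e: "0 < e" "e \<le> 1 / 8" and z: "z < b"
  defines "I \<equiv> \<integral>y. (y ^ 2 + y ^ 4) * exp (y\<^sup>2 / 4) \<partial>std_normal_distribution"
  shows defect_nonneg: "0 \<le> A z - ou e A z"
    and defect_le: "A z - ou e A z \<le> L2 * exp (2 * b\<^sup>2) * I * e"
    and defect_le2: "A z - ou e A z \<le> L2 * exp (2 * b\<^sup>2) * I * e\<^sup>2 / (min (b - z) b)\<^sup>2"
proof -
  define r where "r = sqrt (1 - e)"
  \<comment> \<open>The contraction by \<open>r\<close> moves a negative \<open>z\<close> towards
    \<open>b\<close>, but not beyond \<open>0\<close>; this is the reason for capping the distance
    at \<open>b\<close>.\<close>
  define d where "d = min (b - z) b"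
  have r: "0 \<le> r" "r \<le> 1" using e by (auto simp: r_def)
  have d: "0 < d" using z b by (simp add: d_def)
  have rz: "d \<le> b - r * z"
  proof (cases "0 \<le> z")
    case True
    then have "r * z \<le> z" using r by (intro mult_left_le_one_le) auto
    then show ?thesis by (simp add: d_def)
  next
    case False
    then have "r * z \<le> 0" using r by (intro mult_nonneg_nonpos) auto
    then show ?thesis by (simp add: d_def)
  qed
  have e1: "e < 1" using e by simp
  define g where "g y = h (r * z + sqrt e * y) - A (r * z + sqrt e * y)" for y
  have g0: "0 \<le> g y" for y using A_le_h by (simp add: g_def)
  have ig: "integrable std_normal_distribution g"
    unfolding g_def[abs_def] r_def
    by (intro Bochner_Integration.integrable_diff integrable_ou_h integrable_ou_A e e1)
  have eq: "A z - ou e A z = r * (\<integral>y. g y \<partial>std_normal_distribution)"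
  proof -
    have "A z = ou e h z" using z by (simp add: ou_h[OF e(1) e1] A_def)
    then show ?thesis
      unfolding ou_def g_def r_def
      by (subst Bochner_Integration.integral_diff[OF integrable_ou_h[OF e(1) e1] integrable_ou_A[OF e(1) e1]])
         (simp only: right_diff_distrib)
  qed
  then show "0 \<le> A z - ou e A z" using r g0 by simp
  have i4: "integrable std_normal_distribution (\<lambda>y. (y ^ 2 + y ^ 4) * exp (y\<^sup>2 / 4))"
    unfolding distrib_right
    by (intro Bochner_Integration.integrable_add integrable_std_normal_power_exp)
  have bound: "A z - ou e A z \<le> c * I" if "0 \<le> c" "\<And>y. g y \<le> c * ((y ^ 2 + y ^ 4) * exp (y\<^sup>2 / 4))" for c
  proof -
    have "A z - ou e A z \<le> (\<integral>y. g y \<partial>std_normal_distribution)"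
      unfolding eq using r g0 by (intro mult_left_le_one_le) auto
    also have "\<dots> \<le> (\<integral>y. c * ((y ^ 2 + y ^ 4) * exp (y\<^sup>2 / 4)) \<partial>std_normal_distribution)"
      by (intro integral_mono ig integrable_mult_right i4 that)
    finally show ?thesis by (simp add: I_def)
  qed
  have key: "g y \<le> L2 * exp (2 * b\<^sup>2) * e * (y\<^sup>2 * exp (y\<^sup>2 / 4)) \<and> d\<^sup>2 \<le> e * y\<^sup>2 \<or> g y = 0" for y
  proof (cases "r * z + sqrt e * y < b")
    case False
    define w where "w = r * z + sqrt e * y"
    have w: "b \<le> w" using False by (simp add: w_def)
    have sy: "d \<le> sqrt e * y" "w - b \<le> sqrt e * y" "w \<le> b + sqrt e * y"
      using w rz d by (auto simp: w_def)
    have sq: "(sqrt e * y)\<^sup>2 = e * y\<^sup>2" using e by (simp add: power_mult_distrib)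
    have "w\<^sup>2 \<le> (b + sqrt e * y)\<^sup>2" using sy w b by (intro power_mono) auto
    also have "\<dots> \<le> 2 * b\<^sup>2 + 2 * (sqrt e * y)\<^sup>2"
    proof -
      have "0 \<le> (b - sqrt e * y)\<^sup>2" by simp
      then show ?thesis by (simp add: power2_eq_square algebra_simps)
    qed
    \<comment> \<open>Here \<open>e \<le> 1 / 8\<close> enters: the growth
      \<open>exp (w\<^sup>2)\<close> of the gap is reduced to the integrable weight
      \<open>exp (y\<^sup>2 / 4)\<close>.\<close>
    also have "2 * (sqrt e * y)\<^sup>2 \<le> y\<^sup>2 / 4"
      using mult_right_mono[OF e(2), of "y\<^sup>2"] unfolding sq by simp
    finally have "exp (w\<^sup>2) \<le> exp (2 * b\<^sup>2) * exp (y\<^sup>2 / 4)"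
      by (simp add: exp_add[symmetric])
    moreover have "(w - b)\<^sup>2 \<le> e * y\<^sup>2"
      using power_mono[OF sy(2), of 2] w unfolding sq by simp
    ultimately have "L2 * exp (w\<^sup>2) * (w - b)\<^sup>2 \<le> L2 * (exp (2 * b\<^sup>2) * exp (y\<^sup>2 / 4)) * (e * y\<^sup>2)"
      using L2_nonneg by (intro mult_mono) auto
    moreover have "g y \<le> L2 * exp (w\<^sup>2) * (w - b)\<^sup>2"
      using gap_le[OF w] w by (simp add: g_def A_def w_def)
    moreover have "d\<^sup>2 \<le> e * y\<^sup>2"
      using power_mono[OF sy(1), of 2] d unfolding sq by simp
    ultimately show ?thesis by (simp add: mult_ac)
  qed (simp add: g_def A_def)
  let ?c = "L2 * exp (2 * b\<^sup>2) * e"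
  have c0: "0 \<le> ?c" using L2_nonneg e by simp
  have "A z - ou e A z \<le> ?c * I"
  proof (rule bound[OF c0])
    fix y :: real
    have "?c * (y\<^sup>2 * exp (y\<^sup>2 / 4)) \<le> ?c * ((y ^ 2 + y ^ 4) * exp (y\<^sup>2 / 4))"
      by (intro mult_left_mono[OF _ c0] mult_right_mono) auto
    moreover have "0 \<le> ?c * ((y ^ 2 + y ^ 4) * exp (y\<^sup>2 / 4))"
      by (intro mult_nonneg_nonneg[OF c0]) auto
    ultimately show "g y \<le> ?c * ((y ^ 2 + y ^ 4) * exp (y\<^sup>2 / 4))"
      using key[of y] by auto
  qed
  then show "A z - ou e A z \<le> L2 * exp (2 * b\<^sup>2) * I * e" by (simp add: mult_ac)
  have c1: "0 \<le> ?c * (e / d\<^sup>2)" using c0 e by simp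
  have "A z - ou e A z \<le> ?c * (e / d\<^sup>2) * I"
  proof (rule bound[OF c1])
    fix y :: real
    have "?c * (y\<^sup>2 * exp (y\<^sup>2 / 4)) \<le> ?c * (e / d\<^sup>2) * ((y ^ 2 + y ^ 4) * exp (y\<^sup>2 / 4))" if "d\<^sup>2 \<le> e * y\<^sup>2"
    proof -
      have "1 \<le> e / d\<^sup>2 * y\<^sup>2" using that d by (simp add: field_simps)
      then have "y\<^sup>2 \<le> e / d\<^sup>2 * y\<^sup>2 * y\<^sup>2"
        using mult_right_mono[of 1 "e / d\<^sup>2 * y\<^sup>2" "y\<^sup>2"] by simp
      also have "\<dots> = e / d\<^sup>2 * y ^ 4" by (simp add: power2_eq_square power4_eq_xxxx)
      also have "\<dots> \<le> e / d\<^sup>2 * (y ^ 2 + y ^ 4)" using e by (intro mult_left_mono) auto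
      finally have "y\<^sup>2 * exp (y\<^sup>2 / 4) \<le> (e / d\<^sup>2 * (y ^ 2 + y ^ 4)) * exp (y\<^sup>2 / 4)"
        by (intro mult_right_mono) auto
      then have "?c * (y\<^sup>2 * exp (y\<^sup>2 / 4)) \<le> ?c * ((e / d\<^sup>2 * (y ^ 2 + y ^ 4)) * exp (y\<^sup>2 / 4))"
        by (rule mult_left_mono[OF _ c0])
      then show ?thesis by (simp only: mult.assoc)
    qed
    moreover have "0 \<le> ?c * (e / d\<^sup>2) * ((y ^ 2 + y ^ 4) * exp (y\<^sup>2 / 4))"
      by (intro mult_nonneg_nonneg[OF c1]) auto
    ultimately show "g y \<le> ?c * (e / d\<^sup>2) * ((y ^ 2 + y ^ 4) * exp (y\<^sup>2 / 4))"
      using key[of y] by auto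
  qed
  then show "A z - ou e A z \<le> L2 * exp (2 * b\<^sup>2) * I * e\<^sup>2 / (min (b - z) b)\<^sup>2"
    by (simp add: d_def power2_eq_square mult_ac)
qed

text \<open>The slope is at most \<open>L1 * exp (p\<^sup>2)\<close> on the negative part of the
  interval and at most \<open>1\<close> on the rest; adding the two slopes covers intervals that
  contain \<open>0\<close>.\<close>

lemma A_increment_le:
  assumes "p < q" "p < 0"
  shows "A q - A p \<le> (q - p) * (1 + L1 * exp (p\<^sup>2))"
proof -
  have neg: "A s - A p \<le> (s - p) * (L1 * exp (p\<^sup>2))" if s: "p < s" "s \<le> 0" for s
  proof -
    have "\<exists>y>p. y < s \<and> h s - h p = (s - p) * (y * h y + (1 - b\<^sup>2))"
      by (rule MVT2[OF s(1)]) (auto intro!: h_has_real_derivative)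
    then obtain y where y: "p < y" "y < s" "h s - h p = (s - p) * (y * h y + (1 - b\<^sup>2))" by auto
    have "y\<^sup>2 \<le> p\<^sup>2" using y s by (auto simp: abs_le_square_iff[symmetric])
    then have "L1 * exp (y\<^sup>2) \<le> L1 * exp (p\<^sup>2)"
      using L1_nonneg by (intro mult_left_mono) auto
    then have "y * h y + (1 - b\<^sup>2) \<le> L1 * exp (p\<^sup>2)"
      using abs_deriv_h_le[of y] by linarith
    then have "h s - h p \<le> (s - p) * (L1 * exp (p\<^sup>2))"
      unfolding y(3) using s by (intro mult_left_mono) auto
    then show ?thesis using s b assms by (simp add: A_def)
  qed
  have L: "0 \<le> L1 * exp (p\<^sup>2)" using L1_nonneg by simp
  show ?thesis
  proof (cases "q \<le> 0")
    case True
    then show ?thesis using neg[of q] assms by (simp add: distrib_left)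
  next
    case False
    then have "A q - A 0 \<le> q" "A 0 - A p \<le> - p * (L1 * exp (p\<^sup>2))" "0 \<le> q * (L1 * exp (p\<^sup>2))"
      using A_slope[of 0 q] neg[of 0] assms L by auto
    then show ?thesis using assms by (simp add: algebra_simps)
  qed
qed

text \<open>Coefficient of the \<open>e\<^sup>2\<close> correction in \<open>ou_A_le\<close>. The
  factor \<open>4 / b ^ 4\<close> stems from \<open>b ^ 4 \<le> 4 * e\<^sup>2 * y ^ 4\<close>, which
  holds whenever a step from \<open>b\<close> lands below \<open>0\<close>.\<close>

definition K2 :: real where
  "K2 = 4 * L1 / b ^ 4 * (\<integral>y. y ^ 4 * exp (y\<^sup>2 / 4) \<partial>std_normal_distribution)"

lemma K2_nonneg: "0 \<le> K2"
  unfolding K2_def using L1_nonneg b by (intro mult_nonneg_nonneg Bochner_Integration.integral_nonneg) auto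

text \<open>For \<open>z \<ge> b\<close> the chains from \<open>z\<close> and from \<open>b\<close>
  are driven by the same normal variable. From \<open>b\<close> one has
  \<open>ou e A b \<le> ou e h b = b\<close>. The two new positions differ by
  \<open>r * (z - b)\<close>, and \<open>A\<close> grows with slope at most \<open>1\<close> between
  them unless the lower one is negative, which adds only order \<open>e\<^sup>2\<close>. With the
  prefactor of \<open>ou\<close> the increment is at most
  \<open>(1 - e) * (1 + e\<^sup>2 * K2)\<close> times \<open>z - b\<close>, and this factor does not
  exceed \<open>1\<close> once \<open>e * K2 \<le> 1\<close>.\<close>

lemma ou_A_le:
  assumes e: "0 < e" "e \<le> 1 / 8" "e * K2 \<le> 1"
  shows "ou e A z \<le> A z"
proof (cases "z < b")
  case True
  then show ?thesis using defect_nonneg[OF e(1,2) True] by simp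
next
  case False
  define r where "r = sqrt (1 - e)"
  have e1: "e < 1" using e by simp
  have r: "0 < r" "r \<le> 1" "r * r = 1 - e" using e by (auto simp: r_def)
  have zb: "b \<le> z" using False by simp
  have ptw: "A (r * z + sqrt e * y) - A (r * b + sqrt e * y)
      \<le> r * (z - b) * (1 + 4 * L1 / b ^ 4 * e\<^sup>2 * (y ^ 4 * exp (y\<^sup>2 / 4)))" for y
  proof (cases "z = b")
    case False
    then have zb': "b < z" using zb by simp
    define p where "p = r * b + sqrt e * y"
    define q where "q = r * z + sqrt e * y"
    have pq: "p < q" "q - p = r * (z - b)"
      using zb' r by (auto simp: p_def q_def algebra_simps)
    have "0 \<le> 4 * L1 / b ^ 4 * e\<^sup>2 * (y ^ 4 * exp (y\<^sup>2 / 4))"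
      using L1_nonneg b by auto
    then have 1: "1 \<le> 1 + 4 * L1 / b ^ 4 * e\<^sup>2 * (y ^ 4 * exp (y\<^sup>2 / 4))" by simp
    have rzb: "0 \<le> r * (z - b)" using r zb by simp
    show ?thesis
    proof (cases "p < 0")
      case False
      then have "A q - A p \<le> r * (z - b) * 1"
        using A_slope[of p q] pq by simp
      also have "\<dots> \<le> r * (z - b) * (1 + 4 * L1 / b ^ 4 * e\<^sup>2 * (y ^ 4 * exp (y\<^sup>2 / 4)))"
        by (rule mult_left_mono[OF 1 rzb])
      finally show ?thesis by (simp add: p_def q_def)
    next
      case True
      have sq: "(sqrt e * y)\<^sup>2 = e * y\<^sup>2" using e by (simp add: power_mult_distrib)
      have rb: "0 < r * b" using r b by simp
      have "p\<^sup>2 \<le> (sqrt e * y)\<^sup>2"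
        using True rb by (subst abs_le_square_iff[symmetric]) (auto simp: p_def)
      also have "\<dots> \<le> y\<^sup>2 / 4"
      proof -
        have "e * y\<^sup>2 \<le> 1 / 8 * y\<^sup>2" using e by (intro mult_right_mono) auto
        moreover have "0 \<le> y\<^sup>2" by simp
        ultimately show ?thesis unfolding sq by linarith
      qed
      finally have p2: "p\<^sup>2 \<le> y\<^sup>2 / 4" .
      have "(r * b)\<^sup>2 \<le> (sqrt e * y)\<^sup>2"
        using True rb by (subst abs_le_square_iff[symmetric]) (auto simp: p_def)
      then have "(1 - e) * b\<^sup>2 \<le> e * y\<^sup>2"
        using r unfolding sq by (simp add: power2_eq_square mult_ac)
      moreover have "1 / 2 * b\<^sup>2 \<le> (1 - e) * b\<^sup>2" using e by (intro mult_right_mono) auto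
      ultimately have "b\<^sup>2 \<le> 2 * (e * y\<^sup>2)" by simp
      then have "(b\<^sup>2)\<^sup>2 \<le> (2 * (e * y\<^sup>2))\<^sup>2" by (intro power_mono) auto
      then have "b ^ 4 \<le> 4 * e\<^sup>2 * y ^ 4" by (simp add: power_mult_distrib flip: power_mult)
      then have big: "1 \<le> 4 / b ^ 4 * e\<^sup>2 * y ^ 4" using b by (simp add: field_simps)
      have "L1 * exp (p\<^sup>2) \<le> (4 / b ^ 4 * e\<^sup>2 * y ^ 4) * (L1 * exp (p\<^sup>2))"
        using L1_nonneg mult_right_mono[OF big, of "L1 * exp (p\<^sup>2)"] by simp
      also have "\<dots> \<le> (4 / b ^ 4 * e\<^sup>2 * y ^ 4) * (L1 * exp (y\<^sup>2 / 4))"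
        using L1_nonneg p2 big by (intro mult_left_mono) auto
      finally have "L1 * exp (p\<^sup>2) \<le> 4 * L1 / b ^ 4 * e\<^sup>2 * (y ^ 4 * exp (y\<^sup>2 / 4))"
        by (simp add: mult_ac)
      then have "r * (z - b) * (1 + L1 * exp (p\<^sup>2))
          \<le> r * (z - b) * (1 + 4 * L1 / b ^ 4 * e\<^sup>2 * (y ^ 4 * exp (y\<^sup>2 / 4)))"
        by (intro mult_left_mono[OF _ rzb]) auto
      then show ?thesis
        using A_increment_le[OF pq(1) True] unfolding pq(2) by (simp add: p_def q_def)
    qed
  qed simp
  interpret N: prob_space std_normal_distribution by (rule prob_space_std_normal)
  note iA = integrable_ou_A[OF e(1) e1, folded r_def]
  have i4: "integrable std_normal_distribution (\<lambda>y. 4 * L1 / b ^ 4 * e\<^sup>2 * (y ^ 4 * exp (y\<^sup>2 / 4)))"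
    by (intro integrable_mult_right integrable_std_normal_power_exp)
  have "(\<integral>y. A (r * z + sqrt e * y) \<partial>std_normal_distribution) - (\<integral>y. A (r * b + sqrt e * y) \<partial>std_normal_distribution)
    = (\<integral>y. A (r * z + sqrt e * y) - A (r * b + sqrt e * y) \<partial>std_normal_distribution)"
    by (intro Bochner_Integration.integral_diff[symmetric] iA)
  also have "\<dots> \<le> (\<integral>y. r * (z - b) * (1 + 4 * L1 / b ^ 4 * e\<^sup>2 * (y ^ 4 * exp (y\<^sup>2 / 4))) \<partial>std_normal_distribution)"
    by (intro integral_mono Bochner_Integration.integrable_diff iA ptw integrable_mult_right
        Bochner_Integration.integrable_add i4) simp
  also have "\<dots> = r * (z - b) * (1 + e\<^sup>2 * K2)"
  proof -
    have "(\<integral>y. 1 + 4 * L1 / b ^ 4 * e\<^sup>2 * (y ^ 4 * exp (y\<^sup>2 / 4)) \<partial>std_normal_distribution) = 1 + e\<^sup>2 * K2"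
      by (subst Bochner_Integration.integral_add)
         (use i4 N.prob_space in \<open>auto simp: K2_def mult_ac\<close>)
    then show ?thesis by simp
  qed
  finally have "ou e A z - ou e A b \<le> r * (r * (z - b) * (1 + e\<^sup>2 * K2))"
    unfolding ou_def r_def[symmetric] right_diff_distrib[symmetric]
    using r by (intro mult_left_mono) auto
  also have "\<dots> = (z - b) * ((1 - e) * (1 + e\<^sup>2 * K2))"
    unfolding r(3)[symmetric] by (simp only: mult_ac)
  also have "\<dots> \<le> (z - b) * 1"
  proof (rule mult_left_mono)
    have "e\<^sup>2 * K2 \<le> e * 1"
      using e mult_left_mono[OF e(3), of e] by (simp add: power2_eq_square mult.assoc)
    then have "(1 - e) * (1 + e\<^sup>2 * K2) \<le> (1 - e) * (1 + e)"
      using e by (intro mult_left_mono) auto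
    also have "\<dots> \<le> 1" using e by (simp add: algebra_simps)
    finally show "(1 - e) * (1 + e\<^sup>2 * K2) \<le> 1" .
  qed (use zb in simp)
  finally have "ou e A z - ou e A b \<le> z - b" by simp
  moreover have "ou e A b \<le> b"
  proof -
    have "ou e A b \<le> ou e h b"
      unfolding ou_def r_def[symmetric] using r
      by (intro mult_left_mono integral_mono iA integrable_ou_h[OF e(1) e1, folded r_def] A_le_h) auto
    then show ?thesis by (simp add: ou_h[OF e(1) e1] h_b)
  qed
  ultimately show ?thesis using False by (simp add: A_def)
qed

end

section \<open>The constants and the value functions\<close>

lemma std_normal_density_pos: "0 < std_normal_density z"
  by (rule normal_density_pos) simp

lemma psi_mult_density: "psi z * std_normal_density z = Phi z"
proof -
  have "psi z * std_normal_density z = exp (z\<^sup>2 / 2) * exp (- z\<^sup>2 / 2) * Phi z"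
    by (simp add: psi_eq std_normal_density_def)
  also have "\<dots> = Phi z"
    by (simp add: exp_add[symmetric])
  finally show ?thesis .
qed

text \<open>This is \<open>(1 - y\<^sup>2) * psi y - y\<close> multiplied by the normal density at
  \<open>y\<close>. Both constants are level points of it: \<open>Bstar\<close> is its positive
  zero, and \<open>u C = 0\<close> means that \<open>fit (- C)\<close> equals
  \<open>1 - Bstar\<^sup>2\<close>. The simple derivative \<open>- 2 * y * Phi y\<close> gives
  uniqueness on the nonnegative half line.\<close>

definition fit :: "real \<Rightarrow> real" where
  "fit y = (1 - y\<^sup>2) * Phi y - y * std_normal_density y"

lemma fit_has_real_derivative: "(fit has_real_derivative - 2 * y * Phi y) (at y)"
proof -
  have "((\<lambda>y. 1 / sqrt (2 * pi) * exp (- y\<^sup>2 / 2)) has_real_derivative - y * (1 / sqrt (2 * pi) * exp (- y\<^sup>2 / 2))) (at y)"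
    by (intro DERIV_cong[OF DERIV_cmult[OF DERIV_fun_exp[OF DERIV_cdivide[OF DERIV_minus[OF DERIV_power[OF DERIV_ident]]]]]]) simp
  then have d: "(std_normal_density has_real_derivative - y * std_normal_density y) (at y)"
    by (simp only: std_normal_density_def[abs_def])
  show ?thesis
    unfolding fit_def[abs_def]
    by (rule derivative_eq_intros Phi_has_real_derivative d refl)+
       (simp add: power2_eq_square algebra_simps)
qed

lemma fit_strict_antimono:
  assumes "0 \<le> y" "y < z"
  shows "fit z < fit y"
proof -
  have "\<exists>x>y. x < z \<and> fit z - fit y = (z - y) * (- 2 * x * Phi x)"
    by (rule MVT2[OF assms(2)]) (rule fit_has_real_derivative)
  then obtain x where x: "y < x" "x < z" "fit z - fit y = (z - y) * (- 2 * x * Phi x)" by auto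
  have "0 < Phi x" using Phi_ge_half[of x] x assms by simp
  then have "0 < (z - y) * (2 * x * Phi x)"
    using x assms by (intro mult_pos_pos) auto
  moreover have "(z - y) * (- 2 * x * Phi x) = - ((z - y) * (2 * x * Phi x))" by simp
  ultimately show ?thesis using x(3) by linarith
qed

lemma fit_inj: "0 \<le> y \<Longrightarrow> 0 \<le> z \<Longrightarrow> fit y = fit z \<Longrightarrow> y = z"
  using fit_strict_antimono[of y z] fit_strict_antimono[of z y] by (cases y z rule: linorder_cases) auto

lemma isCont_fit: "isCont fit y"
  using fit_has_real_derivative by (rule DERIV_isCont)

lemma fit_0: "fit 0 = 1 / 2"
  by (simp add: fit_def Phi_0)

lemma fit_1_neg: "fit 1 < 0"
  using std_normal_density_pos[of 1] by (simp add: fit_def)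

text \<open>The point \<open>1 / sqrt 2\<close> is chosen to yield
  \<open>Bstar\<^sup>2 > 1 / 2\<close>, which puts the level \<open>1 - Bstar\<^sup>2\<close> below
  \<open>fit 0 = 1 / 2\<close>. The bounds \<open>exp (- (1 / 4)) \<le> 4 / 5\<close> and
  \<open>sqrt pi \<ge> 17 / 10\<close> are just sharp enough for the purpose, since
  \<open>4 / 5\<close> is less than half of \<open>17 / 10\<close>.\<close>

lemma fit_inv_sqrt2_pos: "0 < fit (1 / sqrt 2)"
proof -
  have "exp (- (1 / 4) :: real) \<le> 4 / 5"
  proof -
    have "1 + 1 / 4 \<le> exp (1 / 4 :: real)" by (rule exp_ge_add_one_self)
    then have "1 / exp (1 / 4 :: real) \<le> 1 / (1 + 1 / 4)" by (intro divide_left_mono) auto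
    then show ?thesis by (simp add: exp_minus inverse_eq_divide)
  qed
  moreover have "17 / 10 \<le> sqrt pi"
    by (rule real_le_rsqrt) (use pi_gt3 in \<open>simp add: power2_eq_square\<close>)
  ultimately have lt: "exp (- (1 / 4)) < 1 / 2 * sqrt pi" by simp
  have "1 / sqrt 2 * std_normal_density (1 / sqrt 2) = exp (- (1 / 4)) / (2 * sqrt pi)"
    by (simp add: std_normal_density_def real_sqrt_mult power_divide)
  also have "\<dots> < 1 / 2 * (1 / 2)"
    using lt by (simp add: field_simps)
  also have "\<dots> \<le> 1 / 2 * Phi (1 / sqrt 2)"
    using Phi_ge_half[of "1 / sqrt 2"] by (intro mult_left_mono) auto
  finally show ?thesis by (simp add: fit_def power_divide)
qed

lemma Bstar_eq_iff:
  "sqrt (2 * pi) * (1 - z\<^sup>2) * exp (z\<^sup>2 / 2) * Phi z = z \<longleftrightarrow> fit z = 0"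
proof -
  have "sqrt (2 * pi) * (1 - z\<^sup>2) * exp (z\<^sup>2 / 2) * Phi z = z \<longleftrightarrow> (1 - z\<^sup>2) * psi z = z"
    by (simp add: psi_eq mult_ac)
  also have "\<dots> \<longleftrightarrow> ((1 - z\<^sup>2) * psi z) * std_normal_density z = z * std_normal_density z"
    using std_normal_density_pos[of z] by (simp only: mult_cancel_right) auto
  also have "((1 - z\<^sup>2) * psi z) * std_normal_density z = (1 - z\<^sup>2) * Phi z"
    by (simp only: mult.assoc psi_mult_density)
  finally show ?thesis by (simp add: fit_def)
qed

lemma Bstar_bounds: "1 / sqrt 2 < Bstar" "Bstar < 1" and fit_Bstar: "fit Bstar = 0"
proof -
  have "\<exists>B\<ge>1 / sqrt 2. B \<le> 1 \<and> fit B = 0"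
    by (rule IVT2) (use fit_1_neg fit_inv_sqrt2_pos in \<open>auto simp: isCont_fit\<close>)
  then obtain B where B: "1 / sqrt 2 \<le> B" "B \<le> 1" "fit B = 0" by auto
  have pos: "0 < 1 / sqrt (2::real)" by simp
  have B0: "0 < B" using pos B(1) by (rule less_le_trans)
  have "Bstar = B"
    unfolding Bstar_def Bstar_eq_iff
  proof (rule the_equality)
    show "0 < B \<and> fit B = 0" using B0 B by simp
    show "B' = B" if "0 < B' \<and> fit B' = 0" for B'
      by (rule fit_inj) (use that B0 B in auto)
  qed
  moreover have "B \<noteq> 1" "B \<noteq> 1 / sqrt 2" using B fit_1_neg fit_inv_sqrt2_pos by auto
  ultimately show "1 / sqrt 2 < Bstar" "Bstar < 1" "fit Bstar = 0" using B by auto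
qed

lemma Bstar_pos: "0 < Bstar"
  using Bstar_bounds(1) by (rule less_trans[rotated]) simp

lemma Bstar_square: "1 / 2 < Bstar\<^sup>2" "Bstar\<^sup>2 < 1"
proof -
  have "(1 / sqrt 2)\<^sup>2 < Bstar\<^sup>2" using Bstar_bounds(1) by (intro power_strict_mono) auto
  then show "1 / 2 < Bstar\<^sup>2" by (simp add: power_divide)
  show "Bstar\<^sup>2 < 1" using Bstar_bounds(2) Bstar_pos by (simp add: power_less_one_iff)
qed

lemma u_eq_fit: "u C = 1 - Bstar\<^sup>2 - fit (- C)"
  by (simp add: u_def fit_def std_normal_density_def)

definition c_star :: real where "c_star = - Cstar"

text \<open>The level \<open>1 - Bstar\<^sup>2\<close> lies strictly between
  \<open>fit Bstar = 0\<close> and \<open>fit 0 = 1 / 2\<close>. The bound by \<open>Bstar\<close>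
  keeps the two barriers apart and makes the coefficient
  \<open>Bstar\<^sup>2 - c_star\<^sup>2\<close> positive.\<close>

lemma c_star_bounds: "0 < c_star" "c_star < Bstar" and fit_c_star: "fit c_star = 1 - Bstar\<^sup>2"
proof -
  have "\<exists>c\<ge>0. c \<le> Bstar \<and> fit c = 1 - Bstar\<^sup>2"
    by (rule IVT2) (use Bstar_square Bstar_pos in \<open>auto simp: isCont_fit fit_0 fit_Bstar\<close>)
  then obtain c where c: "0 \<le> c" "c \<le> Bstar" "fit c = 1 - Bstar\<^sup>2" by auto
  have ne: "c \<noteq> 0" "c \<noteq> Bstar" using c Bstar_square fit_0 fit_Bstar by auto
  have "Cstar = - c"
    unfolding Cstar_def u_eq_fit
  proof (rule the_equality)
    show "- c < 0 \<and> 1 - Bstar\<^sup>2 - fit (- (- c)) = 0" using c ne by simp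
    show "C = - c" if "C < 0 \<and> 1 - Bstar\<^sup>2 - fit (- C) = 0" for C
      using fit_inj[of "- C" c] that c by simp
  qed
  then have "c_star = c" by (simp add: c_star_def)
  then show "0 < c_star" "c_star < Bstar" "fit c_star = 1 - Bstar\<^sup>2"
    using c ne by auto
qed

lemma Cstar_eq: "Cstar = - c_star"
  by (simp add: c_star_def)

text \<open>The equation \<open>fit c_star = 1 - Bstar\<^sup>2\<close> makes the numerator a
  multiple of \<open>Phi c_star\<close>. This identifies the constant in \<open>Vstar\<close> with
  the coefficient of the reflected invariant function.\<close>

lemma v_Cstar: "v Cstar = Bstar\<^sup>2 - c_star\<^sup>2"
proof -
  have pos: "0 < Phi c_star" using Phi_ge_half[of c_star] c_star_bounds(1) by simp
  have "v Cstar = 1 / Phi c_star * ((1 - Bstar\<^sup>2) * (1 - Phi c_star) + c_star * std_normal_density c_star)"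
    by (simp add: v_def Cstar_eq Phi_uminus std_normal_density_def)
  also have "(1 - Bstar\<^sup>2) * (1 - Phi c_star) + c_star * std_normal_density c_star
      = (Bstar\<^sup>2 - c_star\<^sup>2) * Phi c_star"
    using fit_c_star by (simp add: fit_def algebra_simps)
  finally show ?thesis using pos by simp
qed

lemma c_star_square: "c_star\<^sup>2 < Bstar\<^sup>2"
  using c_star_bounds by (intro power_strict_mono) auto

interpretation FU: smooth_fit "1 - Bstar\<^sup>2" 0 Bstar
proof
  have "sqrt (2 * pi) * (1 - Bstar\<^sup>2) * exp (Bstar\<^sup>2 / 2) * Phi Bstar = Bstar"
    using Bstar_eq_iff[of Bstar] fit_Bstar by blast
  then show "(1 - Bstar\<^sup>2) * psi Bstar + 0 * psi (- Bstar) = Bstar"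
    by (simp add: psi_eq mult_ac)
qed (use Bstar_square Bstar_pos in auto)

text \<open>In the reflected variable \<open>w = - z\<close>, the first coefficient belongs to the
  value before the first stop and the second to the subtracted part
  \<open>(1 - Bstar\<^sup>2) * psi z\<close>. The fit equation is continuity of \<open>GV\<close> at
  \<open>Cstar\<close>; the relation between the coefficients matches the slopes there.\<close>

interpretation FV: smooth_fit "Bstar\<^sup>2 - c_star\<^sup>2" "Bstar\<^sup>2 - 1" c_star
proof
  have "psi (- c_star) * std_normal_density c_star = 1 - Phi c_star"
    using psi_mult_density[of "- c_star"] by (simp add: Phi_uminus std_normal_density_def)
  then have "((Bstar\<^sup>2 - c_star\<^sup>2) * psi c_star + (Bstar\<^sup>2 - 1) * psi (- c_star)) * std_normal_density c_star
      = (Bstar\<^sup>2 - c_star\<^sup>2) * Phi c_star - (1 - Bstar\<^sup>2) * (1 - Phi c_star)"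
    by (simp only: distrib_right mult.assoc psi_mult_density) (simp add: algebra_simps)
  also have "\<dots> = c_star * std_normal_density c_star"
    using fit_c_star by (simp add: fit_def algebra_simps)
  finally show "(Bstar\<^sup>2 - c_star\<^sup>2) * psi c_star + (Bstar\<^sup>2 - 1) * psi (- c_star) = c_star"
    using std_normal_density_pos[of c_star] by (simp only: mult_cancel_right) auto
qed (use c_star_bounds c_star_square Bstar_square in auto)

section \<open>The two value functions in the coordinate \<open>Z\<close>\<close>

definition GU :: "real \<Rightarrow> real" where
  "GU z = (if z < Bstar then (1 - Bstar\<^sup>2) * psi z else z)"

definition GV :: "real \<Rightarrow> real" where
  "GV z = (if z > Cstar then (Bstar\<^sup>2 - c_star\<^sup>2) * psi (- z) else (1 - Bstar\<^sup>2) * psi z - z)"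

lemma GU_eq: "GU = FU.A"
  by (simp add: fun_eq_iff GU_def FU.A_def FU.h_def)

lemma GV_eq: "GV z = FV.A (- z) + (1 - Bstar\<^sup>2) * psi z"
  by (auto simp: GV_def FV.A_def FV.h_def Cstar_eq algebra_simps)

lemma continuous_on_GU: "continuous_on UNIV GU"
  unfolding GU_eq by (rule FU.continuous_on_A)

lemma continuous_on_GV: "continuous_on UNIV GV"
  unfolding GV_eq[abs_def]
  by (intro continuous_intros continuous_on_psi continuous_on_compose2[OF FV.continuous_on_A]) auto

lemma U_eq:
  assumes "t < 1"
  shows "U t x = sqrt (1 - t) * GU (x / sqrt (1 - t))"
proof -
  have "x / sqrt (1 - t) < Bstar \<longleftrightarrow> x < Bstar * sqrt (1 - t)"
    using assms by (simp add: pos_divide_less_eq)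
  moreover have "sqrt (2 * pi * (1 - t)) = sqrt (2 * pi) * sqrt (1 - t)"
    by (simp only: real_sqrt_mult)
  moreover have "(x / sqrt (1 - t))\<^sup>2 / 2 = x\<^sup>2 / (2 * (1 - t))"
    using assms by (simp add: power_divide)
  ultimately show ?thesis
    using assms by (simp only: U_def GU_def psi_eq) simp
qed

lemma Vstar_eq:
  assumes "t < 1"
  shows "Vstar t x = sqrt (1 - t) * GV (x / sqrt (1 - t))"
proof (cases "x > Cstar * sqrt (1 - t)")
  case True
  then show ?thesis
    using assms
    by (auto simp: Vstar_def GV_def psi_eq v_Cstar power_divide field_simps)
next
  case False
  have s: "0 < sqrt (1 - t)" using assms by simp
  have z: "x / sqrt (1 - t) \<le> Cstar" using False s by (simp add: field_simps)
  moreover have "Cstar < Bstar" using c_star_bounds by (simp add: Cstar_eq)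
  ultimately have "x / sqrt (1 - t) < Bstar" by simp
  then show ?thesis
    using False z s assms by (simp add: Vstar_def f_def U_eq GU_def GV_def right_diff_distrib)
qed

lemma GU_nonneg: "0 \<le> GU z"
  using Bstar_square Bstar_pos psi_nonneg[of z] by (auto simp: GU_def)

lemma GU_le: "GU z \<le> 1 + \<bar>z\<bar>"
proof (cases "z < Bstar")
  case True
  then have "FU.h z \<le> Bstar" using FU.h_mono[of z Bstar] by (simp add: FU.h_b)
  then show ?thesis using True Bstar_bounds by (simp add: GU_def FU.h_def)
qed (simp add: GU_def)

lemma GU_ge: "z \<le> GU z"
proof (cases "0 \<le> z")
  case True
  then show ?thesis using FU.gap_nonneg[of z] by (simp add: GU_def FU.h_def)
qed (use GU_nonneg[of z] in simp)

lemma GV_nonneg: "0 \<le> GV z"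
proof (cases "z > Cstar")
  case True
  then show ?thesis using c_star_square psi_nonneg[of "- z"] by (simp add: GV_def)
next
  case False
  then have "z < 0" using c_star_bounds by (simp add: Cstar_eq)
  moreover have "0 \<le> (1 - Bstar\<^sup>2) * psi z" using Bstar_square psi_nonneg[of z] by simp
  ultimately show ?thesis using False by (simp add: GV_def)
qed

text \<open>The two summands in \<open>GV_eq\<close> grow like \<open>exp (z\<^sup>2 / 2)\<close> at
  plus infinity with opposite signs and cancel. Linear growth is what the limit needs, because the
  only uniform control at stopping times is on second moments of \<open>X\<close>.\<close>

lemma GV_le: "GV z \<le> (psi c_star + psi 0) + \<bar>z\<bar>"
proof (cases "z > Cstar")
  case True
  have "Bstar\<^sup>2 - c_star\<^sup>2 \<le> 1" using Bstar_square zero_le_power2[of c_star] by linarith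
  then have "(Bstar\<^sup>2 - c_star\<^sup>2) * psi (- z) \<le> 1 * psi c_star"
    using True psi_nonneg by (intro mult_mono psi_mono) (auto simp: Cstar_eq)
  then show ?thesis using True psi_nonneg[of 0] by (simp add: GV_def)
next
  case False
  then have "z < 0" using c_star_bounds by (simp add: Cstar_eq)
  then have "(1 - Bstar\<^sup>2) * psi z \<le> 1 * psi 0"
    using Bstar_square psi_nonneg by (intro mult_mono psi_mono) auto
  then show ?thesis using False psi_nonneg[of c_star] by (simp add: GV_def)
qed

text \<open>The value of the outer problem must dominate its reward. At and below
  \<open>Cstar\<close> both sides agree, on \<open>(Cstar, 0]\<close> the gap inequality of
  \<open>FV\<close> applies after reflection, and from \<open>Bstar\<close> on the reward is
  \<open>0\<close>. Only \<open>(0, Bstar)\<close> needs a new argument, since the reflected point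
  is then negative and outside the reach of \<open>gap_nonneg\<close>.\<close>

lemma GU_minus_id_le_GV: "GU z - z \<le> GV z"
proof -
  have k: "GU z = (1 - Bstar\<^sup>2) * psi z" if "z < Bstar" using that by (simp add: GU_def)
  consider "z \<le> Cstar" | "Cstar < z" "z \<le> 0" | "0 < z" "z < Bstar" | "Bstar \<le> z" by linarith
  then show ?thesis
  proof cases
    case 1
    then show ?thesis using c_star_bounds by (simp add: GV_def GU_def Cstar_eq)
  next
    case 2
    then have "- z \<le> FV.h (- z)" by (intro FV.gap_nonneg) simp
    then show ?thesis using 2 Bstar_pos by (simp add: GV_def GU_def FV.h_def algebra_simps)
  next
    case 3
    \<comment> \<open>Expanded,
      \<open>J w = FU.h w - (Bstar\<^sup>2 - c_star\<^sup>2) * psi (- w)\<close>, so the claim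
      becomes \<open>J z \<le> z\<close>.\<close>
    define J where "J w = - FV.h (- w)" for w
    have dJ: "(J has_real_derivative w * J w + (1 - c_star\<^sup>2)) (at w)" for w
    proof -
      have "((\<lambda>w. FV.h (- w)) has_real_derivative ((- w) * FV.h (- w) + (1 - c_star\<^sup>2)) * (- 1)) (at w)"
        by (rule DERIV_chain2[where f=FV.h, OF FV.h_has_real_derivative]) (auto intro!: derivative_eq_intros)
      from DERIV_minus[OF this] show ?thesis by (simp add: J_def[abs_def] algebra_simps)
    qed
    have mono: "J w \<le> J w'" if "w \<le> w'" for w w' using FV.h_mono[of "- w'" "- w"] that by (simp add: J_def)
    have J0: "J 0 \<le> 0" using FV.gap_nonneg[of 0] by (simp add: J_def)
    have "J Bstar = FU.h Bstar - (Bstar\<^sup>2 - c_star\<^sup>2) * psi (- Bstar)"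
      by (simp add: J_def FV.h_def FU.h_def algebra_simps)
    moreover have "0 \<le> (Bstar\<^sup>2 - c_star\<^sup>2) * psi (- Bstar)" using c_star_square psi_nonneg by simp
    ultimately have JB: "J Bstar \<le> Bstar" using FU.h_b by simp
    \<comment> \<open>If \<open>J z > z\<close>, then the mean slope of \<open>J\<close> over
      \<open>[0, z]\<close> exceeds \<open>1\<close> because \<open>J 0 \<le> 0\<close>, so
      \<open>x * J x > c_star\<^sup>2\<close> for some \<open>x\<close> in between. The product only
      increases to the right of \<open>x\<close>, so the slope stays at least \<open>1\<close> up to
      \<open>Bstar\<close>, and \<open>J Bstar > Bstar\<close> would follow.\<close>
    have "J z \<le> z"
    proof (rule ccontr)
      assume "\<not> J z \<le> z"
      then have Jz: "z < J z" by simp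
      have "\<exists>x>0. x < z \<and> J z - J 0 = (z - 0) * (x * J x + (1 - c_star\<^sup>2))"
        by (rule MVT2[OF 3(1)]) (rule dJ)
      then obtain x where x: "0 < x" "x < z" "J z - J 0 = z * (x * J x + (1 - c_star\<^sup>2))" by auto
      have "z * 1 < z * (x * J x + (1 - c_star\<^sup>2))" unfolding x(3)[symmetric] using Jz J0 by simp
      then have xJ: "c_star\<^sup>2 < x * J x" using 3 by (simp only: mult_less_cancel_left_pos)
      then have "0 < x * J x" using zero_le_power2[of c_star] by linarith
      then have Jx: "0 < J x" using x(1) by (simp add: zero_less_mult_iff)
      have "\<exists>y>z. y < Bstar \<and> J Bstar - J z = (Bstar - z) * (y * J y + (1 - c_star\<^sup>2))"
        by (rule MVT2[OF 3(2)]) (rule dJ)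
      then obtain y where y: "z < y" "y < Bstar" "J Bstar - J z = (Bstar - z) * (y * J y + (1 - c_star\<^sup>2))" by auto
      have "x * J x \<le> y * J y"
        using x y Jx mono[of x y] by (intro mult_mono) auto
      then have "(Bstar - z) * 1 \<le> J Bstar - J z"
        unfolding y(3) using xJ 3 by (intro mult_left_mono) auto
      then show False using Jz JB by simp
    qed
    then show ?thesis using 3 c_star_bounds by (simp add: GV_def GU_def J_def FV.h_def Cstar_eq algebra_simps)
  next
    case 4
    then show ?thesis using GV_nonneg[of z] by (simp add: GU_def)
  qed
qed

section \<open>Superharmonicity and quantitative harmonicity under small steps\<close>

definition superharmonic :: "(real \<Rightarrow> real) \<Rightarrow> bool" where
  "superharmonic G \<longleftrightarrow> (\<exists>e0>0. \<forall>e z. 0 < e \<longrightarrow> e \<le> e0 \<longrightarrow> ou e G z \<le> G z)"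

text \<open>The set \<open>0 < d z\<close> is the continuation region and \<open>d\<close> a
  truncated distance to its boundary. The bound linear in \<open>e\<close> is summable over a grid
  to a finite total; the quadratic one makes the total vanish as \<open>e\<close> tends to
  \<open>0\<close>, as long as \<open>d\<close> stays away from \<open>0\<close>.\<close>

definition harmonic_where :: "(real \<Rightarrow> real) \<Rightarrow> (real \<Rightarrow> real) \<Rightarrow> bool" where
  "harmonic_where d G \<longleftrightarrow> (\<exists>e0>0. \<exists>K\<ge>0. \<forall>e z. 0 < e \<longrightarrow> e \<le> e0 \<longrightarrow> 0 < d z \<longrightarrow>
     0 \<le> G z - ou e G z \<and> G z - ou e G z \<le> K * e \<and> G z - ou e G z \<le> K * e\<^sup>2 / (d z)\<^sup>2)"

lemma (in smooth_fit) superharmonic_A: "superharmonic A"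
  unfolding superharmonic_def
proof (intro exI[of _ "min (1 / 8) (1 / (K2 + 1))"] conjI allI impI)
  show "0 < min (1 / 8) (1 / (K2 + 1))" using K2_nonneg by simp
  fix e z :: real assume e: "0 < e" "e \<le> min (1 / 8) (1 / (K2 + 1))"
  then have "e * (K2 + 1) \<le> 1" using K2_nonneg by (simp add: field_simps)
  then show "ou e A z \<le> A z" using e by (intro ou_A_le) (auto simp: algebra_simps)
qed

lemma (in smooth_fit) harmonic_where_A: "harmonic_where (\<lambda>z. min (b - z) b) A"
  unfolding harmonic_where_def
proof (rule exI[where x="1 / 8"], intro conjI, simp)
  let ?K = "L2 * exp (2 * b\<^sup>2) * (\<integral>y. (y ^ 2 + y ^ 4) * exp (y\<^sup>2 / 4) \<partial>std_normal_distribution)"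
  show "\<exists>K\<ge>0. \<forall>e z. 0 < e \<longrightarrow> e \<le> 1 / 8 \<longrightarrow> 0 < min (b - z) b \<longrightarrow>
     0 \<le> A z - ou e A z \<and> A z - ou e A z \<le> K * e \<and> A z - ou e A z \<le> K * e\<^sup>2 / (min (b - z) b)\<^sup>2"
  proof (rule exI[where x="?K"], intro conjI allI impI)
    show "0 \<le> ?K"
      using L2_nonneg by (intro mult_nonneg_nonneg Bochner_Integration.integral_nonneg) auto
  qed ((rule defect_nonneg defect_le defect_le2; simp)+)
qed

lemma superharmonic_GU: "superharmonic GU"
  unfolding GU_eq by (rule FU.superharmonic_A)

lemma harmonic_where_GU: "harmonic_where (\<lambda>z. min (Bstar - z) Bstar) GU"
  unfolding GU_eq by (rule FU.harmonic_where_A)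

text \<open>The invariant summand drops out of the defect and the operator commutes with reflection,
  so every one-step estimate for \<open>FV.A\<close> carries over to \<open>GV\<close>.\<close>

lemma GV_minus_ou:
  assumes "0 < e" "e < 1"
  shows "GV z - ou e GV z = FV.A (- z) - ou e FV.A (- z)"
proof -
  have i: "integrable std_normal_distribution (\<lambda>y. FV.A (- (sqrt (1 - e) * z + sqrt e * y)))"
    using integrable_std_normal_uminus[of "\<lambda>y. FV.A (- (sqrt (1 - e) * z + sqrt e * y))"]
      FV.integrable_ou_A[OF assms, of "- z"]
    by (simp add: algebra_simps)
  have "ou e GV z = ou e (\<lambda>z. FV.A (- z)) z + (1 - Bstar\<^sup>2) * ou e psi z"
    unfolding ou_def GV_eq
    by (subst Bochner_Integration.integral_add)
       (use i integrable_ou_psi[OF assms, of z] in \<open>auto simp: algebra_simps\<close>)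
  then show ?thesis
    by (simp add: ou_psi[OF assms] ou_uminus GV_eq)
qed

lemma superharmonic_GV: "superharmonic GV"
proof -
  obtain e0 where e0: "e0 > 0" "\<And>e z. 0 < e \<Longrightarrow> e \<le> e0 \<Longrightarrow> ou e FV.A z \<le> FV.A z"
    using FV.superharmonic_A unfolding superharmonic_def by auto
  show ?thesis
    unfolding superharmonic_def
  proof (intro exI[of _ "min e0 (1 / 2)"] conjI allI impI)
    show "ou e GV z \<le> GV z" if "0 < e" "e \<le> min e0 (1 / 2)" for e z
      using GV_minus_ou[of e z] e0(2)[of e "- z"] that by simp
  qed (use e0 in simp)
qed

lemma harmonic_where_GV: "harmonic_where (\<lambda>z. min (z - Cstar) c_star) GV"
proof -
  obtain e0 K where e0: "e0 > 0" "K \<ge> 0" "\<And>e z. 0 < e \<Longrightarrow> e \<le> e0 \<Longrightarrow> 0 < min (c_star - z) c_star \<Longrightarrow>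
     0 \<le> FV.A z - ou e FV.A z \<and> FV.A z - ou e FV.A z \<le> K * e
     \<and> FV.A z - ou e FV.A z \<le> K * e\<^sup>2 / (min (c_star - z) c_star)\<^sup>2"
    using FV.harmonic_where_A unfolding harmonic_where_def by blast
  show ?thesis
    unfolding harmonic_where_def
  proof (rule exI[where x="min e0 (1 / 2)"], rule conjI, use e0 in simp, rule exI[where x=K], intro conjI allI impI)
    fix e z assume e: "0 < e" "e \<le> min e0 (1 / 2)" and z: "0 < min (z - Cstar) c_star"
    have *: "min (z - Cstar) c_star = min (c_star - (- z)) c_star" by (simp add: Cstar_eq add.commute)
    have eq: "GV z - ou e GV z = FV.A (- z) - ou e FV.A (- z)" using e by (intro GV_minus_ou) auto
    show "0 \<le> GV z - ou e GV z" "GV z - ou e GV z \<le> K * e"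
      "GV z - ou e GV z \<le> K * e\<^sup>2 / (min (z - Cstar) c_star)\<^sup>2"
      using e0(3)[of e "- z"] e z unfolding eq * by auto
  qed (use e0 in auto)
qed

section \<open>Gaussian laws\<close>

lemma
  shows integral_std_normal_cos: "(\<integral>y. cos (c * y) \<partial>std_normal_distribution) = exp (- c\<^sup>2 / 2)"
    and integral_std_normal_sin: "(\<integral>y. sin (c * y) \<partial>std_normal_distribution) = 0"
proof -
  interpret N: prob_space std_normal_distribution by (rule prob_space_std_normal)
  have i: "integrable std_normal_distribution (\<lambda>y. iexp (c * y))"
    by (intro N.integrable_iexp) auto
  have eq: "(CLINT y|std_normal_distribution. iexp (c * y)) = complex_of_real (exp (- c\<^sup>2 / 2))"
    using char_std_normal_distribution by (simp add: char_def fun_eq_iff)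
  have "(\<integral>y. Re (iexp (c * y)) \<partial>std_normal_distribution) = exp (- c\<^sup>2 / 2)"
    using integral_Re[OF i] eq by (simp del: of_real_mult of_real_exp)
  then show "(\<integral>y. cos (c * y) \<partial>std_normal_distribution) = exp (- c\<^sup>2 / 2)"
    by (simp add: Re_exp)
  have "(\<integral>y. Im (iexp (c * y)) \<partial>std_normal_distribution) = 0"
    using integral_Im[OF i] eq by (simp del: of_real_mult of_real_exp)
  then show "(\<integral>y. sin (c * y) \<partial>std_normal_distribution) = 0"
    by (simp add: Im_exp)
qed

text \<open>An affine image of one normal variable covers the point mass as well, so that later
  computations need no case split on the variance.\<close>

lemma normal_law_eq_distr:
  assumes "0 \<le> s2"
  shows "normal_law m s2 = distr std_normal_distribution borel (\<lambda>y. m + sqrt s2 * y)"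
proof (cases "s2 = 0")
  case True
  interpret N: prob_space std_normal_distribution by (rule prob_space_std_normal)
  show ?thesis
  proof (rule measure_eqI)
    fix B assume "B \<in> sets (normal_law m s2)"
    then have B: "B \<in> sets borel" using True by (simp add: normal_law_def)
    then show "emeasure (normal_law m s2) B = emeasure (distr std_normal_distribution borel (\<lambda>y. m + sqrt s2 * y)) B"
      using True N.emeasure_space_1 by (cases "m \<in> B") (auto simp: normal_law_def emeasure_distr)
  qed (simp add: True normal_law_def)
next
  case False
  then have s: "0 < sqrt s2" using assms by simp
  interpret N: prob_space std_normal_distribution by (rule prob_space_std_normal)
  have "distributed std_normal_distribution lborel (\<lambda>y. y) (normal_density 0 1)"
    by (auto simp: distributed_def distr_id2)
  from N.normal_density_affine[OF this, of "sqrt s2" m] s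
  have "distributed std_normal_distribution lborel (\<lambda>y. m + sqrt s2 * y) (normal_density m (sqrt s2))"
    by simp
  then have "distr std_normal_distribution lborel (\<lambda>y. m + sqrt s2 * y) = density lborel (normal_density m (sqrt s2))"
    by (simp add: distributed_def)
  moreover have "distr std_normal_distribution lborel (\<lambda>y. m + sqrt s2 * y) = distr std_normal_distribution borel (\<lambda>y. m + sqrt s2 * y)"
    by (rule distr_cong) auto
  ultimately show ?thesis using False by (simp add: normal_law_def)
qed

text \<open>The free phase \<open>a\<close> lets one real formula carry the whole characteristic
  function: \<open>a = 0\<close> gives the real part and \<open>a = - (pi / 2)\<close> the imaginary
  part.\<close>

lemma integral_normal_law_cos:
  assumes "0 \<le> s2"
  shows "(\<integral>y. cos (y + a) \<partial>normal_law m s2) = exp (- s2 / 2) * cos (m + a)"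
proof -
  interpret N: prob_space std_normal_distribution by (rule prob_space_std_normal)
  have i: "integrable std_normal_distribution (\<lambda>y. cos (sqrt s2 * y))"
    "integrable std_normal_distribution (\<lambda>y. sin (sqrt s2 * y))"
    by (auto intro!: N.integrable_const_bound[where B=1])
  have eq: "cos (m + sqrt s2 * y + a) = cos (m + a) * cos (sqrt s2 * y) - sin (m + a) * sin (sqrt s2 * y)" for y
    using cos_add[of "m + a" "sqrt s2 * y"] by (simp add: add_ac)
  have "(\<integral>y. cos (y + a) \<partial>normal_law m s2) = (\<integral>y. cos (m + sqrt s2 * y + a) \<partial>std_normal_distribution)"
    by (simp add: normal_law_eq_distr[OF assms] integral_distr)
  also have "\<dots> = cos (m + a) * exp (- (sqrt s2)\<^sup>2 / 2)"
    unfolding eq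
    by (subst Bochner_Integration.integral_diff)
       (use i integral_std_normal_cos[of "sqrt s2"] integral_std_normal_sin[of "sqrt s2"] in auto)
  finally show ?thesis using assms by simp
qed

lemma
  assumes "0 \<le> s2"
  shows integrable_normal_law_square: "integrable (normal_law m s2) (\<lambda>y. y\<^sup>2)"
    and integral_normal_law_square: "(\<integral>y. y\<^sup>2 \<partial>normal_law m s2) = m\<^sup>2 + s2"
proof -
  interpret N: prob_space std_normal_distribution by (rule prob_space_std_normal)
  have eq: "(m + sqrt s2 * y)\<^sup>2 = m\<^sup>2 + 2 * m * sqrt s2 * y + s2 * y\<^sup>2" for y
    using assms by (simp add: power2_sum power_mult_distrib)
  have i: "integrable std_normal_distribution (\<lambda>y. 2 * m * sqrt s2 * y)"
    "integrable std_normal_distribution (\<lambda>y. s2 * y\<^sup>2)"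
    using integrable_std_normal_power(1)[of 1] integrable_std_normal_power(1)[of 2] by auto
  show "integrable (normal_law m s2) (\<lambda>y. y\<^sup>2)"
    by (simp add: normal_law_eq_distr[OF assms] integrable_distr_eq eq)
       (intro Bochner_Integration.integrable_add i, simp)
  show "(\<integral>y. y\<^sup>2 \<partial>normal_law m s2) = m\<^sup>2 + s2"
    using i integral_std_normal_id integral_std_normal_square N.prob_space
    by (simp add: normal_law_eq_distr[OF assms] integral_distr eq)
qed

subsection \<open>Independence from characteristic functions\<close>

context prob_space
begin

lemma integrable_bounded_real:
  fixes Y :: "'a \<Rightarrow> real"
  assumes "Y \<in> borel_measurable M" "\<And>\<omega>. \<bar>Y \<omega>\<bar> \<le> c"
  shows "integrable M Y"
  using assms by (intro integrable_const_bound[where B=c]) auto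

text \<open>Both weights have the same total mass \<open>w\<close>, by the hypothesis at
  \<open>\<theta> = 0\<close> and \<open>a = 0\<close>. If \<open>w = 0\<close>, both sides vanish;
  otherwise dividing by \<open>w\<close> gives probability densities under which \<open>Y\<close>
  has equal characteristic functions, and uniqueness applies.\<close>

lemma weighted_law_eq:
  fixes Y Z1 Z2 :: "'a \<Rightarrow> real"
  assumes [measurable]: "Y \<in> borel_measurable M" "Z1 \<in> borel_measurable M" "Z2 \<in> borel_measurable M"
    and Z1: "\<And>\<omega>. 0 \<le> Z1 \<omega>" "\<And>\<omega>. Z1 \<omega> \<le> c" and Z2: "\<And>\<omega>. 0 \<le> Z2 \<omega>" "\<And>\<omega>. Z2 \<omega> \<le> c"
    and eq: "\<And>\<theta> a. expectation (\<lambda>\<omega>. Z1 \<omega> * cos (\<theta> * Y \<omega> + a)) = expectation (\<lambda>\<omega>. Z2 \<omega> * cos (\<theta> * Y \<omega> + a))"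
    and B [measurable]: "B \<in> sets borel"
  shows "expectation (\<lambda>\<omega>. Z1 \<omega> * indicator B (Y \<omega>)) = expectation (\<lambda>\<omega>. Z2 \<omega> * indicator B (Y \<omega>))"
proof -
  define w where "w = expectation Z1"
  have i: "integrable M Z1" "integrable M Z2"
    using Z1 Z2 by (auto intro!: integrable_bounded_real[where c=c])
  have w2: "w = expectation Z2" using eq[of 0 0] by (simp add: w_def)
  have w0: "0 \<le> w" unfolding w_def using Z1 by (intro Bochner_Integration.integral_nonneg) auto
  show ?thesis
  proof (cases "w = 0")
    case True
    have z: "expectation (\<lambda>\<omega>. Z \<omega> * indicator B (Y \<omega>)) = 0"
      if [measurable]: "Z \<in> borel_measurable M" and Z: "\<And>\<omega>. 0 \<le> Z \<omega>" "\<And>\<omega>. Z \<omega> \<le> c" "expectation Z = 0" for Z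
    proof (rule antisym)
      have "expectation (\<lambda>\<omega>. Z \<omega> * indicator B (Y \<omega>)) \<le> expectation Z"
        by (intro integral_mono integrable_bounded_real[where c=c])
           (use Z order_trans[OF Z(1) Z(2)] in \<open>auto simp: indicator_def\<close>)
      then show "expectation (\<lambda>\<omega>. Z \<omega> * indicator B (Y \<omega>)) \<le> 0" using Z by simp
      show "0 \<le> expectation (\<lambda>\<omega>. Z \<omega> * indicator B (Y \<omega>))"
        using Z by (intro Bochner_Integration.integral_nonneg) auto
    qed
    show ?thesis using z[of Z1] z[of Z2] Z1 Z2 True w2 by (simp add: w_def)
  next
    case False
    then have wpos: "0 < w" using w0 by simp
    define D where "D Z = distr (density M (\<lambda>\<omega>. ennreal (Z \<omega> / w))) borel Y" for Z
    have D: "real_distribution (D Z) \<and> measure (D Z) B = expectation (\<lambda>\<omega>. Z \<omega> * indicator B (Y \<omega>)) / w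
        \<and> (\<forall>\<theta>. char (D Z) \<theta> = Complex (expectation (\<lambda>\<omega>. Z \<omega> * cos (\<theta> * Y \<omega> + 0)) / w)
             (expectation (\<lambda>\<omega>. Z \<omega> * cos (\<theta> * Y \<omega> + (- (pi / 2)))) / w))"
      if [measurable]: "Z \<in> borel_measurable M" and Z: "\<And>\<omega>. 0 \<le> Z \<omega>" "\<And>\<omega>. Z \<omega> \<le> c" "expectation Z = w" for Z
    proof (intro conjI allI)
      have iZ: "integrable M Z" using Z by (auto intro!: integrable_bounded_real[where c=c])
      have "emeasure (density M (\<lambda>\<omega>. ennreal (Z \<omega> / w))) (space M) = (\<integral>\<^sup>+\<omega>. ennreal (Z \<omega> / w) \<partial>M)"
        by (subst emeasure_density) (auto intro!: nn_integral_cong)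
      also have "\<dots> = ennreal (expectation (\<lambda>\<omega>. Z \<omega> / w))"
        using Z wpos iZ by (intro nn_integral_eq_integral) auto
      also have "expectation (\<lambda>\<omega>. Z \<omega> / w) = 1" using Z(3) wpos by simp
      finally interpret P: prob_space "density M (\<lambda>\<omega>. ennreal (Z \<omega> / w))"
        by (intro prob_spaceI) simp
      have "prob_space (D Z)" unfolding D_def by (rule P.prob_space_distr) simp
      then show "real_distribution (D Z)"
        by (auto simp: real_distribution_def real_distribution_axioms_def D_def)
      have "measure (D Z) B = (\<integral>y. indicator B y \<partial>D Z)"
        by (simp add: D_def)
      also have "\<dots> = (\<integral>\<omega>. indicator B (Y \<omega>) \<partial>density M (\<lambda>\<omega>. ennreal (Z \<omega> / w)))"
        unfolding D_def by (rule integral_distr) auto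
      also have "\<dots> = expectation (\<lambda>\<omega>. Z \<omega> / w * indicator B (Y \<omega>))"
        using Z wpos by (subst integral_density) auto
      finally show "measure (D Z) B = expectation (\<lambda>\<omega>. Z \<omega> * indicator B (Y \<omega>)) / w"
        by simp
      fix \<theta>
      have ic: "integrable M (\<lambda>\<omega>. (Z \<omega> / w) *\<^sub>R iexp (\<theta> * Y \<omega>))"
      proof (rule Bochner_Integration.integrable_bound[where f="\<lambda>\<omega>. Z \<omega> / w"])
        show "integrable M (\<lambda>\<omega>. Z \<omega> / w)" using iZ by simp
      qed auto
      have "char (D Z) \<theta> = (CLINT \<omega>|density M (\<lambda>\<omega>. ennreal (Z \<omega> / w)). iexp (\<theta> * Y \<omega>))"
        unfolding D_def char_def by (rule integral_distr) auto
      also have "\<dots> = (CLINT \<omega>|M. (Z \<omega> / w) *\<^sub>R iexp (\<theta> * Y \<omega>))"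
        using Z wpos by (subst integral_density) auto
      finally have ch: "char (D Z) \<theta> = (CLINT \<omega>|M. (Z \<omega> / w) *\<^sub>R iexp (\<theta> * Y \<omega>))" .
      show "char (D Z) \<theta> = Complex (expectation (\<lambda>\<omega>. Z \<omega> * cos (\<theta> * Y \<omega> + 0)) / w)
             (expectation (\<lambda>\<omega>. Z \<omega> * cos (\<theta> * Y \<omega> + (- (pi / 2)))) / w)"
      proof (rule complex_eqI)
        have "Re (char (D Z) \<theta>) = expectation (\<lambda>\<omega>. Re ((Z \<omega> / w) *\<^sub>R iexp (\<theta> * Y \<omega>)))"
          unfolding ch by (rule integral_Re[OF ic, symmetric])
        also have "\<dots> = expectation (\<lambda>\<omega>. Z \<omega> * cos (\<theta> * Y \<omega> + 0) / w)"
          by (intro Bochner_Integration.integral_cong) (auto simp: Re_exp)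
        finally show "Re (char (D Z) \<theta>) = Re (Complex (expectation (\<lambda>\<omega>. Z \<omega> * cos (\<theta> * Y \<omega> + 0)) / w)
             (expectation (\<lambda>\<omega>. Z \<omega> * cos (\<theta> * Y \<omega> + (- (pi / 2)))) / w))" by simp
        have "Im (char (D Z) \<theta>) = expectation (\<lambda>\<omega>. Im ((Z \<omega> / w) *\<^sub>R iexp (\<theta> * Y \<omega>)))"
          unfolding ch by (rule integral_Im[OF ic, symmetric])
        also have "\<dots> = expectation (\<lambda>\<omega>. Z \<omega> * cos (\<theta> * Y \<omega> + (- (pi / 2))) / w)"
          by (intro Bochner_Integration.integral_cong) (auto simp: Im_exp cos_diff)
        finally show "Im (char (D Z) \<theta>) = Im (Complex (expectation (\<lambda>\<omega>. Z \<omega> * cos (\<theta> * Y \<omega> + 0)) / w)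
             (expectation (\<lambda>\<omega>. Z \<omega> * cos (\<theta> * Y \<omega> + (- (pi / 2)))) / w))" by simp
      qed
    qed
    have D1: "real_distribution (D Z1)" "measure (D Z1) B = expectation (\<lambda>\<omega>. Z1 \<omega> * indicator B (Y \<omega>)) / w"
      using D[of Z1] Z1 by (auto simp: w_def)
    have D2: "real_distribution (D Z2)" "measure (D Z2) B = expectation (\<lambda>\<omega>. Z2 \<omega> * indicator B (Y \<omega>)) / w"
      using D[of Z2] Z2 by (auto simp: w2)
    have "char (D Z1) = char (D Z2)"
    proof
      fix \<theta>
      show "char (D Z1) \<theta> = char (D Z2) \<theta>"
        using D[of Z1] Z1 D[of Z2] Z2 w_def w2 by (simp only: eq) auto
    qed
    from Levy_uniqueness[OF D1(1) D2(1) this] show ?thesis using D1(2) D2(2) wpos by simp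
  qed
qed

text \<open>The coordinates are peeled off one at a time: the nonnegative weights \<open>1 + cos (\<dots>)\<close> reduce each step
  to the uniqueness theorem for characteristic functions of one variable.\<close>
lemma prob_prod_eq_of_cos:
  fixes N :: "'a \<Rightarrow> real" and Y :: "'i \<Rightarrow> 'a \<Rightarrow> real"
  assumes [measurable]: "N \<in> borel_measurable M" and Y: "\<And>i. i \<in> T \<Longrightarrow> Y i \<in> borel_measurable M"
    and T: "finite T"
    and eq: "\<And>\<theta> c a. expectation (\<lambda>\<omega>. cos (\<theta> * N \<omega> + (\<Sum>i\<in>T. c i * Y i \<omega>) + a))
         = g \<theta> * expectation (\<lambda>\<omega>. cos ((\<Sum>i\<in>T. c i * Y i \<omega>) + a))"
    and B [measurable]: "B \<in> sets borel" and A: "\<And>i. i \<in> T \<Longrightarrow> A i \<in> sets borel"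
  shows "expectation (\<lambda>\<omega>. indicator B (N \<omega>) * (\<Prod>i\<in>T. indicator (A i) (Y i \<omega>)))
    = expectation (\<lambda>\<omega>. indicator B (N \<omega>)) * (expectation (\<lambda>\<omega>. \<Prod>i\<in>T. indicator (A i) (Y i \<omega>)) :: real)"
proof -
  define L where "L c \<omega> = (\<Sum>i\<in>T. c i * Y i \<omega>)" for c \<omega>
  have L [measurable]: "L c \<in> borel_measurable M" for c
    unfolding L_def[abs_def] using Y by measurable
  have L_upd: "L (c(p := c p + \<theta>)) \<omega> = \<theta> * Y p \<omega> + L c \<omega>" if "p \<in> T" for p c \<theta> \<omega>
  proof -
    have "(\<Sum>i\<in>T. (c(p := c p + \<theta>)) i * Y i \<omega>) = (\<Sum>i\<in>T. c i * Y i \<omega> + (if i = p then \<theta> * Y p \<omega> else 0))"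
      by (intro sum.cong) (auto simp: algebra_simps)
    then show ?thesis using that T by (simp add: L_def sum.distrib)
  qed
  have L_minus: "L (\<lambda>i. - c i) \<omega> = - L c \<omega>" for c \<omega>
    by (simp add: L_def sum_negf)
  have eq: "expectation (\<lambda>\<omega>. cos (\<theta> * N \<omega> + L c \<omega> + a)) = g \<theta> * expectation (\<lambda>\<omega>. cos (L c \<omega> + a))" for \<theta> c a
    using eq by (simp add: L_def)
  \<comment> \<open>Multiplication by a cosine only changes coefficients and phases, so the family
    of cosines of linear forms is stable under the weighting used below.\<close>
  have cos_prod: "cos (y + a) * cos (n + b) = (1 / 2) * cos (n + y + (a + b)) + (1 / 2) * cos (n + - y + (b - a))" for y n a b :: real
    using cos_times_cos[of "n + b" "y + a"] by (simp add: algebra_simps)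
  define pB :: real where "pB = expectation (\<lambda>\<omega>. indicator B (N \<omega>))"
  have pB: "0 \<le> pB" "pB \<le> 1"
  proof -
    show "0 \<le> pB" unfolding pB_def by (intro Bochner_Integration.integral_nonneg) auto
    have "pB \<le> expectation (\<lambda>\<omega>. 1)" unfolding pB_def
      by (intro integral_mono integrable_bounded_real[where c=1]) (auto simp: indicator_def)
    then show "pB \<le> 1" by (simp add: prob_space)
  qed
  \<comment> \<open>The cosine of an arbitrary linear form is retained in the induction claim: it is
    the material from which the next coordinate is converted into an indicator. At the end the zero
    form is inserted.\<close>
  have "\<forall>c a. expectation (\<lambda>\<omega>. indicator B (N \<omega>) * (\<Prod>i\<in>S. indicator (A i) (Y i \<omega>)) * cos (L c \<omega> + a))
      = expectation (\<lambda>\<omega>. pB * (\<Prod>i\<in>S. indicator (A i) (Y i \<omega>)) * cos (L c \<omega> + a))"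
    if "S \<subseteq> T" for S
    using finite_subset[OF that T] that
  proof (induction S rule: finite_induct)
    case empty
    show ?case
    proof (intro allI)
      fix c a
      define m where "m = expectation (\<lambda>\<omega>. cos (L c \<omega> + a))"
      have ic: "integrable M (\<lambda>\<omega>. cos (\<theta> * N \<omega> + L c \<omega> + a))" "integrable M (\<lambda>\<omega>. cos (L c \<omega> + a))"
        "integrable M (\<lambda>\<omega>. cos (\<theta> * N \<omega> + a))" "integrable M (\<lambda>\<omega>. cos (\<theta> * N \<omega> + - L c \<omega> + a))" for c a \<theta>
        by (auto intro!: integrable_bounded_real[where c=1])
      have m1: "- 1 \<le> m" "m \<le> 1"
      proof -
        have "m \<le> expectation (\<lambda>\<omega>. 1)" unfolding m_def by (intro integral_mono ic) auto
        then show "m \<le> 1" by (simp add: prob_space)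
        have "expectation (\<lambda>\<omega>. - 1) \<le> m" unfolding m_def by (intro integral_mono ic) auto
        then show "- 1 \<le> m" by (simp add: prob_space)
      qed
      have E: "expectation (\<lambda>\<omega>. cos (\<theta> * N \<omega> + b)) = g \<theta> * cos b" for \<theta> b
        using eq[of \<theta> "\<lambda>_. 0" b] by (simp add: L_def prob_space)
      have "expectation (\<lambda>\<omega>. cos (L c \<omega> + a) * cos (\<theta> * N \<omega> + b)) = m * (g \<theta> * cos b)" for \<theta> b
      proof -
        have "expectation (\<lambda>\<omega>. cos (L c \<omega> + a) * cos (\<theta> * N \<omega> + b))
          = (1 / 2) * expectation (\<lambda>\<omega>. cos (\<theta> * N \<omega> + L c \<omega> + (a + b)))
            + (1 / 2) * expectation (\<lambda>\<omega>. cos (\<theta> * N \<omega> + - L c \<omega> + (b - a)))"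
          unfolding cos_prod using ic by (subst Bochner_Integration.integral_add) auto
        also have "\<dots> = g \<theta> * ((1 / 2) * expectation (\<lambda>\<omega>. cos (L c \<omega> + (a + b)))
            + (1 / 2) * expectation (\<lambda>\<omega>. cos (- L c \<omega> + (b - a))))"
          using eq[of \<theta> c "a + b"] eq[of \<theta> "\<lambda>i. - c i" "b - a"] by (simp add: L_minus algebra_simps)
        also have "(1 / 2) * expectation (\<lambda>\<omega>. cos (L c \<omega> + (a + b))) + (1 / 2) * expectation (\<lambda>\<omega>. cos (- L c \<omega> + (b - a)))
            = expectation (\<lambda>\<omega>. cos (L c \<omega> + a) * cos b)"
        proof -
          have "integrable M (\<lambda>\<omega>. cos (- L c \<omega> + (b - a)))"
            using ic(2)[of "\<lambda>i. - c i" "b - a"] by (simp add: L_minus)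
          then show ?thesis
            using cos_prod[of "L c _" a 0 b] ic(2)[of c "a + b"]
            by simp
        qed
        finally show ?thesis by (simp add: m_def)
      qed
      note E2 = this
      have "expectation (\<lambda>\<omega>. (1 + cos (L c \<omega> + a)) * indicator B (N \<omega>)) = expectation (\<lambda>\<omega>. (1 + m) * indicator B (N \<omega>))"
      proof (rule weighted_law_eq[where c=2])
        fix \<theta> b
        have "integrable M (\<lambda>\<omega>. cos (L c \<omega> + a) * cos (\<theta> * N \<omega> + b))"
          by (rule integrable_bounded_real[where c=1]) (auto simp: abs_mult intro!: mult_le_one)
        then have "expectation (\<lambda>\<omega>. (1 + cos (L c \<omega> + a)) * cos (\<theta> * N \<omega> + b)) = g \<theta> * cos b + m * (g \<theta> * cos b)"
          unfolding distrib_right using ic(3)[of \<theta> b] E2[of \<theta> b] E[of \<theta> b]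
          by (subst Bochner_Integration.integral_add) auto
        then show "expectation (\<lambda>\<omega>. (1 + cos (L c \<omega> + a)) * cos (\<theta> * N \<omega> + b)) = expectation (\<lambda>\<omega>. (1 + m) * cos (\<theta> * N \<omega> + b))"
          using E[of \<theta> b] ic(3)[of \<theta> b] by (simp add: distrib_right[of 1 m])
      next
        fix \<omega>
        show "0 \<le> 1 + cos (L c \<omega> + a)" using cos_ge_minus_one[of "L c \<omega> + a"] by linarith
        show "1 + cos (L c \<omega> + a) \<le> 2" using cos_le_one[of "L c \<omega> + a"] by linarith
      qed (use m1 in auto)
      moreover have "integrable M (\<lambda>\<omega>. indicator B (N \<omega>) :: real)"
        "integrable M (\<lambda>\<omega>. cos (L c \<omega> + a) * indicator B (N \<omega>))"
        by (auto intro!: integrable_bounded_real[where c=1] simp: abs_mult indicator_def)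
      ultimately have "expectation (\<lambda>\<omega>. cos (L c \<omega> + a) * indicator B (N \<omega>)) = m * pB"
        by (simp add: distrib_right pB_def)
      then show "expectation (\<lambda>\<omega>. indicator B (N \<omega>) * (\<Prod>i\<in>{}. indicator (A i) (Y i \<omega>)) * cos (L c \<omega> + a))
          = expectation (\<lambda>\<omega>. pB * (\<Prod>i\<in>{}. indicator (A i) (Y i \<omega>)) * cos (L c \<omega> + a))"
        by (simp add: m_def mult.commute)
    qed
  next
    case (insert p S)
    then have p: "p \<in> T" and S: "S \<subseteq> T" by auto
    have [measurable]: "Y p \<in> borel_measurable M" "A p \<in> sets borel" using p Y A by auto
    define W1 where "W1 \<omega> = indicator B (N \<omega>) * (\<Prod>i\<in>S. indicator (A i) (Y i \<omega>) :: real)" for \<omega>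
    define W2 where "W2 \<omega> = pB * (\<Prod>i\<in>S. indicator (A i) (Y i \<omega>) :: real)" for \<omega>
    have prodm: "(\<lambda>\<omega>. \<Prod>i\<in>S. indicator (A i) (Y i \<omega>) :: real) \<in> borel_measurable M"
    proof (rule borel_measurable_prod)
      fix i assume "i \<in> S"
      then have [measurable]: "Y i \<in> borel_measurable M" "A i \<in> sets borel" using S Y A by auto
      show "(\<lambda>\<omega>. indicator (A i) (Y i \<omega>) :: real) \<in> borel_measurable M" by measurable
    qed
    have [measurable]: "W1 \<in> borel_measurable M" "W2 \<in> borel_measurable M"
      unfolding W1_def[abs_def] W2_def[abs_def] using prodm by measurable
    have prod01: "0 \<le> (\<Prod>i\<in>S. indicator (A i) (Y i \<omega>) :: real)" "(\<Prod>i\<in>S. indicator (A i) (Y i \<omega>) :: real) \<le> 1" for \<omega>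
      by (auto intro!: prod_nonneg prod_le_1)
    have W1: "0 \<le> W1 \<omega>" "W1 \<omega> \<le> 1" and W2: "0 \<le> W2 \<omega>" "W2 \<omega> \<le> 1" for \<omega>
      unfolding W1_def W2_def using prod01[of \<omega>] pB by (auto intro!: mult_le_one simp: indicator_def)
    have IH: "expectation (\<lambda>\<omega>. W1 \<omega> * cos (L c \<omega> + a)) = expectation (\<lambda>\<omega>. W2 \<omega> * cos (L c \<omega> + a))" for c a
      using insert.IH[OF S] by (simp add: W1_def W2_def)
    have IH': "expectation (\<lambda>\<omega>. W1 \<omega> * cos (\<theta> * Y p \<omega> + L c \<omega> + a)) = expectation (\<lambda>\<omega>. W2 \<omega> * cos (\<theta> * Y p \<omega> + L c \<omega> + a))" for \<theta> c a
      using IH[of "c(p := c p + \<theta>)" a] by (simp add: L_upd[OF p])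
    have IH'': "expectation (\<lambda>\<omega>. W1 \<omega> * cos (\<theta> * Y p \<omega> + a)) = expectation (\<lambda>\<omega>. W2 \<omega> * cos (\<theta> * Y p \<omega> + a))" for \<theta> a
      using IH'[of \<theta> "\<lambda>_. 0" a] by (simp add: L_def)
    have iW: "integrable M (\<lambda>\<omega>. W1 \<omega> * k \<omega>)" "integrable M (\<lambda>\<omega>. W2 \<omega> * k \<omega>)"
      if [measurable]: "k \<in> borel_measurable M" and "\<And>\<omega>. \<bar>k \<omega>\<bar> \<le> 1" for k
      by (rule integrable_bounded_real[where c=1]; use that W1 W2 in \<open>auto simp: abs_mult intro!: mult_le_one\<close>)+
    have e1: "expectation (\<lambda>\<omega>. W1 \<omega> * indicator (A p) (Y p \<omega>)) = expectation (\<lambda>\<omega>. W2 \<omega> * indicator (A p) (Y p \<omega>))"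
      by (rule weighted_law_eq[where c=1]) (use W1 W2 IH'' in auto)
    show ?case
    proof (intro allI)
      fix c a
      have e2: "expectation (\<lambda>\<omega>. (W1 \<omega> * (1 + cos (L c \<omega> + a))) * indicator (A p) (Y p \<omega>))
          = expectation (\<lambda>\<omega>. (W2 \<omega> * (1 + cos (L c \<omega> + a))) * indicator (A p) (Y p \<omega>))"
      proof (rule weighted_law_eq[where c=2])
        fix \<theta> b
        have ex: "expectation (\<lambda>\<omega>. W \<omega> * (1 + cos (L c \<omega> + a)) * cos (\<theta> * Y p \<omega> + b))
            = expectation (\<lambda>\<omega>. W \<omega> * cos (\<theta> * Y p \<omega> + b))
            + (1 / 2) * expectation (\<lambda>\<omega>. W \<omega> * cos (\<theta> * Y p \<omega> + L c \<omega> + (a + b)))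
            + (1 / 2) * expectation (\<lambda>\<omega>. W \<omega> * cos (\<theta> * Y p \<omega> + L (\<lambda>i. - c i) \<omega> + (b - a)))"
          if iW: "\<And>k. k \<in> borel_measurable M \<Longrightarrow> (\<And>\<omega>. \<bar>k \<omega>\<bar> \<le> 1) \<Longrightarrow> integrable M (\<lambda>\<omega>. W \<omega> * k \<omega>)" for W
        proof -
          have "W \<omega> * (1 + cos (L c \<omega> + a)) * cos (\<theta> * Y p \<omega> + b)
            = W \<omega> * cos (\<theta> * Y p \<omega> + b) + (1 / 2) * (W \<omega> * cos (\<theta> * Y p \<omega> + L c \<omega> + (a + b)))
            + (1 / 2) * (W \<omega> * cos (\<theta> * Y p \<omega> + L (\<lambda>i. - c i) \<omega> + (b - a)))" for \<omega>
          proof -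
            have "W \<omega> * (1 + cos (L c \<omega> + a)) * cos (\<theta> * Y p \<omega> + b)
              = W \<omega> * cos (\<theta> * Y p \<omega> + b) + W \<omega> * (cos (L c \<omega> + a) * cos (\<theta> * Y p \<omega> + b))"
              by (simp add: algebra_simps)
            then show ?thesis unfolding cos_prod L_minus by (simp add: algebra_simps)
          qed
          moreover have "integrable M (\<lambda>\<omega>. W \<omega> * cos (\<theta> * Y p \<omega> + b))"
            "integrable M (\<lambda>\<omega>. W \<omega> * cos (\<theta> * Y p \<omega> + L c \<omega> + (a + b)))"
            "integrable M (\<lambda>\<omega>. W \<omega> * cos (\<theta> * Y p \<omega> + L (\<lambda>i. - c i) \<omega> + (b - a)))"
            by (auto intro!: iW)
          ultimately show ?thesis by simp
        qed
        show "expectation (\<lambda>\<omega>. W1 \<omega> * (1 + cos (L c \<omega> + a)) * cos (\<theta> * Y p \<omega> + b))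
          = expectation (\<lambda>\<omega>. W2 \<omega> * (1 + cos (L c \<omega> + a)) * cos (\<theta> * Y p \<omega> + b))"
          by (simp only: ex[OF iW(1)] ex[OF iW(2)] IH' IH'')
      next
        fix \<omega>
        have "0 \<le> 1 + cos (L c \<omega> + a)" "1 + cos (L c \<omega> + a) \<le> 2"
          using cos_ge_minus_one[of "L c \<omega> + a"] cos_le_one[of "L c \<omega> + a"] by linarith+
        then show "0 \<le> W1 \<omega> * (1 + cos (L c \<omega> + a))" "0 \<le> W2 \<omega> * (1 + cos (L c \<omega> + a))"
          "W1 \<omega> * (1 + cos (L c \<omega> + a)) \<le> 2" "W2 \<omega> * (1 + cos (L c \<omega> + a)) \<le> 2"
          using W1[of \<omega>] W2[of \<omega>] mult_mono[of "W1 \<omega>" 1 "1 + cos (L c \<omega> + a)" 2]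
            mult_mono[of "W2 \<omega>" 1 "1 + cos (L c \<omega> + a)" 2] by auto
      qed auto
      have ex2: "expectation (\<lambda>\<omega>. (W \<omega> * (1 + cos (L c \<omega> + a))) * indicator (A p) (Y p \<omega>))
        = expectation (\<lambda>\<omega>. W \<omega> * indicator (A p) (Y p \<omega>)) + expectation (\<lambda>\<omega>. W \<omega> * indicator (A p) (Y p \<omega>) * cos (L c \<omega> + a))"
        if iW: "\<And>k. k \<in> borel_measurable M \<Longrightarrow> (\<And>\<omega>. \<bar>k \<omega>\<bar> \<le> 1) \<Longrightarrow> integrable M (\<lambda>\<omega>. W \<omega> * k \<omega>)" for W
      proof -
        have "integrable M (\<lambda>\<omega>. W \<omega> * indicator (A p) (Y p \<omega>))"
          "integrable M (\<lambda>\<omega>. W \<omega> * (indicator (A p) (Y p \<omega>) * cos (L c \<omega> + a)))"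
          by (intro iW; auto simp: indicator_def abs_mult)+
        then show ?thesis
          by (subst Bochner_Integration.integral_add[symmetric]) (auto simp: algebra_simps)
      qed
      have "expectation (\<lambda>\<omega>. W1 \<omega> * indicator (A p) (Y p \<omega>) * cos (L c \<omega> + a))
          = expectation (\<lambda>\<omega>. W2 \<omega> * indicator (A p) (Y p \<omega>) * cos (L c \<omega> + a))"
        using e2 e1 ex2[OF iW(1)] ex2[OF iW(2)] by simp
      then show "expectation (\<lambda>\<omega>. indicator B (N \<omega>) * (\<Prod>i\<in>insert p S. indicator (A i) (Y i \<omega>)) * cos (L c \<omega> + a))
          = expectation (\<lambda>\<omega>. pB * (\<Prod>i\<in>insert p S. indicator (A i) (Y i \<omega>)) * cos (L c \<omega> + a))"
        using insert.hyps by (simp add: W1_def W2_def mult_ac)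
    qed
  qed
  from this[of T, THEN spec, of "\<lambda>_. 0", THEN spec, of 0]
  show ?thesis by (simp add: L_def pB_def)
qed

end

section \<open>Markov property of the bridge\<close>

text \<open>The bridge is, up to its mean, \<open>1 - s\<close> times a Brownian motion at time
  \<open>w s\<close>, so its covariance is \<open>(1 - s) * (1 - r) * min (w s) (w r)\<close>. The
  minimum is the inner product of the indicators of \<open>[0, w s]\<close> and
  \<open>[0, w r]\<close>, and the double sum becomes the integral of a square.\<close>

lemma bb_cov_psd:
  assumes t: "t < 1" and S: "finite S" "S \<subseteq> {t..<1}"
  shows "0 \<le> (\<Sum>s\<in>S. \<Sum>r\<in>S. c s * c r * bb_cov t s r)"
proof -
  define w where "w s = (s - t) / ((1 - t) * (1 - s))" for s
  define J :: "real \<Rightarrow> real \<Rightarrow> real" where "J s y = indicator {0..w s} y" for s y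
  have wmono: "w s \<le> w r" if "s \<in> S" "r \<in> S" "s \<le> r" for s r
    unfolding w_def using that S t by (intro frac_le mult_left_mono mult_pos_pos) auto
  have w0: "0 \<le> w s" if "s \<in> S" for s unfolding w_def using that S t by (auto simp: subset_iff)
  have JJ: "(\<integral>y. J s y * J r y \<partial>lborel) = min (w s) (w r)" and iJJ: "integrable lborel (\<lambda>y. J s y * J r y)"
    if "s \<in> S" "r \<in> S" for s r
  proof -
    have "J s y * J r y = indicator {0..min (w s) (w r)} y" for y
      by (auto simp: J_def indicator_def)
    then show "(\<integral>y. J s y * J r y \<partial>lborel) = min (w s) (w r)" "integrable lborel (\<lambda>y. J s y * J r y)"
      using w0 that by auto
  qed
  have cov: "bb_cov t s r = (1 - s) * (1 - r) * min (w s) (w r)" if "s \<in> S" "r \<in> S" for s r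
  proof -
    have *: "bb_cov t s r = (1 - s) * (1 - r) * min (w s) (w r)" if "s \<in> S" "r \<in> S" "s \<le> r" for s r
    proof -
      have "s < 1" using that S by auto
      moreover have "min (w s) (w r) = w s" using wmono that by simp
      moreover have "d * m / q = p * m * (d / (q * p))" if "0 < p" for d m p q :: real
        using that by simp
      ultimately show ?thesis
        using that by (simp add: bb_cov_def w_def)
    qed
    show ?thesis
      using *[of s r] *[of r s] that
      by (cases "s \<le> r") (auto simp: bb_cov_def min.commute max.commute mult_ac)
  qed
  have "(\<Sum>s\<in>S. \<Sum>r\<in>S. c s * c r * bb_cov t s r)
      = (\<Sum>s\<in>S. \<Sum>r\<in>S. \<integral>y. (c s * (1 - s) * (c r * (1 - r))) * (J s y * J r y) \<partial>lborel)"
    by (intro sum.cong refl) (simp add: cov JJ mult_ac)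
  also have "\<dots> = (\<integral>y. (\<Sum>s\<in>S. \<Sum>r\<in>S. (c s * (1 - s) * (c r * (1 - r))) * (J s y * J r y)) \<partial>lborel)"
    using iJJ by (subst Bochner_Integration.integral_sum, auto intro!: sum.cong Bochner_Integration.integral_sum[symmetric])
  also have "\<dots> = (\<integral>y. (\<Sum>s\<in>S. c s * (1 - s) * J s y)\<^sup>2 \<partial>lborel)"
    by (intro Bochner_Integration.integral_cong refl) (simp add: power2_eq_square sum_product mult_ac)
  finally show ?thesis by simp
qed

lemma stopping_time_in_sets:
  assumes "stopping_time F \<tau>"
  shows "{\<omega> \<in> space (F s). \<tau> \<omega> \<le> s} \<in> sets (F s)" "{\<omega> \<in> space (F s). s < \<tau> \<omega>} \<in> sets (F s)"
  using stopping_timeD[OF assms, of s] stopping_timeD2[OF assms, of s] by (auto simp: Measurable.pred_def)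

locale bridge = prob_space M for M :: "'a measure" +
  fixes t x :: real and X :: "real \<Rightarrow> 'a \<Rightarrow> real"
  assumes t1: "t < 1" and bb: "brownian_bridge M t x X"
begin

lemma X_measurable: "s \<in> {t..<1} \<Longrightarrow> X s \<in> borel_measurable M"
  using bb by (simp add: brownian_bridge_def)

lemma X_continuous: "\<omega> \<in> space M \<Longrightarrow> continuous_on {t..<1} (\<lambda>s. X s \<omega>)"
  using bb by (simp add: brownian_bridge_def)

lemma distr_X:
  "finite S \<Longrightarrow> S \<subseteq> {t..<1} \<Longrightarrow>
    distr M borel (\<lambda>\<omega>. \<Sum>s\<in>S. c s * X s \<omega>) =
    normal_law (\<Sum>s\<in>S. c s * bb_mean t x s) (\<Sum>s\<in>S. \<Sum>r\<in>S. c s * c r * bb_cov t s r)"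
  using bb by (simp add: brownian_bridge_def)

abbreviation F :: "real \<Rightarrow> 'a measure" where "F \<equiv> nat_filtration M t X"

lemma space_F: "space (F s) = space M"
  unfolding nat_filtration_def by (subst space_measure_of) auto

lemma sets_F: "sets (F s) = sigma_sets (space M)
    (\<Union>r\<in>{t..min s 1} \<inter> {t..<1}. {X r -` A \<inter> space M | A. A \<in> sets borel})"
  unfolding nat_filtration_def by (subst sets_measure_of) auto

lemma sets_F_subset: "sets (F s) \<subseteq> sets M"
  unfolding sets_F by (rule sets.sigma_sets_subset) (auto intro!: measurable_sets[OF X_measurable])

lemma sets_F_mono: "s \<le> r \<Longrightarrow> sets (F s) \<subseteq> sets (F r)"
  unfolding sets_F by (rule sigma_sets_mono') force

lemma X_measurable_F: "t \<le> r \<Longrightarrow> r \<le> s \<Longrightarrow> r < 1 \<Longrightarrow> X r \<in> borel_measurable (F s)"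
  by (rule measurableI) (auto simp: space_F sets_F intro!: sigma_sets.Basic bexI[of _ r] exI)

lemma stopping_time_measurable:
  assumes "stopping_time F \<tau>"
  shows "\<tau> \<in> borel_measurable M"
  by (rule measurable_stopping_time[OF assms sets_F_subset space_F])

lemma expectation_cos_X:
  assumes S: "finite S" "S \<subseteq> {t..<1}"
  shows "expectation (\<lambda>\<omega>. cos ((\<Sum>s\<in>S. c s * X s \<omega>) + a))
    = exp (- (\<Sum>s\<in>S. \<Sum>r\<in>S. c s * c r * bb_cov t s r) / 2) * cos ((\<Sum>s\<in>S. c s * bb_mean t x s) + a)"
proof -
  have [measurable]: "(\<lambda>\<omega>. \<Sum>s\<in>S. c s * X s \<omega>) \<in> borel_measurable M"
    using S X_measurable by (intro borel_measurable_sum borel_measurable_times) auto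
  have "expectation (\<lambda>\<omega>. cos ((\<Sum>s\<in>S. c s * X s \<omega>) + a))
      = (\<integral>y. cos (y + a) \<partial>distr M borel (\<lambda>\<omega>. \<Sum>s\<in>S. c s * X s \<omega>))"
    by (simp add: integral_distr)
  then show ?thesis
    by (simp only: distr_X[OF S] integral_normal_law_cos[OF bb_cov_psd[OF t1 S]])
qed

lemma distr_X_single:
  assumes "s \<in> {t..<1}"
  shows "distr M borel (X s) = normal_law (bb_mean t x s) (bb_cov t s s)"
  using distr_X[of "{s}" "\<lambda>_. 1"] assms by simp

lemma bb_cov_self_nonneg: "s \<in> {t..<1} \<Longrightarrow> 0 \<le> bb_cov t s s"
  using t1 by (simp add: bb_cov_def)

lemma
  assumes s: "s \<in> {t..<1}"
  shows integrable_X_square: "integrable M (\<lambda>\<omega>. (X s \<omega>)\<^sup>2)"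
    and expectation_X_square: "expectation (\<lambda>\<omega>. (X s \<omega>)\<^sup>2) = (bb_mean t x s)\<^sup>2 + bb_cov t s s"
  using integrable_normal_law_square[OF bb_cov_self_nonneg[OF s], of "bb_mean t x s"]
    integral_normal_law_square[OF bb_cov_self_nonneg[OF s], of "bb_mean t x s"] X_measurable[OF s]
  by (auto simp: distr_X_single[OF s, symmetric] integrable_distr_eq integral_distr)

section \<open>The normalised coordinate, its innovations and the Markov property\<close>

definition Z :: "real \<Rightarrow> 'a \<Rightarrow> real" where
  "Z s \<omega> = X s \<omega> / sqrt (1 - s)"

lemma Z_measurable: "s \<in> {t..<1} \<Longrightarrow> Z s \<in> borel_measurable M"
  unfolding Z_def[abs_def] using X_measurable by measurable

lemma Z_measurable_F: "t \<le> r \<Longrightarrow> r \<le> s \<Longrightarrow> r < 1 \<Longrightarrow> Z r \<in> borel_measurable (F s)"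
  unfolding Z_def[abs_def] using X_measurable_F by measurable

lemma integrable_Z_square:
  assumes s: "s \<in> {t..<1}"
  shows "integrable M (\<lambda>\<omega>. (Z s \<omega>)\<^sup>2)"
  using integrable_X_square[OF s] s by (simp add: Z_def power_divide)

lemma integrable_Z_quadratic:
  fixes G :: "real \<Rightarrow> real"
  assumes s: "s \<in> {t..<1}" and [measurable]: "G \<in> borel_measurable borel"
    and G: "\<And>z. \<bar>G z\<bar> \<le> a * (1 + z\<^sup>2)"
  shows "integrable M (\<lambda>\<omega>. G (Z s \<omega>))"
proof (rule Bochner_Integration.integrable_bound)
  have [measurable]: "Z s \<in> borel_measurable M" by (rule Z_measurable[OF s])
  show "integrable M (\<lambda>\<omega>. a * (1 + (Z s \<omega>)\<^sup>2))"
    using integrable_Z_square[OF s] by simp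
  show "(\<lambda>\<omega>. G (Z s \<omega>)) \<in> borel_measurable M" by measurable
  show "AE \<omega> in M. norm (G (Z s \<omega>)) \<le> norm (a * (1 + (Z s \<omega>)\<^sup>2))"
    by (intro always_eventually allI) (use G in \<open>auto intro: order_trans[OF G]\<close>)
qed

text \<open>The variance of the bridge vanishes like \<open>1 - s\<close> near time
  \<open>1\<close>, which compensates the normalisation. Uniformity in \<open>s\<close> bounds, in
  the hitting estimate, how often \<open>Z\<close> can be far away.\<close>

lemma expectation_Z_square_le:
  assumes s: "s \<in> {t..<1}"
  shows "expectation (\<lambda>\<omega>. (Z s \<omega>)\<^sup>2) \<le> x\<^sup>2 / (1 - t) + 1"
proof -
  have s1: "0 < 1 - s" "1 - s \<le> 1 - t" "t \<le> s" using s by auto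
  have "expectation (\<lambda>\<omega>. (Z s \<omega>)\<^sup>2) = ((bb_mean t x s)\<^sup>2 + bb_cov t s s) / (1 - s)"
    using expectation_X_square[OF s] s by (simp add: Z_def power_divide)
  also have "\<dots> = x\<^sup>2 / (1 - t) * ((1 - s) / (1 - t)) + (s - t) / (1 - t)"
  proof -
    have "(x * p / q)\<^sup>2 / p = x\<^sup>2 / q * (p / q)" "d * p / q / p = d / q" if "0 < p" "0 < q" for p q d :: real
      using that by (auto simp: power2_eq_square)
    from this[of "1 - s" "1 - t"] show ?thesis
      using s1 t1 by (simp add: bb_mean_def bb_cov_def add_divide_distrib)
  qed
  also have "\<dots> \<le> x\<^sup>2 / (1 - t) * 1 + 1"
    using s1 t1 by (intro add_mono mult_left_mono) auto
  finally show ?thesis by simp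
qed

text \<open>The residual of \<open>X s\<close> after Gaussian regression on \<open>X r\<close>:
  \<open>(1 - s) / (1 - r)\<close> is the factor of the conditional mean and the denominator is the
  conditional standard deviation.\<close>

definition Nz :: "real \<Rightarrow> real \<Rightarrow> 'a \<Rightarrow> real" where
  "Nz r s \<omega> = (X s \<omega> - (1 - s) / (1 - r) * X r \<omega>) / sqrt ((1 - s) / (1 - r) * (s - r))"

lemma Nz_measurable: "t \<le> r \<Longrightarrow> r < s \<Longrightarrow> s < 1 \<Longrightarrow> Nz r s \<in> borel_measurable M"
  unfolding Nz_def[abs_def] using X_measurable[of r] X_measurable[of s] by measurable

lemma Z_step:
  assumes rs: "t \<le> r" "r < s" "s < 1"
  defines "e \<equiv> (s - r) / (1 - r)"
  shows "Z s \<omega> = sqrt (1 - e) * Z r \<omega> + sqrt e * Nz r s \<omega>"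
proof -
  define \<rho> where "\<rho> = (1 - s) / (1 - r)"
  have \<rho>: "0 < \<rho>" "1 - e = \<rho>" "1 - s = \<rho> * (1 - r)" "s - r = e * (1 - r)" "0 < e"
  proof -
    have r: "1 - r \<noteq> 0" "0 < 1 - s" "0 < 1 - r" using rs by auto
    show "0 < \<rho>" "1 - s = \<rho> * (1 - r)" "s - r = e * (1 - r)" "0 < e"
      using r rs(2) by (auto simp: \<rho>_def e_def)
    have "((1 - r) - (s - r)) / (1 - r) = (1 - r) / (1 - r) - e"
      unfolding e_def by (rule diff_divide_distrib)
    then show "1 - e = \<rho>" using r by (simp add: \<rho>_def)
  qed
  have sq: "0 < sqrt \<rho>" "0 < sqrt e" "0 < sqrt (1 - r)" "sqrt \<rho> * sqrt \<rho> = \<rho>" using \<rho> rs by auto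
  have N: "Nz r s \<omega> = (X s \<omega> - \<rho> * X r \<omega>) / (sqrt \<rho> * (sqrt e * sqrt (1 - r)))"
    unfolding Nz_def \<rho>_def[symmetric] by (simp add: \<rho>(4) real_sqrt_mult)
  have Zs: "Z s \<omega> = X s \<omega> / (sqrt \<rho> * sqrt (1 - r))"
    by (simp add: Z_def \<rho>(3) real_sqrt_mult)
  have "sqrt e * Nz r s \<omega> = (X s \<omega> - \<rho> * X r \<omega>) / (sqrt \<rho> * sqrt (1 - r))"
    unfolding N using sq by (simp add: field_simps)
  also have "\<dots> = Z s \<omega> - \<rho> * X r \<omega> / (sqrt \<rho> * sqrt (1 - r))"
    by (simp add: Zs diff_divide_distrib)
  also have "\<rho> * X r \<omega> / (sqrt \<rho> * sqrt (1 - r)) = (sqrt \<rho> * sqrt \<rho>) * X r \<omega> / (sqrt \<rho> * sqrt (1 - r))"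
    using sq(4) by simp
  also have "\<dots> = sqrt \<rho> * Z r \<omega>"
    using sq by (simp add: Z_def field_simps del: real_sqrt_mult_self)
  finally show ?thesis by (simp add: \<rho>)
qed

text \<open>The argument of the cosine is again a linear form in finitely many values of
  \<open>X\<close>, so only its mean and variance matter. For \<open>q \<le> r\<close> the
  covariance of \<open>X s\<close> with \<open>X q\<close> is \<open>\<rho>\<close> times that of
  \<open>X r\<close> with \<open>X q\<close>; hence the residual is uncorrelated with the past and
  the variances add.\<close>

lemma expectation_cos_Nz:
  assumes rs: "t \<le> r" "r < s" "s < 1" and T: "finite T" "T \<subseteq> {t..r}"
  shows "expectation (\<lambda>\<omega>. cos (\<theta> * Nz r s \<omega> + (\<Sum>q\<in>T. c q * X q \<omega>) + a))
       = exp (- \<theta>\<^sup>2 / 2) * expectation (\<lambda>\<omega>. cos ((\<Sum>q\<in>T. c q * X q \<omega>) + a))"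
proof -
  define \<rho> where "\<rho> = (1 - s) / (1 - r)"
  define \<kappa> where "\<kappa> = sqrt (\<rho> * (s - r))"
  have \<rho>: "0 < \<rho>" using rs by (simp add: \<rho>_def)
  have \<kappa>: "0 < \<kappa>" "\<kappa>\<^sup>2 = \<rho> * (s - r)" using rs \<rho> by (auto simp: \<kappa>_def)
  define R where "R = insert r T"
  define k where "k = \<theta> / \<kappa>"
  \<comment> \<open>The time \<open>r\<close> is adjoined because the residual contributes there
    whether or not \<open>r\<close> lies in \<open>T\<close>; the coefficients are extended by
    \<open>0\<close> so that both cases are treated alike.\<close>
  define c0 where "c0 q = (if q \<in> T then c q else 0)" for q
  define d where "d q = (if q = r then 1 else 0 :: real)" for q
  define c1 where "c1 q = c0 q - k * \<rho> * d q" for q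
  define c2 where "c2 q = (if q = s then k else c1 q)" for q
  have R: "finite R" "R \<subseteq> {t..<1}" "s \<notin> R" "r \<in> R" "T \<subseteq> R" using T rs by (auto simp: R_def)
  have RT: "(\<Sum>q\<in>R. c0 q * g q) = (\<Sum>q\<in>T. c q * g q)" for g :: "real \<Rightarrow> real"
    by (intro sum.mono_neutral_cong_right) (use R in \<open>auto simp: c0_def\<close>)
  have dsum: "(\<Sum>q\<in>R. d q * g q) = g r" "(\<Sum>q\<in>R. g q * d q) = g r" for g :: "real \<Rightarrow> real"
    using R by (auto simp: d_def if_distrib[of "\<lambda>z. z * _"] if_distrib[of "\<lambda>z. _ * z"] cong: if_cong)
  have sR: "(\<Sum>q\<in>insert s R. c2 q * g q) = k * g s + (\<Sum>q\<in>T. c q * g q) - k * \<rho> * g r" for g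
  proof -
    have "(\<Sum>q\<in>insert s R. c2 q * g q) = k * g s + (\<Sum>q\<in>R. c2 q * g q)"
      using R by (simp add: c2_def)
    also have "(\<Sum>q\<in>R. c2 q * g q) = (\<Sum>q\<in>R. c0 q * g q - k * \<rho> * (d q * g q))"
      using R by (intro sum.cong) (auto simp: c2_def c1_def algebra_simps)
    also have "\<dots> = (\<Sum>q\<in>T. c q * g q) - k * \<rho> * g r"
      by (simp add: sum_subtractf RT sum_distrib_left[symmetric] dsum)
    finally show ?thesis by simp
  qed
  have lhs: "\<theta> * Nz r s \<omega> + (\<Sum>q\<in>T. c q * X q \<omega>) = (\<Sum>q\<in>insert s R. c2 q * X q \<omega>)" for \<omega>
  proof -
    have "Nz r s \<omega> = (X s \<omega> - \<rho> * X r \<omega>) / \<kappa>" by (simp only: Nz_def \<rho>_def \<kappa>_def)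
    then show ?thesis unfolding sR by (simp add: k_def diff_divide_distrib right_diff_distrib)
  qed
  have mean: "(\<Sum>q\<in>insert s R. c2 q * bb_mean t x q) = (\<Sum>q\<in>T. c q * bb_mean t x q)"
  proof -
    have "bb_mean t x s = \<rho> * bb_mean t x r" using rs by (simp add: bb_mean_def \<rho>_def)
    then show ?thesis unfolding sR by simp
  qed
  have cov_s: "bb_cov t s q = \<rho> * bb_cov t r q" "bb_cov t q s = \<rho> * bb_cov t q r" if "q \<in> R" for q
  proof -
    have "t \<le> q" "q \<le> r" using that T rs by (auto simp: R_def)
    then have "min s q = q" "max s q = s" "min r q = q" "max r q = r" "min q s = q" "max q s = s" "min q r = q" "max q r = r"
      using rs by auto
    then show "bb_cov t s q = \<rho> * bb_cov t r q" "bb_cov t q s = \<rho> * bb_cov t q r"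
      using rs by (simp_all add: bb_cov_def \<rho>_def)
  qed
  have cov_ss: "bb_cov t s s = \<rho>\<^sup>2 * bb_cov t r r + \<kappa>\<^sup>2"
  proof -
    have r1: "1 - s = \<rho> * (1 - r)" using rs by (simp add: \<rho>_def)
    have "s - t = \<rho> * (r - t) + (s - r) * (1 - t) / (1 - r)"
    proof -
      have "(s - t) * (1 - r) = (1 - s) * (r - t) + (s - r) * (1 - t)" by (simp add: algebra_simps)
      then have "s - t = ((1 - s) * (r - t) + (s - r) * (1 - t)) / (1 - r)" using rs by (simp add: eq_divide_eq)
      then show ?thesis by (simp add: \<rho>_def add_divide_distrib)
    qed
    then have "bb_cov t s s = (\<rho> * (r - t) + (s - r) * (1 - t) / (1 - r)) * (\<rho> * (1 - r)) / (1 - t)"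
      unfolding bb_cov_def using r1 by simp
    also have "\<dots> = \<rho>\<^sup>2 * ((r - t) * (1 - r) / (1 - t)) + \<rho> * (s - r)"
    proof -
      have "(\<rho> * a + d * q / p) * (\<rho> * p) / q = \<rho>\<^sup>2 * (a * p / q) + \<rho> * d" if "0 < p" "0 < q" for a d p q :: real
        using that by (simp add: power2_eq_square field_simps)
      from this[of "1 - r" "1 - t"] show ?thesis using rs t1 by simp
    qed
    finally show ?thesis by (simp add: bb_cov_def \<kappa>(2))
  qed
  have sym: "bb_cov t p q = bb_cov t q p" for p q by (simp add: bb_cov_def min.commute max.commute)
  define q0 where "q0 = (\<Sum>p\<in>T. \<Sum>q\<in>T. c p * c q * bb_cov t p q)"
  define l where "l = (\<Sum>q\<in>T. c q * bb_cov t r q)"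
  have inner: "(\<Sum>q\<in>insert s R. c2 p * c2 q * bb_cov t p q) =
     c2 p * (k * bb_cov t p s + (\<Sum>q\<in>T. c q * bb_cov t p q) - k * \<rho> * bb_cov t p r)" for p
    using sR[of "bb_cov t p"] by (simp only: sum_distrib_left[symmetric] mult.assoc)
  have var: "(\<Sum>p\<in>insert s R. \<Sum>q\<in>insert s R. c2 p * c2 q * bb_cov t p q) = q0 + \<theta>\<^sup>2"
  proof -
    have "(\<Sum>p\<in>insert s R. \<Sum>q\<in>insert s R. c2 p * c2 q * bb_cov t p q)
      = k * (k * bb_cov t s s + (\<Sum>q\<in>T. c q * bb_cov t s q) - k * \<rho> * bb_cov t s r)
       + (\<Sum>p\<in>T. c p * (k * bb_cov t p s + (\<Sum>q\<in>T. c q * bb_cov t p q) - k * \<rho> * bb_cov t p r))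
       - k * \<rho> * (k * bb_cov t r s + (\<Sum>q\<in>T. c q * bb_cov t r q) - k * \<rho> * bb_cov t r r)"
      unfolding inner by (rule sR)
    also have "(\<Sum>q\<in>T. c q * bb_cov t s q) = \<rho> * l"
      unfolding l_def sum_distrib_left using R by (intro sum.cong) (auto simp: cov_s)
    also have "(\<Sum>p\<in>T. c p * (k * bb_cov t p s + (\<Sum>q\<in>T. c q * bb_cov t p q) - k * \<rho> * bb_cov t p r)) = q0"
      unfolding q0_def using R
      by (intro sum.cong) (auto simp: cov_s sum_distrib_left mult_ac)
    also have "(\<Sum>q\<in>T. c q * bb_cov t r q) = l" by (simp add: l_def)
    also have "bb_cov t s r = \<rho> * bb_cov t r r" using R by (simp add: cov_s)
    also have "bb_cov t r s = \<rho> * bb_cov t r r" using R by (simp add: cov_s)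
    also have "k * (k * bb_cov t s s + \<rho> * l - k * \<rho> * (\<rho> * bb_cov t r r)) + q0
        - k * \<rho> * (k * (\<rho> * bb_cov t r r) + l - k * \<rho> * bb_cov t r r) = q0 + k\<^sup>2 * (bb_cov t s s - \<rho>\<^sup>2 * bb_cov t r r)"
      by (simp add: power2_eq_square algebra_simps)
    also have "\<dots> = q0 + \<theta>\<^sup>2"
      using \<kappa>(1) by (simp add: cov_ss k_def power_divide)
    finally show ?thesis .
  qed
  have "expectation (\<lambda>\<omega>. cos (\<theta> * Nz r s \<omega> + (\<Sum>q\<in>T. c q * X q \<omega>) + a))
      = exp (- (q0 + \<theta>\<^sup>2) / 2) * cos ((\<Sum>q\<in>T. c q * bb_mean t x q) + a)"
    unfolding lhs using R rs by (subst expectation_cos_X) (auto simp only: var mean, auto)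
  moreover have "expectation (\<lambda>\<omega>. cos ((\<Sum>q\<in>T. c q * X q \<omega>) + a)) = exp (- q0 / 2) * cos ((\<Sum>q\<in>T. c q * bb_mean t x q) + a)"
    unfolding q0_def using T R by (subst expectation_cos_X) auto
  moreover have "exp (- (q0 + \<theta>\<^sup>2) / 2) = exp (- \<theta>\<^sup>2 / 2) * exp (- q0 / 2)"
    by (simp add: exp_add[symmetric] field_simps)
  ultimately show ?thesis by simp
qed

lemma distr_Nz:
  assumes rs: "t \<le> r" "r < s" "s < 1"
  shows "distr M borel (Nz r s) = std_normal_distribution"
proof (rule Levy_uniqueness)
  have [measurable]: "Nz r s \<in> borel_measurable M" by (rule Nz_measurable[OF rs])
  interpret N: prob_space std_normal_distribution by (rule prob_space_std_normal)
  show "real_distribution (distr M borel (Nz r s))" by (rule real_distribution_distr) simp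
  show "real_distribution std_normal_distribution"
    by (auto simp: real_distribution_def real_distribution_axioms_def prob_space_std_normal)
  show "char (distr M borel (Nz r s)) = char std_normal_distribution"
  proof
    fix \<theta>
    have i: "integrable M (\<lambda>\<omega>. iexp (\<theta> * Nz r s \<omega>))"
      by (intro integrable_iexp) auto
    have E: "expectation (\<lambda>\<omega>. cos (\<theta> * Nz r s \<omega> + a)) = exp (- \<theta>\<^sup>2 / 2) * cos a" for a
      using expectation_cos_Nz[OF rs, of "{}" \<theta> "\<lambda>_. 0" a] by (simp add: prob_space)
    have ch: "char (distr M borel (Nz r s)) \<theta> = (CLINT \<omega>|M. iexp (\<theta> * Nz r s \<omega>))"
      unfolding char_def by (rule integral_distr) auto
    have "Re (char (distr M borel (Nz r s)) \<theta>) = exp (- \<theta>\<^sup>2 / 2)"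
      unfolding ch integral_Re[OF i, symmetric] using E[of 0] by (simp add: Re_exp)
    moreover have "Im (char (distr M borel (Nz r s)) \<theta>) = 0"
      unfolding ch integral_Im[OF i, symmetric] using E[of "- (pi / 2)"] by (simp add: Im_exp cos_diff)
    ultimately show "char (distr M borel (Nz r s)) \<theta> = char std_normal_distribution \<theta>"
      by (simp add: char_std_normal_distribution complex_eq_iff)
  qed
qed

text \<open>Cylinder sets over finitely many times in \<open>[t, r]\<close> form an
  intersection-stable generator of \<open>F r\<close>. On them independence is
  \<open>prob_prod_eq_of_cos\<close>, whose factorisation hypothesis is supplied by
  \<open>expectation_cos_Nz\<close>.\<close>

lemma indep_Nz:
  assumes rs: "t \<le> r" "r < s" "s < 1"
  shows "indep_set (sets (F r)) (sigma_sets (space M) {Nz r s -` B \<inter> space M | B. B \<in> sets borel})"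
proof -
  have [measurable]: "Nz r s \<in> borel_measurable M" by (rule Nz_measurable[OF rs])
  define cyl where "cyl T A = {\<omega> \<in> space M. \<forall>q\<in>T. X q \<omega> \<in> A q}" for T and A :: "real \<Rightarrow> real set"
  define E where "E = {cyl T A | T A. finite T \<and> T \<subseteq> {t..r} \<and> (\<forall>q\<in>T. A q \<in> sets borel)}"
  define H where "H = {Nz r s -` B \<inter> space M | B. B \<in> sets (borel :: real measure)}"
  have cyl_meas: "cyl T A \<in> sets M" if "finite T" "T \<subseteq> {t..r}" "\<forall>q\<in>T. A q \<in> sets borel" for T A
  proof -
    have "cyl T A = (\<Inter>q\<in>T. X q -` A q \<inter> space M) \<inter> space M" by (auto simp: cyl_def)
    moreover have "(\<Inter>q\<in>T. X q -` A q \<inter> space M) \<inter> space M \<in> sets M"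
    proof (cases "T = {}")
      case False
      then show ?thesis using that rs
        by (intro sets.Int sets.finite_INT measurable_sets[OF X_measurable]) auto
    qed simp
    ultimately show ?thesis by simp
  qed
  have E_meas: "E \<subseteq> events" using cyl_meas by (auto simp: E_def)
  have H_meas: "H \<subseteq> events" by (auto simp: H_def)
  have indep: "indep_set E H"
    unfolding indep_sets2_eq
  proof (intro conjI ballI E_meas H_meas)
    fix a b assume "a \<in> E" "b \<in> H"
    then obtain T A B where TA: "a = cyl T A" "finite T" "T \<subseteq> {t..r}" "\<forall>q\<in>T. A q \<in> sets borel"
      and B: "b = Nz r s -` B \<inter> space M" "B \<in> sets borel" by (auto simp: E_def H_def)
    have ind_a: "(\<Prod>q\<in>T. indicator (A q) (X q \<omega>) :: real) = indicator a \<omega>" if "\<omega> \<in> space M" for \<omega>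
    proof (cases "\<forall>q\<in>T. X q \<omega> \<in> A q")
      case True
      then show ?thesis using that by (simp add: TA(1) cyl_def)
    next
      case False
      then obtain q where q: "q \<in> T" "X q \<omega> \<notin> A q" by auto
      then have "(\<Prod>q\<in>T. indicator (A q) (X q \<omega>) :: real) = 0"
        by (intro prod_zero[OF TA(2)] bexI[of _ q]) auto
      then show ?thesis using q by (auto simp: TA(1) cyl_def indicator_def)
    qed
    have ind_b: "indicator B (Nz r s \<omega>) = (indicator b \<omega> :: real)" if "\<omega> \<in> space M" for \<omega>
      using that by (auto simp: B(1) indicator_def)
    have ev: "a \<in> events" "b \<in> events" using \<open>a \<in> E\<close> \<open>b \<in> H\<close> E_meas H_meas by auto
    have "expectation (\<lambda>\<omega>. indicator B (Nz r s \<omega>) * (\<Prod>q\<in>T. indicator (A q) (X q \<omega>)))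
      = expectation (\<lambda>\<omega>. indicator B (Nz r s \<omega>)) * (expectation (\<lambda>\<omega>. \<Prod>q\<in>T. indicator (A q) (X q \<omega>)) :: real)"
      by (rule prob_prod_eq_of_cos[where g="\<lambda>\<theta>. exp (- \<theta>\<^sup>2 / 2)"])
         (use TA B rs expectation_cos_Nz[OF rs TA(2,3)] in \<open>auto intro!: X_measurable\<close>)
    also have "expectation (\<lambda>\<omega>. indicator B (Nz r s \<omega>) * (\<Prod>q\<in>T. indicator (A q) (X q \<omega>)))
        = (expectation (indicator (a \<inter> b)) :: real)"
      by (intro Bochner_Integration.integral_cong refl) (simp add: ind_a ind_b indicator_inter_arith mult.commute)
    also have "expectation (\<lambda>\<omega>. indicator B (Nz r s \<omega>)) = (expectation (indicator b) :: real)"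
      by (intro Bochner_Integration.integral_cong refl) (simp add: ind_b)
    also have "expectation (\<lambda>\<omega>. \<Prod>q\<in>T. indicator (A q) (X q \<omega>)) = (expectation (indicator a) :: real)"
      by (intro Bochner_Integration.integral_cong refl) (simp add: ind_a)
    finally show "prob (a \<inter> b) = prob a * prob b" using ev by simp
  qed
  have stE: "Int_stable E"
  proof (rule Int_stableI)
    fix a b assume "a \<in> E" "b \<in> E"
    then obtain T A T' A' where TA: "a = cyl T A" "finite T" "T \<subseteq> {t..r}" "\<forall>q\<in>T. A q \<in> sets borel"
      and TA': "b = cyl T' A'" "finite T'" "T' \<subseteq> {t..r}" "\<forall>q\<in>T'. A' q \<in> sets borel" by (auto simp: E_def)
    let ?A = "\<lambda>q. (if q \<in> T then A q else UNIV) \<inter> (if q \<in> T' then A' q else UNIV)"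
    have "a \<inter> b = cyl (T \<union> T') ?A" by (auto simp: TA(1) TA'(1) cyl_def)
    moreover have "\<forall>q\<in>T \<union> T'. ?A q \<in> sets borel" using TA TA' by auto
    ultimately show "a \<inter> b \<in> E" unfolding E_def using TA TA' by blast
  qed
  have stH: "Int_stable H"
  proof (rule Int_stableI)
    fix a b assume "a \<in> H" "b \<in> H"
    then obtain B B' where "a = Nz r s -` B \<inter> space M" "B \<in> sets borel" "b = Nz r s -` B' \<inter> space M" "B' \<in> sets borel"
      by (auto simp: H_def)
    then have "a \<inter> b = Nz r s -` (B \<inter> B') \<inter> space M" "B \<inter> B' \<in> sets borel" by auto
    then show "a \<inter> b \<in> H" unfolding H_def by blast
  qed
  have "indep_set (sigma_sets (space M) E) (sigma_sets (space M) H)"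
    by (rule indep_set_sigma_sets[OF indep stE stH])
  moreover have "sets (F r) \<subseteq> sigma_sets (space M) E"
    unfolding sets_F
  proof (rule sigma_sets_mono, safe)
    fix q A assume "q \<in> {t..min r 1}" "A \<in> sets (borel :: real measure)"
    then have "X q -` A \<inter> space M = cyl {q} (\<lambda>_. A)" "q \<in> {t..r}" by (auto simp: cyl_def)
    then show "X q -` A \<inter> space M \<in> sigma_sets (space M) E"
      using \<open>A \<in> sets borel\<close>
      by (intro sigma_sets.Basic) (auto simp: E_def intro!: exI[of _ "{q}"] exI[of _ "\<lambda>_. A"])
  qed
  ultimately show ?thesis
    unfolding indep_sets2_eq H_def[symmetric] using sets_F_subset by blast
qed

lemma markov_step:
  fixes G :: "real \<Rightarrow> real"
  assumes rs: "t \<le> r" "r < s" "s < 1" and A: "A \<in> sets (F r)"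
    and G [measurable]: "G \<in> borel_measurable borel" and bound: "\<And>z. \<bar>G z\<bar> \<le> a * (1 + z\<^sup>2)"
  defines "e \<equiv> (s - r) / (1 - r)"
  shows "expectation (\<lambda>\<omega>. indicator A \<omega> * G (Z s \<omega>))
    = expectation (\<lambda>\<omega>. indicator A \<omega> * (\<integral>y. G (sqrt (1 - e) * Z r \<omega> + sqrt e * y) \<partial>std_normal_distribution))"
proof -
  have s_in: "s \<in> {t..<1}" and r_in: "r \<in> {t..<1}" using rs by auto
  have [measurable]: "Nz r s \<in> borel_measurable M" "Z r \<in> borel_measurable M" "A \<in> sets M" "Z s \<in> borel_measurable M"
    using Nz_measurable[OF rs] Z_measurable[OF r_in] Z_measurable[OF s_in] A sets_F_subset by auto
  \<comment> \<open>The event is carried along as a real coordinate, so the product form of one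
    joint law accounts for both the event and the position; Fubini then integrates out the
    innovation.\<close>
  define Y where "Y \<omega> = (indicator A \<omega> :: real, Z r \<omega>)" for \<omega>
  have Y_F: "Y \<in> measurable (F r) (borel \<Otimes>\<^sub>M borel)"
    unfolding Y_def[abs_def] using A Z_measurable_F[of r r] rs by (intro measurable_Pair) auto
  have Y_M [measurable]: "Y \<in> measurable M (borel \<Otimes>\<^sub>M borel)"
    unfolding Y_def[abs_def] by measurable
  interpret N: prob_space std_normal_distribution by (rule prob_space_std_normal)
  have joint: "distr M ((borel \<Otimes>\<^sub>M borel) \<Otimes>\<^sub>M borel) (\<lambda>\<omega>. (Y \<omega>, Nz r s \<omega>))
      = distr M (borel \<Otimes>\<^sub>M borel) Y \<Otimes>\<^sub>M std_normal_distribution"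
  proof (rule pair_measure_eqI[symmetric])
    show "sigma_finite_measure (distr M (borel \<Otimes>\<^sub>M borel) Y)"
      by (intro prob_space_imp_sigma_finite prob_space_distr) simp
    show "sigma_finite_measure std_normal_distribution" ..
    fix A' B assume A': "A' \<in> sets (distr M (borel \<Otimes>\<^sub>M borel) Y)" and B: "B \<in> sets std_normal_distribution"
    have "Y -` A' \<inter> space M \<in> sets (F r)"
      using measurable_sets[OF Y_F, of A'] A' by (simp add: space_F)
    moreover have "Nz r s -` B \<inter> space M \<in> sigma_sets (space M) {Nz r s -` B \<inter> space M | B. B \<in> sets borel}"
      using B by (intro sigma_sets.Basic) auto
    ultimately have "prob ((Y -` A' \<inter> space M) \<inter> (Nz r s -` B \<inter> space M)) = prob (Y -` A' \<inter> space M) * prob (Nz r s -` B \<inter> space M)"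
      using indep_Nz[OF rs] unfolding indep_sets2_eq by blast
    moreover have "(\<lambda>\<omega>. (Y \<omega>, Nz r s \<omega>)) -` (A' \<times> B) \<inter> space M = (Y -` A' \<inter> space M) \<inter> (Nz r s -` B \<inter> space M)"
      by auto
    ultimately show "emeasure (distr M (borel \<Otimes>\<^sub>M borel) Y) A' * emeasure std_normal_distribution B
        = emeasure (distr M ((borel \<Otimes>\<^sub>M borel) \<Otimes>\<^sub>M borel) (\<lambda>\<omega>. (Y \<omega>, Nz r s \<omega>))) (A' \<times> B)"
      using A' B unfolding distr_Nz[OF rs, symmetric]
      by (simp add: emeasure_distr emeasure_eq_measure ennreal_mult)
  qed simp
  define h where "h p = fst (fst p) * G (sqrt (1 - e) * snd (fst p) + sqrt e * snd p)" for p :: "(real \<times> real) \<times> real"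
  have h [measurable]: "h \<in> borel_measurable ((borel \<Otimes>\<^sub>M borel) \<Otimes>\<^sub>M borel)"
    unfolding h_def[abs_def] by measurable
  have hY: "h (Y \<omega>, Nz r s \<omega>) = indicator A \<omega> * G (Z s \<omega>)" for \<omega>
    unfolding h_def Y_def Z_step[OF rs, folded e_def] by simp
  have int: "integrable M (\<lambda>\<omega>. h (Y \<omega>, Nz r s \<omega>))"
    unfolding hY by (rule Bochner_Integration.integrable_bound[OF integrable_Z_quadratic[OF s_in G bound]])
      (auto simp: indicator_def)
  then have int2: "integrable (distr M (borel \<Otimes>\<^sub>M borel) Y \<Otimes>\<^sub>M std_normal_distribution) h"
    unfolding joint[symmetric] by (subst integrable_distr_eq) auto
  interpret DY: prob_space "distr M (borel \<Otimes>\<^sub>M borel) Y" by (rule prob_space_distr) simp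
  interpret P: pair_sigma_finite "distr M (borel \<Otimes>\<^sub>M borel) Y" std_normal_distribution ..
  have "expectation (\<lambda>\<omega>. indicator A \<omega> * G (Z s \<omega>)) = expectation (\<lambda>\<omega>. h (Y \<omega>, Nz r s \<omega>))"
    by (simp add: hY)
  also have "\<dots> = (\<integral>p. h p \<partial>distr M ((borel \<Otimes>\<^sub>M borel) \<Otimes>\<^sub>M borel) (\<lambda>\<omega>. (Y \<omega>, Nz r s \<omega>)))"
    by (subst integral_distr) auto
  also have "\<dots> = (\<integral>q. (\<integral>y. h (q, y) \<partial>std_normal_distribution) \<partial>distr M (borel \<Otimes>\<^sub>M borel) Y)"
    unfolding joint by (rule P.integral_fst'[symmetric, OF int2])
  also have "\<dots> = expectation (\<lambda>\<omega>. \<integral>y. h (Y \<omega>, y) \<partial>std_normal_distribution)"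
    by (rule integral_distr) measurable
  also have "\<dots> = expectation (\<lambda>\<omega>. indicator A \<omega> * (\<integral>y. G (sqrt (1 - e) * Z r \<omega> + sqrt e * y) \<partial>std_normal_distribution))"
    by (simp add: h_def Y_def)
  finally show ?thesis .
qed

end

section \<open>Convergence of expectations\<close>

text \<open>Fatou's lemma passes the second-moment bound to the limit. The deviation
  \<open>D\<close> is then split as \<open>D \<le> min D K + D\<^sup>2 / K\<close>: the truncated
  part tends to \<open>0\<close> by dominated convergence, and the remainder is uniformly small for
  large \<open>K\<close>.\<close>

lemma (in prob_space)
  fixes Y :: "nat \<Rightarrow> 'a \<Rightarrow> real"
  assumes [measurable]: "\<And>n. Y n \<in> borel_measurable M" "L \<in> borel_measurable M"
    and int: "\<And>n. integrable M (\<lambda>\<omega>. (Y n \<omega>)\<^sup>2)" and bound: "\<And>n. expectation (\<lambda>\<omega>. (Y n \<omega>)\<^sup>2) \<le> C"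
    and lim: "AE \<omega> in M. (\<lambda>n. Y n \<omega>) \<longlonglongrightarrow> L \<omega>"
  shows integrable_of_L2_bounded: "integrable M L"
    and expectation_tendsto_of_L2_bounded: "(\<lambda>n. expectation (Y n)) \<longlonglongrightarrow> expectation L"
proof -
  have C0: "0 \<le> C" using bound[of 0] by (rule order_trans[rotated]) simp
  have nn: "(\<integral>\<^sup>+\<omega>. ennreal ((Y n \<omega>)\<^sup>2) \<partial>M) \<le> ennreal C" for n
    using bound[of n] by (subst nn_integral_eq_integral[OF int]) (auto intro: ennreal_leI)
  have "(\<integral>\<^sup>+\<omega>. ennreal ((L \<omega>)\<^sup>2) \<partial>M) = (\<integral>\<^sup>+\<omega>. liminf (\<lambda>n. ennreal ((Y n \<omega>)\<^sup>2)) \<partial>M)"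
  proof (rule nn_integral_cong_AE)
    show "AE \<omega> in M. ennreal ((L \<omega>)\<^sup>2) = liminf (\<lambda>n. ennreal ((Y n \<omega>)\<^sup>2))"
      using lim
    proof eventually_elim
      case (elim \<omega>)
      then have "(\<lambda>n. ennreal ((Y n \<omega>)\<^sup>2)) \<longlonglongrightarrow> ennreal ((L \<omega>)\<^sup>2)"
        by (intro tendsto_ennrealI tendsto_power)
      then show ?case by (intro lim_imp_Liminf[symmetric]) auto
    qed
  qed
  also have "\<dots> \<le> liminf (\<lambda>n. \<integral>\<^sup>+\<omega>. ennreal ((Y n \<omega>)\<^sup>2) \<partial>M)"
    by (rule nn_integral_liminf) measurable
  also have "\<dots> \<le> ennreal C"
    by (rule Liminf_le) (auto intro!: always_eventually nn)
  finally have L2: "(\<integral>\<^sup>+\<omega>. ennreal ((L \<omega>)\<^sup>2) \<partial>M) \<le> ennreal C" .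
  have iL2: "integrable M (\<lambda>\<omega>. (L \<omega>)\<^sup>2)"
    using L2 by (intro integrableI_bounded) (auto intro: le_less_trans)
  have EL2: "expectation (\<lambda>\<omega>. (L \<omega>)\<^sup>2) \<le> C"
    using L2 C0 by (subst (asm) nn_integral_eq_integral[OF iL2]) auto
  have abs_le: "\<bar>y\<bar> \<le> 1 + y\<^sup>2" for y :: real
  proof -
    have "0 \<le> (\<bar>y\<bar> - 1)\<^sup>2" by simp
    then have "2 * \<bar>y\<bar> \<le> 1 + y\<^sup>2" by (simp add: power2_eq_square algebra_simps)
    then show ?thesis using abs_ge_zero[of y] by linarith
  qed
  have l1: "integrable M g" if [measurable]: "g \<in> borel_measurable M" and "integrable M (\<lambda>\<omega>. (g \<omega>)\<^sup>2)" for g :: "'a \<Rightarrow> real"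
    by (rule Bochner_Integration.integrable_bound[where f="\<lambda>\<omega>. 1 + (g \<omega>)\<^sup>2"]) (use that abs_le in auto)
  show iL: "integrable M L" by (rule l1[OF _ iL2]) simp
  have iY: "integrable M (Y n)" for n by (rule l1[OF _ int]) simp
  define D where "D n \<omega> = \<bar>Y n \<omega> - L \<omega>\<bar>" for n \<omega>
  have [measurable]: "D n \<in> borel_measurable M" for n unfolding D_def[abs_def] by measurable
  have D0: "0 \<le> D n \<omega>" for n \<omega> by (simp add: D_def)
  have D2: "(D n \<omega>)\<^sup>2 \<le> 2 * (Y n \<omega>)\<^sup>2 + 2 * (L \<omega>)\<^sup>2" for n \<omega>
  proof -
    have "0 \<le> (Y n \<omega> + L \<omega>)\<^sup>2" by simp
    then show ?thesis by (simp add: D_def power2_eq_square algebra_simps)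
  qed
  have iD: "integrable M (D n)" for n
    unfolding D_def[abs_def] using iY iL by auto
  have iD2: "integrable M (\<lambda>\<omega>. (D n \<omega>)\<^sup>2)" for n
    by (rule Bochner_Integration.integrable_bound[where f="\<lambda>\<omega>. 2 * (Y n \<omega>)\<^sup>2 + 2 * (L \<omega>)\<^sup>2"])
       (use int iL2 D2 in auto)
  have ED2: "expectation (\<lambda>\<omega>. (D n \<omega>)\<^sup>2) \<le> 4 * C" for n
  proof -
    have "expectation (\<lambda>\<omega>. (D n \<omega>)\<^sup>2) \<le> expectation (\<lambda>\<omega>. 2 * (Y n \<omega>)\<^sup>2 + 2 * (L \<omega>)\<^sup>2)"
      by (intro integral_mono iD2 D2) (use int iL2 in auto)
    also have "\<dots> = 2 * expectation (\<lambda>\<omega>. (Y n \<omega>)\<^sup>2) + 2 * expectation (\<lambda>\<omega>. (L \<omega>)\<^sup>2)"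
      using int iL2 by simp
    finally show ?thesis using bound[of n] EL2 by linarith
  qed
  have D_lim: "(\<lambda>n. expectation (D n)) \<longlonglongrightarrow> 0"
  proof (rule LIMSEQ_I)
    fix \<epsilon> :: real assume \<epsilon>: "0 < \<epsilon>"
    \<comment> \<open>Chosen so that \<open>4 * C / K \<le> \<epsilon> / 2\<close>; the summand
      \<open>1\<close> keeps \<open>K\<close> positive when \<open>C = 0\<close>.\<close>
    define K where "K = (8 * C + 1) / \<epsilon>"
    have K: "0 < K" using \<epsilon> C0 by (simp add: K_def)
    have "(\<lambda>n. expectation (\<lambda>\<omega>. min (D n \<omega>) K)) \<longlonglongrightarrow> expectation (\<lambda>\<omega>. 0)"
    proof (rule integral_dominated_convergence[where w="\<lambda>_. K"])
      show "AE \<omega> in M. (\<lambda>n. min (D n \<omega>) K) \<longlonglongrightarrow> 0"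
        using lim
      proof eventually_elim
        case (elim \<omega>)
        then have "(\<lambda>n. D n \<omega>) \<longlonglongrightarrow> \<bar>L \<omega> - L \<omega>\<bar>"
          unfolding D_def by (intro tendsto_intros)
        then have "(\<lambda>n. min (D n \<omega>) K) \<longlonglongrightarrow> min 0 K"
          by (intro tendsto_min tendsto_const) simp
        then show ?case using K by simp
      qed
    qed (use K D0 in \<open>auto intro!: always_eventually\<close>)
    then have "(\<lambda>n. expectation (\<lambda>\<omega>. min (D n \<omega>) K)) \<longlonglongrightarrow> 0" by simp
    from LIMSEQ_D[OF this, of "\<epsilon> / 2"] \<epsilon>
    obtain n0 where n0: "\<And>n. n \<ge> n0 \<Longrightarrow> \<bar>expectation (\<lambda>\<omega>. min (D n \<omega>) K)\<bar> < \<epsilon> / 2"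
      by auto
    show "\<exists>n0. \<forall>n\<ge>n0. norm (expectation (D n) - 0) < \<epsilon>"
    proof (intro exI[of _ n0] allI impI)
      fix n assume n: "n0 \<le> n"
      have ptw: "D n \<omega> \<le> min (D n \<omega>) K + (D n \<omega>)\<^sup>2 / K" for \<omega>
      proof (cases "D n \<omega> \<le> K")
        case True
        then show ?thesis using K by simp
      next
        case False
        then have "D n \<omega> * K \<le> D n \<omega> * D n \<omega>" using D0[of n \<omega>] by (intro mult_left_mono) auto
        then have "D n \<omega> \<le> (D n \<omega>)\<^sup>2 / K" using K by (simp add: field_simps power2_eq_square)
        then show ?thesis using False K by simp
      qed
      have imin: "integrable M (\<lambda>\<omega>. min (D n \<omega>) K)"
        by (rule integrable_const_bound[where B=K]) (use D0 K in auto)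
      have "expectation (D n) \<le> expectation (\<lambda>\<omega>. min (D n \<omega>) K + (D n \<omega>)\<^sup>2 / K)"
        by (intro integral_mono iD ptw Bochner_Integration.integrable_add imin) (use iD2 in auto)
      also have "\<dots> = expectation (\<lambda>\<omega>. min (D n \<omega>) K) + expectation (\<lambda>\<omega>. (D n \<omega>)\<^sup>2) / K"
        using imin iD2 by simp
      also have "\<dots> < \<epsilon> / 2 + 4 * C / K"
        using n0[OF n] ED2[of n] K by (intro add_less_le_mono divide_right_mono) auto
      also have "4 * C / K \<le> \<epsilon> / 2"
      proof -
        have "4 * C / K = \<epsilon> * (4 * C / (8 * C + 1))" using \<epsilon> C0 by (simp add: K_def)
        also have "\<dots> \<le> \<epsilon> * (1 / 2)" using \<epsilon> C0 by (intro mult_left_mono) (auto simp: divide_simps)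
        finally show ?thesis by simp
      qed
      finally have "expectation (D n) < \<epsilon>" by simp
      moreover have "0 \<le> expectation (D n)" using D0 by (intro Bochner_Integration.integral_nonneg)
      ultimately show "norm (expectation (D n) - 0) < \<epsilon>" by simp
    qed
  qed
  have "\<forall>n. norm (expectation (Y n) - expectation L) \<le> expectation (D n)"
  proof
    fix n
    have "expectation (Y n) - expectation L = expectation (\<lambda>\<omega>. Y n \<omega> - L \<omega>)"
      using iY iL by simp
    then show "norm (expectation (Y n) - expectation L) \<le> expectation (D n)"
      unfolding D_def by (simp add: integral_norm_bound[of M "\<lambda>\<omega>. Y n \<omega> - L \<omega>", simplified])
  qed
  from Lim_null_comparison[OF always_eventually[OF this] D_lim]
  have "(\<lambda>n. expectation (Y n) - expectation L) \<longlonglongrightarrow> 0" .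
  then show "(\<lambda>n. expectation (Y n)) \<longlonglongrightarrow> expectation L"
    by (simp add: LIM_zero_iff)
qed

subsection \<open>The operator on functions of quadratic growth\<close>

lemma borel_measurable_ou [measurable]:
  fixes G :: "real \<Rightarrow> real"
  assumes [measurable]: "G \<in> borel_measurable borel"
  shows "ou e G \<in> borel_measurable borel"
proof -
  interpret N: prob_space std_normal_distribution by (rule prob_space_std_normal)
  show ?thesis unfolding ou_def[abs_def] by measurable
qed

lemma integral_std_normal_affine_square:
  "(\<integral>y. (p + q * y)\<^sup>2 \<partial>std_normal_distribution) = p\<^sup>2 + q\<^sup>2"
proof -
  interpret N: prob_space std_normal_distribution by (rule prob_space_std_normal)
  have i: "integrable std_normal_distribution (\<lambda>y. 2 * p * q * y)"
    "integrable std_normal_distribution (\<lambda>y. q\<^sup>2 * y\<^sup>2)"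
    using integrable_std_normal_power(1)[of 1] integrable_std_normal_power(1)[of 2] by auto
  have eq: "(p + q * y)\<^sup>2 = p\<^sup>2 + 2 * p * q * y + q\<^sup>2 * y\<^sup>2" for y
    by (simp add: power2_sum power_mult_distrib)
  show ?thesis
    unfolding eq using i integral_std_normal_id integral_std_normal_square N.prob_space by simp
qed

lemma abs_ou_le:
  fixes G :: "real \<Rightarrow> real"
  assumes e: "0 < e" "e < 1" and [measurable]: "G \<in> borel_measurable borel"
    and b: "\<And>z. \<bar>G z\<bar> \<le> a * (1 + z\<^sup>2)"
  shows "\<bar>ou e G z\<bar> \<le> 2 * a * (1 + z\<^sup>2)"
proof -
  interpret N: prob_space std_normal_distribution by (rule prob_space_std_normal)
  let ?w = "\<lambda>y. sqrt (1 - e) * z + sqrt e * y"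
  have a: "0 \<le> a" using order_trans[OF abs_ge_zero b[of 0]] by simp
  have i: "integrable std_normal_distribution (\<lambda>y. (?w y)\<^sup>2)"
    by (rule integrable_std_normal_quadratic[where a=1]) auto
  have "\<bar>\<integral>y. G (?w y) \<partial>std_normal_distribution\<bar> \<le> (\<integral>y. \<bar>G (?w y)\<bar> \<partial>std_normal_distribution)"
    by (rule integral_abs_bound)
  also have "\<dots> \<le> (\<integral>y. a * (1 + (?w y)\<^sup>2) \<partial>std_normal_distribution)"
    by (intro integral_mono b integrable_abs integrable_std_normal_quadratic[OF _ b]) (use i in auto)
  also have "\<dots> = a * (1 + ((sqrt (1 - e) * z)\<^sup>2 + (sqrt e)\<^sup>2))"
    using i N.prob_space by (simp add: integral_std_normal_affine_square)
  also have "\<dots> \<le> a * (2 * (1 + z\<^sup>2))"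
  proof (rule mult_left_mono[OF _ a])
    have "(1 - e) * z\<^sup>2 \<le> 1 * z\<^sup>2" using e by (intro mult_right_mono) auto
    moreover have "z\<^sup>2 + e \<le> 1 + 2 * z\<^sup>2" using e zero_le_power2[of z] by linarith
    ultimately show "1 + ((sqrt (1 - e) * z)\<^sup>2 + (sqrt e)\<^sup>2) \<le> 2 * (1 + z\<^sup>2)"
      using e by (simp add: power_mult_distrib)
  qed
  finally have *: "\<bar>\<integral>y. G (?w y) \<partial>std_normal_distribution\<bar> \<le> 2 * a * (1 + z\<^sup>2)" by (simp add: algebra_simps)
  have "\<bar>ou e G z\<bar> \<le> \<bar>\<integral>y. G (?w y) \<partial>std_normal_distribution\<bar>"
    unfolding ou_def abs_mult using e by (intro mult_left_le_one_le) auto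
  with * show ?thesis by linarith
qed

lemma linear_imp_quadratic:
  fixes g z :: real
  assumes "\<bar>g\<bar> \<le> a + \<bar>z\<bar>" "0 \<le> a"
  shows "\<bar>g\<bar> \<le> (a + 1) * (1 + z\<^sup>2)"
proof -
  have "0 \<le> (\<bar>z\<bar> - 1)\<^sup>2" by simp
  then have "2 * \<bar>z\<bar> \<le> 1 + z\<^sup>2" by (simp add: power2_eq_square algebra_simps)
  moreover have "0 \<le> a * z\<^sup>2" using assms(2) by simp
  moreover have "(a + 1) * (1 + z\<^sup>2) = a + a * z\<^sup>2 + (1 + z\<^sup>2)" by (simp add: algebra_simps)
  ultimately show ?thesis using assms abs_ge_zero[of z] by linarith
qed

subsection \<open>Geometric time grids\<close>

text \<open>The remaining time shrinks by the same factor in every step, so all steps have relative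
  size \<open>1 - \<rho>\<close> and are governed by the single operator
  \<open>ou (1 - \<rho>)\<close>.\<close>

definition grid :: "real \<Rightarrow> real \<Rightarrow> nat \<Rightarrow> real" where
  "grid s \<rho> k = 1 - (1 - s) * \<rho> ^ k"

lemma grid_0 [simp]: "grid s \<rho> 0 = s"
  by (simp add: grid_def)

lemma grid_props:
  assumes "s < 1" "0 < \<rho>" "\<rho> < 1"
  shows grid_ge: "s \<le> grid s \<rho> k" and grid_less_1: "grid s \<rho> k < 1"
    and grid_less_Suc: "grid s \<rho> k < grid s \<rho> (Suc k)"
    and grid_ratio: "(grid s \<rho> (Suc k) - grid s \<rho> k) / (1 - grid s \<rho> k) = 1 - \<rho>"
proof -
  have p: "0 < \<rho> ^ k" "\<rho> ^ k \<le> 1" using assms by (auto intro: power_le_one)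
  have pos: "0 < (1 - s) * \<rho> ^ k" using assms p by simp
  show "grid s \<rho> k < 1" using pos by (simp add: grid_def)
  have "(1 - s) * \<rho> ^ k \<le> (1 - s) * 1" using assms p by (intro mult_left_mono) auto
  then show "s \<le> grid s \<rho> k" by (simp add: grid_def)
  have eq: "grid s \<rho> (Suc k) - grid s \<rho> k = (1 - \<rho>) * ((1 - s) * \<rho> ^ k)"
    by (simp add: grid_def algebra_simps)
  have "1 - grid s \<rho> k = (1 - s) * \<rho> ^ k" by (simp add: grid_def)
  then show "(grid s \<rho> (Suc k) - grid s \<rho> k) / (1 - grid s \<rho> k) = 1 - \<rho>"
    unfolding eq using pos by (metis less_irrefl nonzero_mult_div_cancel_right)
  have "0 < (1 - \<rho>) * ((1 - s) * \<rho> ^ k)" using assms pos by simp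
  then show "grid s \<rho> k < grid s \<rho> (Suc k)" using eq by linarith
qed

lemma grid_mono:
  assumes "s < 1" "0 < \<rho>" "\<rho> < 1" "k \<le> l"
  shows "grid s \<rho> k \<le> grid s \<rho> l"
  using assms(4) by (rule lift_Suc_mono_le[rotated]) (use grid_less_Suc[OF assms(1-3)] in \<open>auto intro: less_imp_le\<close>)

lemma one_minus_grid_Suc: "1 - grid s \<rho> (Suc k) = \<rho> * (1 - grid s \<rho> k)"
  by (simp add: grid_def)

text \<open>For increasing \<open>g\<close> this is the first index whose grid value is at least
  \<open>r\<close>, or \<open>n\<close> if there is none below \<open>n\<close>. Rounding up is
  essential: whether to go on after \<open>g k\<close> is decided by \<open>g k < r\<close>, which
  is known at time \<open>g k\<close> when \<open>r\<close> is a stopping time.\<close>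

definition index :: "(nat \<Rightarrow> real) \<Rightarrow> nat \<Rightarrow> real \<Rightarrow> nat" where
  "index g n r = card {k. k < n \<and> g k < r}"

lemma index_Suc:
  assumes "\<And>k l. k \<le> l \<Longrightarrow> g k \<le> g l"
  shows "index g (Suc n) r = (if g n < r then Suc n else index g n r)"
proof (cases "g n < r")
  case True
  then have "{k. k < Suc n \<and> g k < r} = {..<Suc n}"
    using le_less_trans[OF assms True] by (auto simp: less_Suc_eq_le)
  then show ?thesis using True by (simp add: index_def)
next
  case False
  then have "{k. k < Suc n \<and> g k < r} = {k. k < n \<and> g k < r}"
    by (auto simp: less_Suc_eq)
  then show ?thesis using False by (simp add: index_def)
qed

lemma index_telescope:
  fixes Y :: "nat \<Rightarrow> real"
  assumes mono: "\<And>k l. k \<le> l \<Longrightarrow> g k \<le> g l"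
  shows "Y (index g n r) = Y 0 + (\<Sum>k<n. if g k < r then Y (Suc k) - Y k else 0)"
proof (induction n)
  case (Suc n)
  show ?case
  proof (cases "g n < r")
    case True
    then have all: "g k < r" if "k \<le> n" for k using mono[OF that] by simp
    have "(\<Sum>k<Suc n. if g k < r then Y (Suc k) - Y k else 0) = (\<Sum>k<Suc n. Y (Suc k) - Y k)"
      using all by (intro sum.cong) auto
    also have "\<dots> = Y (Suc n) - Y 0" by (rule sum_lessThan_telescope)
    finally show ?thesis using True by (simp add: index_Suc[OF mono])
  next
    case False
    then show ?thesis using Suc by (simp add: index_Suc[OF mono])
  qed
qed (simp add: index_def)

lemma index_le: "index g n r \<le> n"
proof -
  have "card {k. k < n \<and> g k < r} \<le> card {..<n}" by (intro card_mono) auto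
  then show ?thesis by (simp add: index_def)
qed

lemma less_index_iff:
  assumes mono: "\<And>k l. k \<le> l \<Longrightarrow> g k \<le> g l"
  shows "k < index g n r \<longleftrightarrow> k < n \<and> g k < r"
proof (induction n)
  case (Suc n)
  then show ?case
    using mono[of k n] by (auto simp: index_Suc[OF mono] less_Suc_eq_le dest: le_less_trans)
qed (simp add: index_def)

text \<open>The grid point before the chosen one lies strictly below \<open>r\<close>, and one step
  scales the remaining time by \<open>\<rho>\<close>. Both bounds tend to \<open>r\<close> as
  \<open>\<rho>\<close> tends to \<open>1\<close>.\<close>

lemma grid_index_bounds:
  assumes "s < 1" "0 < \<rho>" "\<rho> < 1" and r: "s \<le> r" "r \<le> grid s \<rho> n"
  defines "i \<equiv> index (grid s \<rho>) n r"
  shows "r \<le> grid s \<rho> i" "grid s \<rho> i \<le> 1 - \<rho> * (1 - r)"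
proof -
  note iff = less_index_iff[of "grid s \<rho>" _ n r, OF grid_mono[OF assms(1-3)], folded i_def]
  show "r \<le> grid s \<rho> i"
    using iff[of i] index_le[of "grid s \<rho>" n r, folded i_def] r(2) by (cases "i = n") auto
  show "grid s \<rho> i \<le> 1 - \<rho> * (1 - r)"
  proof (cases i)
    case 0
    have "\<rho> * (1 - r) \<le> 1 * (1 - r)"
      using assms grid_less_1[OF assms(1-3), of n] by (intro mult_right_mono) auto
    then show ?thesis using 0 r by simp
  next
    case (Suc j)
    then have "grid s \<rho> j < r" using iff[of j] by simp
    then have "\<rho> * (1 - r) \<le> \<rho> * (1 - grid s \<rho> j)" using assms by (intro mult_left_mono) auto
    then show ?thesis using Suc one_minus_grid_Suc[of s \<rho> j] by simp
  qed
qed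

section \<open>Optional stopping along a grid\<close>

locale bridge_grid = bridge +
  fixes \<rho> :: real
  assumes \<rho>: "0 < \<rho>" "\<rho> < 1"
begin

definition tk :: "nat \<Rightarrow> real" where "tk k = grid t \<rho> k"

definition wk :: "nat \<Rightarrow> real" where "wk k = sqrt (1 - tk k)"

lemma tk_in: "tk k \<in> {t..<1}"
  using grid_ge[OF t1 \<rho>] grid_less_1[OF t1 \<rho>] by (simp add: tk_def)

lemma tk_mono: "k \<le> l \<Longrightarrow> tk k \<le> tk l"
  unfolding tk_def by (rule grid_mono[OF t1 \<rho>])

lemma tk_less_Suc: "tk k < tk (Suc k)"
  unfolding tk_def by (rule grid_less_Suc[OF t1 \<rho>])

lemma wk_pos: "0 < wk k"
  using tk_in[of k] by (simp add: wk_def)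

lemma wk_Suc: "wk (Suc k) = sqrt \<rho> * wk k"
  by (simp add: wk_def tk_def one_minus_grid_Suc real_sqrt_mult)

lemma wk_square: "(wk k)\<^sup>2 = 1 - tk k"
  using tk_in[of k] by (simp add: wk_def)

lemma X_eq_wk_Z: "X (tk k) \<omega> = wk k * Z (tk k) \<omega>"
  using wk_pos[of k] by (simp add: Z_def wk_def)

text \<open>Since \<open>1 - \<rho> = (1 - sqrt \<rho>) (1 + sqrt \<rho>)\<close>, the weights are dominated by a telescoping sum.\<close>
lemma wk_eps_le: "wk k * (1 - \<rho>) \<le> 2 * (wk k - wk (Suc k))"
proof -
  have s: "sqrt \<rho> * sqrt \<rho> = \<rho>" "sqrt \<rho> \<le> 1" using \<rho> by auto
  have "wk k * (1 - \<rho>) = (1 + sqrt \<rho>) * (wk k * (1 - sqrt \<rho>))"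
    using s(1) by (simp add: algebra_simps)
  also have "\<dots> \<le> 2 * (wk k * (1 - sqrt \<rho>))"
    using s(2) wk_pos[of k] by (intro mult_right_mono) auto
  finally show ?thesis by (simp add: wk_Suc algebra_simps)
qed

lemma wk_Suc_le: "wk (Suc k) \<le> wk k"
  using tk_less_Suc[of k] by (simp add: wk_def)

lemma markov_grid:
  fixes G :: "real \<Rightarrow> real"
  assumes A: "A \<in> sets (F (tk k))" and G: "G \<in> borel_measurable borel"
    and bound: "\<And>z. \<bar>G z\<bar> \<le> a * (1 + z\<^sup>2)"
  shows "expectation (\<lambda>\<omega>. indicator A \<omega> * G (Z (tk (Suc k)) \<omega>))
    = expectation (\<lambda>\<omega>. indicator A \<omega> * (\<integral>y. G (sqrt \<rho> * Z (tk k) \<omega> + sqrt (1 - \<rho>) * y) \<partial>std_normal_distribution))"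
  using markov_step[OF _ tk_less_Suc _ A G bound] tk_in[of k] tk_in[of "Suc k"]
  by (simp add: tk_def grid_ratio[OF t1 \<rho>])

lemma integrable_indicator_Z:
  fixes G :: "real \<Rightarrow> real"
  assumes A: "A \<in> sets M" and G: "G \<in> borel_measurable borel"
    and bound: "\<And>z. \<bar>G z\<bar> \<le> a * (1 + z\<^sup>2)"
  shows "integrable M (\<lambda>\<omega>. indicator A \<omega> * G (Z (tk k) \<omega>))"
  using integrable_mult_indicator[OF A integrable_Z_quadratic[OF tk_in G bound, of k]] by simp

text \<open>The factor \<open>sqrt \<rho>\<close> between consecutive weights is precisely the
  prefactor of \<open>ou\<close>, so the conditional drift of the weighted process is minus the
  one-step defect.\<close>

lemma expectation_step:
  fixes G :: "real \<Rightarrow> real"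
  assumes A: "A \<in> sets (F (tk k))" and G: "G \<in> borel_measurable borel"
    and bound: "\<And>z. \<bar>G z\<bar> \<le> a * (1 + z\<^sup>2)"
  shows "expectation (\<lambda>\<omega>. indicator A \<omega> * (wk (Suc k) * G (Z (tk (Suc k)) \<omega>) - wk k * G (Z (tk k) \<omega>)))
    = expectation (\<lambda>\<omega>. indicator A \<omega> * (wk k * (ou (1 - \<rho>) G (Z (tk k) \<omega>) - G (Z (tk k) \<omega>))))"
proof -
  have AM: "A \<in> sets M" using A sets_F_subset by auto
  note i = integrable_indicator_Z[OF AM G bound]
  have e: "0 < 1 - \<rho>" "1 - \<rho> < 1" using \<rho> by auto
  have j: "integrable M (\<lambda>\<omega>. indicator A \<omega> * ou (1 - \<rho>) G (Z (tk k) \<omega>))"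
    by (rule integrable_indicator_Z[OF AM _ abs_ou_le[OF e G bound]]) (use G in measurable)
  have "expectation (\<lambda>\<omega>. indicator A \<omega> * (wk (Suc k) * G (Z (tk (Suc k)) \<omega>) - wk k * G (Z (tk k) \<omega>)))
      = expectation (\<lambda>\<omega>. wk (Suc k) * (indicator A \<omega> * G (Z (tk (Suc k)) \<omega>)) - wk k * (indicator A \<omega> * G (Z (tk k) \<omega>)))"
    by (intro Bochner_Integration.integral_cong) (auto simp: algebra_simps)
  also have "\<dots> = wk (Suc k) * expectation (\<lambda>\<omega>. indicator A \<omega> * G (Z (tk (Suc k)) \<omega>))
      - wk k * expectation (\<lambda>\<omega>. indicator A \<omega> * G (Z (tk k) \<omega>))"
    using i by simp
  also have "wk (Suc k) * expectation (\<lambda>\<omega>. indicator A \<omega> * G (Z (tk (Suc k)) \<omega>))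
      = expectation (\<lambda>\<omega>. wk k * (indicator A \<omega> * ou (1 - \<rho>) G (Z (tk k) \<omega>)))"
  proof -
    have "wk k * (indicator A \<omega> * ou (1 - \<rho>) G (Z (tk k) \<omega>)) = wk (Suc k) *
        (indicator A \<omega> * (\<integral>y. G (sqrt \<rho> * Z (tk k) \<omega> + sqrt (1 - \<rho>) * y) \<partial>std_normal_distribution))" for \<omega>
      by (simp add: ou_def wk_Suc)
    then show ?thesis
      unfolding markov_grid[OF A G bound] by (simp only: integral_mult_right_zero)
  qed
  also have "\<dots> - wk k * expectation (\<lambda>\<omega>. indicator A \<omega> * G (Z (tk k) \<omega>))
      = expectation (\<lambda>\<omega>. wk k * (indicator A \<omega> * ou (1 - \<rho>) G (Z (tk k) \<omega>)) - wk k * (indicator A \<omega> * G (Z (tk k) \<omega>)))"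
    using i j by simp
  also have "\<dots> = expectation (\<lambda>\<omega>. indicator A \<omega> * (wk k * (ou (1 - \<rho>) G (Z (tk k) \<omega>) - G (Z (tk k) \<omega>))))"
    by (intro Bochner_Integration.integral_cong) (auto simp: algebra_simps)
  finally show ?thesis .
qed

section \<open>Stopping on the grid and the accumulated defect\<close>

definition stop :: "nat \<Rightarrow> ('a \<Rightarrow> real) \<Rightarrow> 'a \<Rightarrow> nat" where
  "stop n \<tau> \<omega> = index tk n (\<tau> \<omega>)"

lemma stop_sum:
  fixes Y :: "nat \<Rightarrow> 'a \<Rightarrow> real"
  assumes "\<omega> \<in> space M"
  shows "Y (stop n \<tau> \<omega>) \<omega> = Y 0 \<omega> + (\<Sum>k<n. indicator {\<omega> \<in> space M. tk k < \<tau> \<omega>} \<omega> * (Y (Suc k) \<omega> - Y k \<omega>))"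
proof -
  have "Y (stop n \<tau> \<omega>) \<omega> = Y 0 \<omega> + (\<Sum>k<n. if tk k < \<tau> \<omega> then Y (Suc k) \<omega> - Y k \<omega> else 0)"
    unfolding stop_def by (rule index_telescope[where Y="\<lambda>k. Y k \<omega>", OF tk_mono])
  also have "(\<Sum>k<n. if tk k < \<tau> \<omega> then Y (Suc k) \<omega> - Y k \<omega> else 0)
      = (\<Sum>k<n. indicator {\<omega> \<in> space M. tk k < \<tau> \<omega>} \<omega> * (Y (Suc k) \<omega> - Y k \<omega>))"
    using assms by (intro sum.cong) (auto simp: indicator_def)
  finally show ?thesis .
qed

lemma event_less:
  assumes "stopping_time F \<tau>"
  shows "{\<omega> \<in> space M. tk k < \<tau> \<omega>} \<in> sets (F (tk k))"
  using stopping_time_in_sets(2)[OF assms, of "tk k"] by (simp add: space_F)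

lemma integrable_stop:
  fixes Y :: "nat \<Rightarrow> 'a \<Rightarrow> real"
  assumes \<tau>: "stopping_time F \<tau>" and Y: "\<And>k. integrable M (Y k)"
  shows "integrable M (\<lambda>\<omega>. Y (stop n \<tau> \<omega>) \<omega>)"
proof -
  have "integrable M (\<lambda>\<omega>. Y 0 \<omega> + (\<Sum>k<n. indicator {\<omega> \<in> space M. tk k < \<tau> \<omega>} \<omega> * (Y (Suc k) \<omega> - Y k \<omega>)))"
  proof (intro Bochner_Integration.integrable_add Y Bochner_Integration.integrable_sum)
    fix k
    have "{\<omega> \<in> space M. tk k < \<tau> \<omega>} \<in> sets M" using event_less[OF \<tau>] sets_F_subset by blast
    then have "integrable M (\<lambda>\<omega>. indicator {\<omega> \<in> space M. tk k < \<tau> \<omega>} \<omega> *\<^sub>R (Y (Suc k) \<omega> - Y k \<omega>))"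
      by (intro integrable_mult_indicator Bochner_Integration.integrable_diff Y)
    then show "integrable M (\<lambda>\<omega>. indicator {\<omega> \<in> space M. tk k < \<tau> \<omega>} \<omega> * (Y (Suc k) \<omega> - Y k \<omega>))"
      by simp
  qed
  then show ?thesis
    by (subst Bochner_Integration.integrable_cong[OF refl stop_sum]) auto
qed

definition Yk :: "(real \<Rightarrow> real) \<Rightarrow> nat \<Rightarrow> 'a \<Rightarrow> real" where
  "Yk G k \<omega> = wk k * G (Z (tk k) \<omega>)"

lemma integrable_Yk:
  fixes G :: "real \<Rightarrow> real"
  assumes G: "G \<in> borel_measurable borel" and bound: "\<And>z. \<bar>G z\<bar> \<le> a * (1 + z\<^sup>2)"
  shows "integrable M (Yk G k)"
  unfolding Yk_def[abs_def] by (intro integrable_mult_right integrable_Z_quadratic[OF tk_in G bound])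

text \<open>The increment, between the rounded times, of the compensator in the Doob decomposition
  of \<open>- Yk G\<close>.\<close>

definition defect :: "(real \<Rightarrow> real) \<Rightarrow> nat \<Rightarrow> ('a \<Rightarrow> real) \<Rightarrow> ('a \<Rightarrow> real) \<Rightarrow> 'a \<Rightarrow> real" where
  "defect G n \<sigma> \<tau> \<omega> = (\<Sum>k<n. indicator {\<omega> \<in> space M. \<sigma> \<omega> \<le> tk k \<and> tk k < \<tau> \<omega>} \<omega>
     * (wk k * (G (Z (tk k) \<omega>) - ou (1 - \<rho>) G (Z (tk k) \<omega>))))"

text \<open>Both stopped values telescope over the events \<open>tk k < \<sigma>\<close> and
  \<open>tk k < \<tau>\<close>. Their difference retains exactly the steps with
  \<open>\<sigma> \<le> tk k < \<tau>\<close>, an event of \<open>F (tk k)\<close>, on which each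
  increment may be replaced by its conditional drift.\<close>

lemma
  fixes G :: "real \<Rightarrow> real"
  assumes \<sigma>: "stopping_time F \<sigma>" and \<tau>: "stopping_time F \<tau>" and le: "AE \<omega> in M. \<sigma> \<omega> \<le> \<tau> \<omega>"
    and G: "G \<in> borel_measurable borel" and bound: "\<And>z. \<bar>G z\<bar> \<le> a * (1 + z\<^sup>2)"
  shows integrable_defect: "integrable M (defect G n \<sigma> \<tau>)"
    and expectation_stop_diff: "expectation (\<lambda>\<omega>. Yk G (stop n \<sigma> \<omega>) \<omega>) - expectation (\<lambda>\<omega>. Yk G (stop n \<tau> \<omega>) \<omega>)
    = expectation (defect G n \<sigma> \<tau>)"
proof -
  define A where "A k = {\<omega> \<in> space M. \<sigma> \<omega> \<le> tk k \<and> tk k < \<tau> \<omega>}" for k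
  have A: "A k \<in> sets (F (tk k))" for k
  proof -
    have "A k = {\<omega> \<in> space (F (tk k)). \<sigma> \<omega> \<le> tk k} \<inter> {\<omega> \<in> space (F (tk k)). tk k < \<tau> \<omega>}"
      by (auto simp: A_def space_F)
    then show ?thesis using stopping_time_in_sets(1)[OF \<sigma>] stopping_time_in_sets(2)[OF \<tau>] by auto
  qed
  have AM: "A k \<in> sets M" for k using A sets_F_subset by blast
  have e: "0 < 1 - \<rho>" "1 - \<rho> < 1" using \<rho> by auto
  have bound2: "\<bar>G z - ou (1 - \<rho>) G z\<bar> \<le> 3 * a * (1 + z\<^sup>2)" for z
    using bound[of z] abs_ou_le[OF e G bound, of z] by (simp add: algebra_simps abs_le_iff)
  have meas2: "(\<lambda>z. G z - ou (1 - \<rho>) G z) \<in> borel_measurable borel" using G by measurable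
  have id: "integrable M (\<lambda>\<omega>. indicator (A k) \<omega> * (wk k * (G (Z (tk k) \<omega>) - ou (1 - \<rho>) G (Z (tk k) \<omega>))))" for k
    using integrable_mult_right[OF integrable_indicator_Z[OF AM meas2 bound2, of k k], of "wk k"]
    by (simp add: mult_ac)
  have defect_eq: "defect G n \<sigma> \<tau> = (\<lambda>\<omega>. \<Sum>k<n. indicator (A k) \<omega> * (wk k * (G (Z (tk k) \<omega>) - ou (1 - \<rho>) G (Z (tk k) \<omega>))))"
    by (rule ext) (simp only: defect_def A_def)
  show "integrable M (defect G n \<sigma> \<tau>)"
    unfolding defect_eq by (rule Bochner_Integration.integrable_sum) (rule id)
  note iY = integrable_Yk[OF G bound]
  have iS: "integrable M (\<lambda>\<omega>. Yk G (stop n \<sigma> \<omega>) \<omega>)" "integrable M (\<lambda>\<omega>. Yk G (stop n \<tau> \<omega>) \<omega>)"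
    by (rule integrable_stop[where Y="Yk G", OF \<sigma> iY], rule integrable_stop[where Y="Yk G", OF \<tau> iY])
  have "expectation (\<lambda>\<omega>. Yk G (stop n \<sigma> \<omega>) \<omega>) - expectation (\<lambda>\<omega>. Yk G (stop n \<tau> \<omega>) \<omega>)
      = expectation (\<lambda>\<omega>. Yk G (stop n \<sigma> \<omega>) \<omega> - Yk G (stop n \<tau> \<omega>) \<omega>)"
    by (rule Bochner_Integration.integral_diff[OF iS, symmetric])
  also have "\<dots> = expectation (\<lambda>\<omega>. - (\<Sum>k<n. indicator (A k) \<omega> * (Yk G (Suc k) \<omega> - Yk G k \<omega>)))"
  proof (rule integral_cong_AE)
    show "(\<lambda>\<omega>. Yk G (stop n \<sigma> \<omega>) \<omega> - Yk G (stop n \<tau> \<omega>) \<omega>) \<in> borel_measurable M"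
      by (rule borel_measurable_integrable[OF Bochner_Integration.integrable_diff[OF iS]])
    show "(\<lambda>\<omega>. - (\<Sum>k<n. indicator (A k) \<omega> * (Yk G (Suc k) \<omega> - Yk G k \<omega>))) \<in> borel_measurable M"
      using AM borel_measurable_integrable[OF iY] by measurable
    show "AE \<omega> in M. Yk G (stop n \<sigma> \<omega>) \<omega> - Yk G (stop n \<tau> \<omega>) \<omega> = - (\<Sum>k<n. indicator (A k) \<omega> * (Yk G (Suc k) \<omega> - Yk G k \<omega>))"
      using le
    proof (rule AE_mp, intro AE_I2 impI)
      fix \<omega> assume \<omega>: "\<omega> \<in> space M" "\<sigma> \<omega> \<le> \<tau> \<omega>"
      have "Yk G (stop n \<sigma> \<omega>) \<omega> - Yk G (stop n \<tau> \<omega>) \<omega>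
        = (\<Sum>k<n. indicator {\<omega> \<in> space M. tk k < \<sigma> \<omega>} \<omega> * (Yk G (Suc k) \<omega> - Yk G k \<omega>)
           - indicator {\<omega> \<in> space M. tk k < \<tau> \<omega>} \<omega> * (Yk G (Suc k) \<omega> - Yk G k \<omega>))"
        using stop_sum[OF \<omega>(1), of "Yk G" n \<sigma>] stop_sum[OF \<omega>(1), of "Yk G" n \<tau>] by (simp add: sum_subtractf)
      also have "\<dots> = (\<Sum>k<n. - (indicator (A k) \<omega> * (Yk G (Suc k) \<omega> - Yk G k \<omega>)))"
        using \<omega> by (intro sum.cong) (auto simp: A_def indicator_def)
      finally show "Yk G (stop n \<sigma> \<omega>) \<omega> - Yk G (stop n \<tau> \<omega>) \<omega> = - (\<Sum>k<n. indicator (A k) \<omega> * (Yk G (Suc k) \<omega> - Yk G k \<omega>))"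
        by (simp add: sum_negf)
    qed
  qed
  also have "\<dots> = - (\<Sum>k<n. expectation (\<lambda>\<omega>. indicator (A k) \<omega> * (Yk G (Suc k) \<omega> - Yk G k \<omega>)))"
  proof -
    have "integrable M (\<lambda>\<omega>. indicator (A k) \<omega> * (Yk G (Suc k) \<omega> - Yk G k \<omega>))" for k
      using integrable_mult_indicator[OF AM Bochner_Integration.integrable_diff[OF iY iY]] by simp
    then show ?thesis by (simp only: Bochner_Integration.integral_minus Bochner_Integration.integral_sum)
  qed
  also have "\<dots> = - (\<Sum>k<n. expectation (\<lambda>\<omega>. - (indicator (A k) \<omega> * (wk k * (G (Z (tk k) \<omega>) - ou (1 - \<rho>) G (Z (tk k) \<omega>))))))"
    unfolding Yk_def expectation_step[OF A G bound]
    by (intro arg_cong[where f=uminus] sum.cong Bochner_Integration.integral_cong) (auto simp: algebra_simps)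
  also have "\<dots> = expectation (defect G n \<sigma> \<tau>)"
    unfolding defect_eq Bochner_Integration.integral_sum[OF id] by (simp add: sum_negf)
  finally show "expectation (\<lambda>\<omega>. Yk G (stop n \<sigma> \<omega>) \<omega>) - expectation (\<lambda>\<omega>. Yk G (stop n \<tau> \<omega>) \<omega>)
    = expectation (defect G n \<sigma> \<tau>)" .
qed

text \<open>Given the past, the mean of the next value of \<open>X\<^sup>2\<close> is
  \<open>\<rho>\<^sup>2\<close> times the present one plus \<open>\<rho>\<close> times the length of
  the time step. So \<open>X\<^sup>2\<close> minus time decreases on average, and the total time is
  at most \<open>1 - t\<close>. The bound is independent of \<open>\<rho>\<close>, \<open>n\<close>
  and \<open>\<tau>\<close>.\<close>

lemma
  assumes \<tau>: "stopping_time F \<tau>"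
  shows integrable_X_stop_square: "integrable M (\<lambda>\<omega>. (X (tk (stop n \<tau> \<omega>)) \<omega>)\<^sup>2)"
    and expectation_X_stop_square_le: "expectation (\<lambda>\<omega>. (X (tk (stop n \<tau> \<omega>)) \<omega>)\<^sup>2) \<le> x\<^sup>2 + (1 - t)"
proof -
  define Y where "Y k \<omega> = (X (tk k) \<omega>)\<^sup>2" for k \<omega>
  have iY: "integrable M (Y k)" for k
    unfolding Y_def[abs_def] by (rule integrable_X_square[OF tk_in])
  from integrable_stop[where Y=Y, OF \<tau> iY] show "integrable M (\<lambda>\<omega>. (X (tk (stop n \<tau> \<omega>)) \<omega>)\<^sup>2)"
    by (simp add: Y_def)
  define A where "A k = {\<omega> \<in> space M. tk k < \<tau> \<omega>}" for k
  have A: "A k \<in> sets (F (tk k))" for k unfolding A_def by (rule event_less[OF \<tau>])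
  have AM: "A k \<in> sets M" for k using A sets_F_subset by blast
  have iA: "integrable M (\<lambda>\<omega>. indicator (A k) \<omega> * (Y l \<omega>))" for k l
    using integrable_mult_indicator[OF AM iY] by simp
  have e: "0 \<le> 1 - \<rho>" using \<rho> by simp
  have step: "expectation (\<lambda>\<omega>. indicator (A k) \<omega> * (Y (Suc k) \<omega> - Y k \<omega>)) \<le> tk (Suc k) - tk k" for k
  proof -
    have "expectation (\<lambda>\<omega>. indicator (A k) \<omega> * Y (Suc k) \<omega>)
        = (wk (Suc k))\<^sup>2 * expectation (\<lambda>\<omega>. indicator (A k) \<omega> * (Z (tk (Suc k)) \<omega>)\<^sup>2)"
    proof -
      have "indicator (A k) \<omega> * Y (Suc k) \<omega> = (wk (Suc k))\<^sup>2 * (indicator (A k) \<omega> * (Z (tk (Suc k)) \<omega>)\<^sup>2)" for \<omega>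
        by (simp add: Y_def X_eq_wk_Z power_mult_distrib)
      then show ?thesis by (simp only: integral_mult_right_zero)
    qed
    also have "expectation (\<lambda>\<omega>. indicator (A k) \<omega> * (Z (tk (Suc k)) \<omega>)\<^sup>2)
        = expectation (\<lambda>\<omega>. indicator (A k) \<omega> * (\<integral>y. (sqrt \<rho> * Z (tk k) \<omega> + sqrt (1 - \<rho>) * y)\<^sup>2 \<partial>std_normal_distribution))"
      by (rule markov_grid[OF A, where a=1]) auto
    also have "\<dots> = expectation (\<lambda>\<omega>. indicator (A k) \<omega> * (\<rho> * (Z (tk k) \<omega>)\<^sup>2 + (1 - \<rho>)))"
      using \<rho> by (simp add: integral_std_normal_affine_square power_mult_distrib)
    also have "(wk (Suc k))\<^sup>2 * \<dots> = expectation (\<lambda>\<omega>. (wk (Suc k))\<^sup>2 * (indicator (A k) \<omega> * (\<rho> * (Z (tk k) \<omega>)\<^sup>2 + (1 - \<rho>))))"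
      by simp
    also have "\<dots> \<le> expectation (\<lambda>\<omega>. indicator (A k) \<omega> * Y k \<omega> + (tk (Suc k) - tk k))"
    proof (rule integral_mono)
      show "integrable M (\<lambda>\<omega>. (wk (Suc k))\<^sup>2 * (indicator (A k) \<omega> * (\<rho> * (Z (tk k) \<omega>)\<^sup>2 + (1 - \<rho>))))"
      proof (intro integrable_mult_right integrable_indicator_Z[where G="\<lambda>z. \<rho> * z\<^sup>2 + (1 - \<rho>)" and a=1] AM)
        fix z :: real
        have "\<rho> * z\<^sup>2 \<le> 1 * z\<^sup>2" using \<rho> by (intro mult_right_mono) auto
        then show "\<bar>\<rho> * z\<^sup>2 + (1 - \<rho>)\<bar> \<le> 1 * (1 + z\<^sup>2)" using \<rho> by simp
      qed simp
      show "integrable M (\<lambda>\<omega>. indicator (A k) \<omega> * Y k \<omega> + (tk (Suc k) - tk k))"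
        using iA by simp
      fix \<omega>
      have w: "(wk (Suc k))\<^sup>2 = \<rho> * (wk k)\<^sup>2" using \<rho> by (simp add: wk_Suc power_mult_distrib)
      have d: "tk (Suc k) - tk k = (1 - \<rho>) * (wk k)\<^sup>2"
        using one_minus_grid_Suc[of t \<rho> k] unfolding wk_square tk_def by (simp add: algebra_simps)
      have "\<rho> * \<rho> * ((wk k)\<^sup>2 * (Z (tk k) \<omega>)\<^sup>2) \<le> 1 * ((wk k)\<^sup>2 * (Z (tk k) \<omega>)\<^sup>2)"
        using \<rho> by (intro mult_right_mono mult_le_one) auto
      moreover have "\<rho> * ((1 - \<rho>) * (wk k)\<^sup>2) \<le> 1 * ((1 - \<rho>) * (wk k)\<^sup>2)"
        using \<rho> by (intro mult_right_mono) auto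
      moreover have "Y k \<omega> = (wk k)\<^sup>2 * (Z (tk k) \<omega>)\<^sup>2"
        by (simp add: Y_def X_eq_wk_Z power_mult_distrib)
      moreover have "0 \<le> tk (Suc k) - tk k" using tk_less_Suc[of k] by simp
      ultimately show "(wk (Suc k))\<^sup>2 * (indicator (A k) \<omega> * (\<rho> * (Z (tk k) \<omega>)\<^sup>2 + (1 - \<rho>)))
          \<le> indicator (A k) \<omega> * Y k \<omega> + (tk (Suc k) - tk k)"
        unfolding w d by (cases "\<omega> \<in> A k") (simp_all add: algebra_simps)
    qed
    also have "\<dots> = expectation (\<lambda>\<omega>. indicator (A k) \<omega> * Y k \<omega>) + (tk (Suc k) - tk k)"
      using iA prob_space by simp
    finally show ?thesis
      using iA by (simp add: right_diff_distrib)
  qed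
  have "expectation (\<lambda>\<omega>. Y (stop n \<tau> \<omega>) \<omega>)
      = expectation (\<lambda>\<omega>. Y 0 \<omega> + (\<Sum>k<n. indicator (A k) \<omega> * (Y (Suc k) \<omega> - Y k \<omega>)))"
    unfolding A_def by (intro Bochner_Integration.integral_cong refl stop_sum)
  also have "\<dots> = expectation (Y 0) + (\<Sum>k<n. expectation (\<lambda>\<omega>. indicator (A k) \<omega> * (Y (Suc k) \<omega> - Y k \<omega>)))"
  proof -
    have "integrable M (\<lambda>\<omega>. indicator (A k) \<omega> * (Y (Suc k) \<omega> - Y k \<omega>))" for k
      using integrable_mult_indicator[OF AM Bochner_Integration.integrable_diff[OF iY iY]] by simp
    then show ?thesis using iY
      by (simp only: Bochner_Integration.integral_add Bochner_Integration.integral_sum Bochner_Integration.integrable_sum)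
  qed
  also have "\<dots> \<le> expectation (Y 0) + (\<Sum>k<n. tk (Suc k) - tk k)"
    by (intro add_left_mono sum_mono step)
  also have "(\<Sum>k<n. tk (Suc k) - tk k) = tk n - tk 0" by (rule sum_lessThan_telescope)
  also have "expectation (Y 0) = x\<^sup>2"
    using expectation_X_square[of t] t1 by (simp add: Y_def[abs_def] tk_def bb_mean_def bb_cov_def)
  also have "x\<^sup>2 + (tk n - tk 0) \<le> x\<^sup>2 + (1 - t)" using tk_in[of n] by (simp add: tk_def)
  finally show "expectation (\<lambda>\<omega>. (X (tk (stop n \<tau> \<omega>)) \<omega>)\<^sup>2) \<le> x\<^sup>2 + (1 - t)"
    by (simp add: Y_def)
qed

section \<open>Pathwise bounds on the accumulated defect\<close>

lemma defect_bounds: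
  assumes K: "0 \<le> K" and \<omega>: "\<omega> \<in> space M"
    and z: "\<And>k. k < n \<Longrightarrow> \<sigma> \<omega> \<le> tk k \<Longrightarrow> tk k < \<tau> \<omega> \<Longrightarrow>
       0 \<le> G (Z (tk k) \<omega>) - ou (1 - \<rho>) G (Z (tk k) \<omega>) \<and>
       G (Z (tk k) \<omega>) - ou (1 - \<rho>) G (Z (tk k) \<omega>) \<le> K * (1 - \<rho>)"
  shows "0 \<le> defect G n \<sigma> \<tau> \<omega>" "defect G n \<sigma> \<tau> \<omega> \<le> 2 * K * sqrt (1 - t)"
proof -
  show "0 \<le> defect G n \<sigma> \<tau> \<omega>"
    unfolding defect_def by (intro sum_nonneg) (use z wk_pos less_imp_le in \<open>auto simp: indicator_def intro!: mult_nonneg_nonneg\<close>)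
  have "defect G n \<sigma> \<tau> \<omega> \<le> (\<Sum>k<n. 2 * K * (wk k - wk (Suc k)))"
    unfolding defect_def
  proof (rule sum_mono)
    fix k assume k: "k \<in> {..<n}"
    have K1: "0 \<le> 2 * K * (wk k - wk (Suc k))" using K wk_Suc_le[of k] by simp
    show "indicator {\<omega> \<in> space M. \<sigma> \<omega> \<le> tk k \<and> tk k < \<tau> \<omega>} \<omega> * (wk k * (G (Z (tk k) \<omega>) - ou (1 - \<rho>) G (Z (tk k) \<omega>)))
        \<le> 2 * K * (wk k - wk (Suc k))"
    proof (cases "\<sigma> \<omega> \<le> tk k \<and> tk k < \<tau> \<omega>")
      case True
      then have "wk k * (G (Z (tk k) \<omega>) - ou (1 - \<rho>) G (Z (tk k) \<omega>)) \<le> wk k * (K * (1 - \<rho>))"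
        using z[of k] k wk_pos[of k] by (intro mult_left_mono) auto
      also have "\<dots> \<le> K * (2 * (wk k - wk (Suc k)))"
        using mult_left_mono[OF wk_eps_le[of k] K] by (simp add: mult_ac)
      finally show ?thesis using True \<omega> by (simp add: mult_ac)
    qed (use K1 in simp)
  qed
  also have "\<dots> = 2 * K * (wk 0 - wk n)"
    by (simp only: sum_distrib_left[symmetric] sum_lessThan_telescope')
  also have "\<dots> \<le> 2 * K * sqrt (1 - t)"
    using K wk_pos[of n] by (intro mult_left_mono) (auto simp: wk_def tk_def)
  finally show "defect G n \<sigma> \<tau> \<omega> \<le> 2 * K * sqrt (1 - t)" .
qed

text \<open>Up to \<open>s0\<close> the quadratic one-step bound is used and the sum is of order
  \<open>1 - \<rho>\<close>. Between \<open>s0\<close> and \<open>\<tau>\<close> only the linear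
  bound is available, but the weights telescope to the small difference of
  \<open>sqrt (1 - s0)\<close> and \<open>sqrt (1 - \<tau> \<omega>)\<close>, up to one overshooting
  step.\<close>

lemma defect_split_bound:
  assumes K: "0 \<le> K" and m: "0 < m" and \<omega>: "\<omega> \<in> space M" and s0: "s0 \<le> \<tau> \<omega>" "\<tau> \<omega> < 1"
    and near: "\<And>k. k < n \<Longrightarrow> \<sigma> \<omega> \<le> tk k \<Longrightarrow> tk k < \<tau> \<omega> \<Longrightarrow>
       G (Z (tk k) \<omega>) - ou (1 - \<rho>) G (Z (tk k) \<omega>) \<le> K * (1 - \<rho>)"
    and far: "\<And>k. k < n \<Longrightarrow> \<sigma> \<omega> \<le> tk k \<Longrightarrow> tk k \<le> s0 \<Longrightarrow>
       G (Z (tk k) \<omega>) - ou (1 - \<rho>) G (Z (tk k) \<omega>) \<le> K * (1 - \<rho>)\<^sup>2 / m\<^sup>2"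
  shows "defect G n \<sigma> \<tau> \<omega> \<le> 2 * K * (1 - \<rho>) / m\<^sup>2 * sqrt (1 - t)
    + 2 * K * (sqrt (1 - s0) - sqrt \<rho> * sqrt (1 - \<tau> \<omega>))"
proof -
  define u0 where "u0 = sqrt (1 - s0)"
  define u1 where "u1 = sqrt \<rho> * sqrt (1 - \<tau> \<omega>)"
  have u10: "u1 \<le> u0"
  proof -
    have "u1 \<le> 1 * sqrt (1 - \<tau> \<omega>)" unfolding u1_def using \<rho> s0 by (intro mult_right_mono) auto
    also have "\<dots> \<le> u0" unfolding u0_def using s0 by simp
    finally show ?thesis .
  qed
  \<comment> \<open>Clamping to \<open>[u1, u0]\<close> turns the sum over
    \<open>s0 < tk k < \<tau>\<close> into a telescope over all \<open>k\<close>. The factor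
    \<open>sqrt \<rho>\<close> in \<open>u1\<close> allows for the successor of the last grid point
    before \<open>\<tau>\<close>, which may lie beyond \<open>\<tau>\<close>.\<close>
  define cl where "cl y = min (max y u1) u0" for y
  have clmono: "cl y \<le> cl y'" if "y \<le> y'" for y y' using that by (auto simp: cl_def)
  define a where "a = 2 * K * (1 - \<rho>) / m\<^sup>2"
  have a: "0 \<le> a" using K \<rho> by (simp add: a_def)
  have "defect G n \<sigma> \<tau> \<omega> \<le> (\<Sum>k<n. a * (wk k - wk (Suc k)) + 2 * K * (cl (wk k) - cl (wk (Suc k))))"
    unfolding defect_def
  proof (rule sum_mono)
    fix k assume k: "k \<in> {..<n}"
    have K1: "0 \<le> a * (wk k - wk (Suc k))" using a wk_Suc_le[of k] by simp
    have K2: "0 \<le> 2 * K * (cl (wk k) - cl (wk (Suc k)))" using K clmono[OF wk_Suc_le[of k]] by simp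
    consider "\<not> (\<sigma> \<omega> \<le> tk k \<and> tk k < \<tau> \<omega>)" | "\<sigma> \<omega> \<le> tk k" "tk k < \<tau> \<omega>" "tk k \<le> s0" | "\<sigma> \<omega> \<le> tk k" "tk k < \<tau> \<omega>" "s0 < tk k"
      by linarith
    then show "indicator {\<omega> \<in> space M. \<sigma> \<omega> \<le> tk k \<and> tk k < \<tau> \<omega>} \<omega> * (wk k * (G (Z (tk k) \<omega>) - ou (1 - \<rho>) G (Z (tk k) \<omega>)))
        \<le> a * (wk k - wk (Suc k)) + 2 * K * (cl (wk k) - cl (wk (Suc k)))"
    proof cases
      case 1
      then show ?thesis using K1 K2 by auto
    next
      case 2
      then have "wk k * (G (Z (tk k) \<omega>) - ou (1 - \<rho>) G (Z (tk k) \<omega>)) \<le> wk k * (K * (1 - \<rho>)\<^sup>2 / m\<^sup>2)"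
        using far[of k] k wk_pos[of k] by (intro mult_left_mono) auto
      also have "\<dots> = (K * (1 - \<rho>) / m\<^sup>2) * (wk k * (1 - \<rho>))" by (simp add: power2_eq_square)
      also have "\<dots> \<le> (K * (1 - \<rho>) / m\<^sup>2) * (2 * (wk k - wk (Suc k)))"
        using K \<rho> by (intro mult_left_mono wk_eps_le) auto
      also have "\<dots> = a * (wk k - wk (Suc k))" by (simp add: a_def)
      finally show ?thesis using 2 \<omega> K2 by simp
    next
      case 3
      have "wk k * (G (Z (tk k) \<omega>) - ou (1 - \<rho>) G (Z (tk k) \<omega>)) \<le> wk k * (K * (1 - \<rho>))"
        using near[of k] 3 k wk_pos[of k] by (intro mult_left_mono) auto
      also have "\<dots> \<le> K * (2 * (wk k - wk (Suc k)))"
        using mult_left_mono[OF wk_eps_le[of k] K] by (simp add: mult_ac)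
      finally have "wk k * (G (Z (tk k) \<omega>) - ou (1 - \<rho>) G (Z (tk k) \<omega>)) \<le> 2 * K * (wk k - wk (Suc k))"
        by (simp only: mult_ac)
      moreover have "cl (wk k) = wk k" "cl (wk (Suc k)) = wk (Suc k)"
      proof -
        have "wk k \<le> u0" using 3 by (simp add: wk_def u0_def)
        moreover have "u1 \<le> wk (Suc k)" unfolding u1_def wk_Suc using 3 \<rho> by (intro mult_left_mono) (auto simp: wk_def)
        ultimately show "cl (wk k) = wk k" "cl (wk (Suc k)) = wk (Suc k)" using wk_Suc_le[of k] by (auto simp: cl_def)
      qed
      ultimately show ?thesis using 3 \<omega> K1 by simp
    qed
  qed
  also have "\<dots> = a * (wk 0 - wk n) + 2 * K * (cl (wk 0) - cl (wk n))"
    by (simp only: sum.distrib sum_distrib_left[symmetric] sum_lessThan_telescope'[of wk] sum_lessThan_telescope'[of "\<lambda>k. cl (wk k)"])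
  also have "\<dots> \<le> a * sqrt (1 - t) + 2 * K * (u0 - u1)"
  proof (intro add_mono mult_left_mono)
    show "wk 0 - wk n \<le> sqrt (1 - t)" using wk_pos[of n] by (simp add: wk_def tk_def)
    show "cl (wk 0) - cl (wk n) \<le> u0 - u1" using u10 by (auto simp: cl_def)
  qed (use a K in auto)
  finally show ?thesis by (simp add: a_def u0_def u1_def)
qed

end

section \<open>Passage to continuous time\<close>

text \<open>The offset \<open>2\<close> keeps the ratio inside \<open>(0, 1)\<close> for every
  \<open>n\<close>. Quadratically many steps of relative size \<open>1 / (n + 2)\<close> give
  \<open>rho n ^ steps n \<le> exp (- (n + 2))\<close>, so the grids eventually pass any time before
  \<open>1\<close>.\<close>

definition rho :: "nat \<Rightarrow> real" where "rho n = 1 - 1 / (real n + 2)"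

definition steps :: "nat \<Rightarrow> nat" where "steps n = (n + 2)\<^sup>2"

lemma rho: "0 < rho n" "rho n < 1"
  by (auto simp: rho_def field_simps)

lemma one_minus_rho: "1 - rho n = 1 / (real n + 2)"
  by (simp add: rho_def)

lemma inverse_add_2_tendsto: "(\<lambda>n. 1 / (real n + 2)) \<longlonglongrightarrow> 0"
proof -
  have "(\<lambda>n. inverse (real (n + 2))) \<longlonglongrightarrow> 0"
    by (rule LIMSEQ_ignore_initial_segment[OF lim_inverse_n])
  then show ?thesis by (simp add: inverse_eq_divide add.commute)
qed

lemma rho_tendsto: "rho \<longlonglongrightarrow> 1"
  using tendsto_diff[OF tendsto_const inverse_add_2_tendsto, of 1] by (simp add: rho_def[abs_def])

lemma eventually_rho: "0 < e0 \<Longrightarrow> \<exists>n0. \<forall>n\<ge>n0. 1 - rho n \<le> e0"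
  using order_tendstoD(2)[OF inverse_add_2_tendsto, of e0]
  unfolding one_minus_rho eventually_sequentially by (meson less_imp_le)

lemma rho_steps_tendsto: "(\<lambda>n. rho n ^ steps n) \<longlonglongrightarrow> 0"
proof (rule tendsto_sandwich[OF _ _ tendsto_const])
  show "\<forall>\<^sub>F n in sequentially. 0 \<le> rho n ^ steps n"
    using rho by (intro always_eventually allI zero_le_power) (auto intro: less_imp_le)
  show "\<forall>\<^sub>F n in sequentially. rho n ^ steps n \<le> 1 / (real n + 2)"
  proof (intro always_eventually allI)
    fix n
    have "rho n \<le> exp (- (1 / (real n + 2)))"
      using exp_ge_add_one_self[of "- (1 / (real n + 2))"] by (simp add: rho_def)
    then have "rho n ^ steps n \<le> exp (- (1 / (real n + 2))) ^ steps n"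
      using rho(1)[of n] by (intro power_mono) auto
    also have "\<dots> = exp (real (steps n) * - (1 / (real n + 2)))"
      by (rule exp_of_nat_mult[symmetric])
    also have "real (steps n) * - (1 / (real n + 2)) = - (real n + 2)"
      by (simp add: steps_def power2_eq_square field_simps)
    also have "exp (- (real n + 2)) \<le> 1 / (real n + 2)"
    proof -
      have "real n + 2 \<le> exp (real n + 2)" using exp_ge_add_one_self[of "real n + 2"] by linarith
      then have "1 / exp (real n + 2) \<le> 1 / (real n + 2)" by (intro frac_le) auto
      then show ?thesis by (simp only: exp_minus inverse_eq_divide)
    qed
    finally show "rho n ^ steps n \<le> 1 / (real n + 2)" .
  qed
qed (rule inverse_add_2_tendsto)

lemma grid_index_tendsto:
  assumes "s < 1" "s \<le> r" "r < 1"
  shows "(\<lambda>n. grid s (rho n) (index (grid s (rho n)) (steps n) r)) \<longlonglongrightarrow> r"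
proof -
  have "(\<lambda>n. (1 - s) * rho n ^ steps n) \<longlonglongrightarrow> (1 - s) * 0"
    by (intro tendsto_mult tendsto_const rho_steps_tendsto)
  then have "\<forall>\<^sub>F n in sequentially. (1 - s) * rho n ^ steps n < 1 - r"
    by (rule order_tendstoD(2)) (use assms in simp)
  then have ev: "\<forall>\<^sub>F n in sequentially. r \<le> grid s (rho n) (steps n)"
    by eventually_elim (simp add: grid_def)
  have lim: "(\<lambda>n. 1 - rho n * (1 - r)) \<longlonglongrightarrow> 1 - 1 * (1 - r)"
    by (intro tendsto_intros rho_tendsto)
  show ?thesis
  proof (rule tendsto_sandwich[OF _ _ tendsto_const])
    show "\<forall>\<^sub>F n in sequentially. r \<le> grid s (rho n) (index (grid s (rho n)) (steps n) r)"
      using ev by eventually_elim (rule grid_index_bounds(1)[OF assms(1) rho assms(2)])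
    show "\<forall>\<^sub>F n in sequentially. grid s (rho n) (index (grid s (rho n)) (steps n) r) \<le> 1 - rho n * (1 - r)"
      using ev by eventually_elim (rule grid_index_bounds(2)[OF assms(1) rho assms(2)])
    show "(\<lambda>n. 1 - rho n * (1 - r)) \<longlonglongrightarrow> r" using lim by simp
  qed
qed

context bridge
begin

definition val :: "(real \<Rightarrow> real) \<Rightarrow> ('a \<Rightarrow> real) \<Rightarrow> 'a \<Rightarrow> real" where
  "val G \<tau> \<omega> = (if t \<le> \<tau> \<omega> \<and> \<tau> \<omega> < 1 then sqrt (1 - \<tau> \<omega>) * G (Z (\<tau> \<omega>) \<omega>) else 0)"

lemma Z_continuous: "\<omega> \<in> space M \<Longrightarrow> continuous_on {t..<1} (\<lambda>s. Z s \<omega>)"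
  unfolding Z_def by (intro continuous_intros X_continuous) auto

lemma bridge_grid_rho: "bridge_grid M t x X (rho n)"
  by (intro bridge_grid.intro bridge_grid_axioms.intro rho bridge_axioms)

text \<open>Path continuity gives pointwise convergence of the rounded values. Linear growth of
  \<open>G\<close> bounds their squares by a constant plus \<open>2 * X\<^sup>2\<close> at the
  rounded time, whose mean is bounded independently of \<open>n\<close>; convergence of the means
  follows. Measurability of the limit is obtained from the approximations.\<close>

lemma
  fixes G :: "real \<Rightarrow> real"
  assumes \<tau>: "stopping_time F \<tau>" and AE\<tau>: "AE \<omega> in M. t \<le> \<tau> \<omega> \<and> \<tau> \<omega> < 1"
    and cont: "continuous_on UNIV G" and lin: "\<And>z. \<bar>G z\<bar> \<le> a + \<bar>z\<bar>" and a: "0 \<le> a"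
  shows integrable_val: "integrable M (val G \<tau>)"
    and expectation_stop_tendsto:
      "(\<lambda>n. expectation (\<lambda>\<omega>. bridge_grid.Yk t X (rho n) G (bridge_grid.stop t (rho n) (steps n) \<tau> \<omega>) \<omega>)) \<longlonglongrightarrow> expectation (val G \<tau>)"
proof -
  interpret B: bridge_grid M t x X "rho n" for n by (rule bridge_grid_rho)
  have G: "G \<in> borel_measurable borel" by (rule borel_measurable_continuous_onI[OF cont])
  have quad: "\<bar>G z\<bar> \<le> (a + 1) * (1 + z\<^sup>2)" for z by (rule linear_imp_quadratic[OF lin a])
  define Y where "Y n \<omega> = B.Yk n G (B.stop n (steps n) \<tau> \<omega>) \<omega>" for n \<omega>
  have iY: "integrable M (Y n)" for n
    unfolding Y_def[abs_def] by (rule B.integrable_stop[where Y="B.Yk n G", OF \<tau> B.integrable_Yk[OF G quad]])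
  have Ym [measurable]: "Y n \<in> borel_measurable M" for n by (rule borel_measurable_integrable[OF iY])
  have [measurable]: "\<tau> \<in> borel_measurable M" by (rule stopping_time_measurable[OF \<tau>])
  have conv: "(\<lambda>n. Y n \<omega>) \<longlonglongrightarrow> val G \<tau> \<omega>" if \<omega>: "\<omega> \<in> space M" "t \<le> \<tau> \<omega>" "\<tau> \<omega> < 1" for \<omega>
  proof -
    define s where "s n = B.tk n (B.stop n (steps n) \<tau> \<omega>)" for n
    have s: "s \<longlonglongrightarrow> \<tau> \<omega>"
      using grid_index_tendsto[OF t1 \<omega>(2,3)]
      by (simp add: s_def[abs_def] B.stop_def B.tk_def[abs_def])
    have "continuous_on {t..<1} (\<lambda>s. sqrt (1 - s) * G (Z s \<omega>))"
      by (intro continuous_intros continuous_on_compose2[OF cont Z_continuous[OF \<omega>(1)]]) auto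
    then have "(\<lambda>n. sqrt (1 - s n) * G (Z (s n) \<omega>)) \<longlonglongrightarrow> sqrt (1 - \<tau> \<omega>) * G (Z (\<tau> \<omega>) \<omega>)"
      by (rule continuous_on_tendsto_compose[OF _ s]) (use \<omega> B.tk_in in \<open>auto simp: s_def\<close>)
    then show ?thesis using \<omega> by (simp add: val_def Y_def B.Yk_def B.wk_def s_def)
  qed
  have meas [measurable]: "val G \<tau> \<in> borel_measurable M"
  proof (rule borel_measurable_LIMSEQ_real)
    show "(\<lambda>\<omega>. if t \<le> \<tau> \<omega> \<and> \<tau> \<omega> < 1 then Y n \<omega> else 0) \<in> borel_measurable M" for n by measurable
    show "(\<lambda>n. if t \<le> \<tau> \<omega> \<and> \<tau> \<omega> < 1 then Y n \<omega> else 0) \<longlonglongrightarrow> val G \<tau> \<omega>" if "\<omega> \<in> space M" for \<omega>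
      using conv[OF that] by (cases "t \<le> \<tau> \<omega> \<and> \<tau> \<omega> < 1") (auto simp: val_def)
  qed
  define C where "C = 2 * a\<^sup>2 * (1 - t) + 2 * (x\<^sup>2 + (1 - t))"
  have sq: "(Y n \<omega>)\<^sup>2 \<le> 2 * a\<^sup>2 * (1 - t) + 2 * (X (B.tk n (B.stop n (steps n) \<tau> \<omega>)) \<omega>)\<^sup>2" for n \<omega>
  proof -
    define k where "k = B.stop n (steps n) \<tau> \<omega>"
    define z where "z = Z (B.tk n k) \<omega>"
    have w: "0 < B.wk n k" "(B.wk n k)\<^sup>2 \<le> 1 - t"
      using B.wk_pos B.wk_square[of n k] B.tk_in[of n k] by auto
    have "(G z)\<^sup>2 \<le> (a + \<bar>z\<bar>)\<^sup>2" using lin[of z] a by (intro power2_le_iff_abs_le[THEN iffD2]) auto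
    also have "\<dots> \<le> 2 * a\<^sup>2 + 2 * z\<^sup>2"
    proof -
      have "0 \<le> (a - \<bar>z\<bar>)\<^sup>2" by simp
      then show ?thesis by (simp add: power2_eq_square algebra_simps)
    qed
    finally have "(B.wk n k)\<^sup>2 * (G z)\<^sup>2 \<le> (B.wk n k)\<^sup>2 * (2 * a\<^sup>2 + 2 * z\<^sup>2)"
      by (intro mult_left_mono) auto
    also have "\<dots> = 2 * a\<^sup>2 * (B.wk n k)\<^sup>2 + 2 * (B.wk n k * z)\<^sup>2"
      by (simp add: power_mult_distrib algebra_simps)
    also have "\<dots> \<le> 2 * a\<^sup>2 * (1 - t) + 2 * (B.wk n k * z)\<^sup>2"
      using w by (intro add_right_mono mult_left_mono) auto
    finally show ?thesis
      by (simp add: Y_def B.Yk_def k_def z_def B.X_eq_wk_Z power_mult_distrib)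
  qed
  have iX: "integrable M (\<lambda>\<omega>. 2 * a\<^sup>2 * (1 - t) + 2 * (X (B.tk n (B.stop n (steps n) \<tau> \<omega>)) \<omega>)\<^sup>2)" for n
    using B.integrable_X_stop_square[OF \<tau>] by simp
  have iY2: "integrable M (\<lambda>\<omega>. (Y n \<omega>)\<^sup>2)" for n
    by (rule Bochner_Integration.integrable_bound[OF iX[of n]]) (use sq[of n] in \<open>auto intro!: always_eventually order_trans[OF _ abs_ge_self]\<close>)
  have EY2: "expectation (\<lambda>\<omega>. (Y n \<omega>)\<^sup>2) \<le> C" for n
  proof -
    have "expectation (\<lambda>\<omega>. (Y n \<omega>)\<^sup>2) \<le> expectation (\<lambda>\<omega>. 2 * a\<^sup>2 * (1 - t) + 2 * (X (B.tk n (B.stop n (steps n) \<tau> \<omega>)) \<omega>)\<^sup>2)"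
      by (rule integral_mono[OF iY2 iX sq])
    also have "\<dots> = 2 * a\<^sup>2 * (1 - t) + 2 * expectation (\<lambda>\<omega>. (X (B.tk n (B.stop n (steps n) \<tau> \<omega>)) \<omega>)\<^sup>2)"
      using B.integrable_X_stop_square[OF \<tau>, of n "steps n"] prob_space by simp
    also have "\<dots> \<le> C" unfolding C_def using B.expectation_X_stop_square_le[OF \<tau>, of n "steps n"] by simp
    finally show ?thesis .
  qed
  have AEc: "AE \<omega> in M. (\<lambda>n. Y n \<omega>) \<longlonglongrightarrow> val G \<tau> \<omega>"
    using AE\<tau> by (rule AE_mp) (auto intro!: AE_I2 conv)
  show "integrable M (val G \<tau>)"
    by (rule integrable_of_L2_bounded[where Y=Y, OF Ym meas iY2 EY2 AEc])
  show "(\<lambda>n. expectation (\<lambda>\<omega>. B.Yk n G (B.stop n (steps n) \<tau> \<omega>) \<omega>)) \<longlonglongrightarrow> expectation (val G \<tau>)"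
    using expectation_tendsto_of_L2_bounded[where Y=Y, OF Ym meas iY2 EY2 AEc] by (simp add: Y_def[abs_def])
qed

section \<open>Optional stopping in continuous time\<close>

lemma AE_stopping_pair:
  assumes "AE \<omega> in M. t \<le> \<sigma> \<omega> \<and> \<sigma> \<omega> \<le> \<tau> \<omega> \<and> \<tau> \<omega> < 1"
  shows "AE \<omega> in M. t \<le> \<sigma> \<omega> \<and> \<sigma> \<omega> < 1" "AE \<omega> in M. t \<le> \<tau> \<omega> \<and> \<tau> \<omega> < 1" "AE \<omega> in M. \<sigma> \<omega> \<le> \<tau> \<omega>"
  by (rule eventually_mono[OF assms], auto)+

lemma expectation_defect_tendsto:
  fixes G :: "real \<Rightarrow> real"
  assumes \<sigma>: "stopping_time F \<sigma>" and \<tau>: "stopping_time F \<tau>"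
    and le: "AE \<omega> in M. t \<le> \<sigma> \<omega> \<and> \<sigma> \<omega> \<le> \<tau> \<omega> \<and> \<tau> \<omega> < 1"
    and cont: "continuous_on UNIV G" and lin: "\<And>z. \<bar>G z\<bar> \<le> a + \<bar>z\<bar>" and a: "0 \<le> a"
  shows "(\<lambda>n. expectation (bridge_grid.defect M t X (rho n) G (steps n) \<sigma> \<tau>))
    \<longlonglongrightarrow> expectation (val G \<sigma>) - expectation (val G \<tau>)"
proof -
  interpret B: bridge_grid M t x X "rho n" for n by (rule bridge_grid_rho)
  have G: "G \<in> borel_measurable borel" by (rule borel_measurable_continuous_onI[OF cont])
  have quad: "\<bar>G z\<bar> \<le> (a + 1) * (1 + z\<^sup>2)" for z by (rule linear_imp_quadratic[OF lin a])
  note AEs = AE_stopping_pair[OF le]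
  show ?thesis
    unfolding B.expectation_stop_diff[OF \<sigma> \<tau> AEs(3) G quad, symmetric]
    by (intro tendsto_diff expectation_stop_tendsto[OF \<sigma> AEs(1) cont lin a] expectation_stop_tendsto[OF \<tau> AEs(2) cont lin a])
qed

theorem superharmonic_stopping:
  fixes G :: "real \<Rightarrow> real"
  assumes \<sigma>: "stopping_time F \<sigma>" and \<tau>: "stopping_time F \<tau>"
    and le: "AE \<omega> in M. t \<le> \<sigma> \<omega> \<and> \<sigma> \<omega> \<le> \<tau> \<omega> \<and> \<tau> \<omega> < 1"
    and cont: "continuous_on UNIV G" and lin: "\<And>z. \<bar>G z\<bar> \<le> a + \<bar>z\<bar>" and a: "0 \<le> a"
    and super: "superharmonic G"
  shows "expectation (val G \<tau>) \<le> expectation (val G \<sigma>)"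
proof -
  interpret B: bridge_grid M t x X "rho n" for n by (rule bridge_grid_rho)
  obtain e0 where e0: "e0 > 0" "\<And>e z. 0 < e \<Longrightarrow> e \<le> e0 \<Longrightarrow> ou e G z \<le> G z"
    using super unfolding superharmonic_def by auto
  obtain n0 where n0: "\<And>n. n \<ge> n0 \<Longrightarrow> 1 - rho n \<le> e0" using eventually_rho[OF e0(1)] by auto
  have "0 \<le> expectation (B.defect n G (steps n) \<sigma> \<tau>)" if "n \<ge> n0" for n
  proof (rule Bochner_Integration.integral_nonneg)
    fix \<omega>
    have "0 \<le> B.wk n k * (G (Z (B.tk n k) \<omega>) - ou (1 - rho n) G (Z (B.tk n k) \<omega>))" for k
      using e0(2)[of "1 - rho n"] n0[OF that] rho(2)[of n] B.wk_pos[of n k] by simp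
    then show "0 \<le> B.defect n G (steps n) \<sigma> \<tau> \<omega>"
      unfolding B.defect_def by (intro sum_nonneg mult_nonneg_nonneg[of "indicator _ _"]) auto
  qed
  then have "0 \<le> expectation (val G \<sigma>) - expectation (val G \<tau>)"
    by (intro LIMSEQ_le_const[OF expectation_defect_tendsto[OF \<sigma> \<tau> le cont lin a]]) auto
  then show ?thesis by simp
qed

text \<open>On \<open>[\<sigma>, \<tau>)\<close> the one-step defect is \<open>O(\<epsilon>)\<close>, and \<open>O(\<epsilon>\<^sup>2)\<close> away from the free boundary, which
  the path only meets at time \<open>\<tau>\<close>; hence the accumulated defect vanishes in the limit.\<close>
theorem harmonic_stopping:
  fixes G d :: "real \<Rightarrow> real"
  assumes \<sigma>: "stopping_time F \<sigma>" and \<tau>: "stopping_time F \<tau>"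
    and le: "AE \<omega> in M. t \<le> \<sigma> \<omega> \<and> \<sigma> \<omega> \<le> \<tau> \<omega> \<and> \<tau> \<omega> < 1"
    and cont: "continuous_on UNIV G" and lin: "\<And>z. \<bar>G z\<bar> \<le> a + \<bar>z\<bar>" and a: "0 \<le> a"
    and harm: "harmonic_where d G" and d: "continuous_on UNIV d"
    and pos: "\<And>\<omega> s. \<omega> \<in> space M \<Longrightarrow> t \<le> \<sigma> \<omega> \<Longrightarrow> \<sigma> \<omega> \<le> s \<Longrightarrow> s < \<tau> \<omega> \<Longrightarrow> \<tau> \<omega> < 1 \<Longrightarrow> 0 < d (Z s \<omega>)"
  shows "expectation (val G \<tau>) = expectation (val G \<sigma>)"
proof -
  interpret B: bridge_grid M t x X "rho n" for n by (rule bridge_grid_rho)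
  obtain e0 K where e0: "e0 > 0" and K: "K \<ge> 0" and harm: "\<And>e z. 0 < e \<Longrightarrow> e \<le> e0 \<Longrightarrow> 0 < d z \<Longrightarrow>
     0 \<le> G z - ou e G z \<and> G z - ou e G z \<le> K * e \<and> G z - ou e G z \<le> K * e\<^sup>2 / (d z)\<^sup>2"
    using harm unfolding harmonic_where_def by blast
  obtain n0 where n0: "\<And>n. n \<ge> n0 \<Longrightarrow> 1 - rho n \<le> e0" using eventually_rho[OF e0(1)] by auto
  have G: "G \<in> borel_measurable borel" by (rule borel_measurable_continuous_onI[OF cont])
  have quad: "\<bar>G z\<bar> \<le> (a + 1) * (1 + z\<^sup>2)" for z by (rule linear_imp_quadratic[OF lin a])
  note AEs = AE_stopping_pair[OF le]
  \<comment> \<open>The shift by \<open>n0\<close> makes every step short enough for the one-step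
    bounds, so that one dominating constant serves all \<open>n\<close>.\<close>
  define D where "D n \<omega> = B.defect (n + n0) G (steps (n + n0)) \<sigma> \<tau> \<omega>" for n \<omega>
  have e: "0 < 1 - rho (n + n0)" "1 - rho (n + n0) \<le> e0" for n
    using n0[of "n + n0"] rho(2)[of "n + n0"] by auto
  have "(\<lambda>n. expectation (D n)) \<longlonglongrightarrow> expectation (\<lambda>\<omega>. 0)"
  proof (rule integral_dominated_convergence[where w="\<lambda>_. 2 * K * sqrt (1 - t)"])
    show "D n \<in> borel_measurable M" for n
      unfolding D_def[abs_def] by (rule borel_measurable_integrable[OF B.integrable_defect[OF \<sigma> \<tau> AEs(3) G quad]])
    have bnd: "0 \<le> D n \<omega>" "D n \<omega> \<le> 2 * K * sqrt (1 - t)"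
      if \<omega>: "\<omega> \<in> space M" "t \<le> \<sigma> \<omega>" "\<tau> \<omega> < 1" for n \<omega>
      unfolding D_def
      by (rule B.defect_bounds[OF K \<omega>(1)]; use harm[OF e] pos \<omega> in blast)+
    show "AE \<omega> in M. norm (D n \<omega>) \<le> 2 * K * sqrt (1 - t)" for n
      using le by (rule AE_mp) (auto intro!: AE_I2 simp: bnd)
    show "AE \<omega> in M. (\<lambda>n. D n \<omega>) \<longlonglongrightarrow> 0"
      using le
    proof (rule AE_mp, intro AE_I2 impI)
      fix \<omega> assume "\<omega> \<in> space M" and "t \<le> \<sigma> \<omega> \<and> \<sigma> \<omega> \<le> \<tau> \<omega> \<and> \<tau> \<omega> < 1"
      then have \<omega>: "\<omega> \<in> space M" "t \<le> \<sigma> \<omega>" "\<sigma> \<omega> \<le> \<tau> \<omega>" "\<tau> \<omega> < 1" by auto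
      show "(\<lambda>n. D n \<omega>) \<longlonglongrightarrow> 0"
      proof (cases "\<sigma> \<omega> = \<tau> \<omega>")
        case True
        have "indicator {\<omega> \<in> space M. \<sigma> \<omega> \<le> q \<and> q < \<tau> \<omega>} \<omega> = (0::real)" for q
          using True by (auto simp: indicator_def)
        then have "D n \<omega> = 0" for n unfolding D_def B.defect_def by simp
        then show ?thesis by simp
      next
        case False
        then have st: "\<sigma> \<omega> < \<tau> \<omega>" using \<omega> by simp
        show ?thesis
        proof (rule order_tendstoI)
          fix y :: real assume "y < 0"
          then show "\<forall>\<^sub>F n in sequentially. y < D n \<omega>"
            using bnd(1)[OF \<omega>(1,2,4)] by (intro always_eventually allI) (auto intro: less_le_trans)
        next
          fix y :: real assume y: "0 < y"
          \<comment> \<open>The stretch between \<open>s0\<close> and \<open>\<tau>\<close> will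
            contribute at most \<open>2 * K * \<eta> < y\<close> in the limit; \<open>K + 1\<close>
            also covers \<open>K = 0\<close>.\<close>
          define \<eta> where "\<eta> = y / (2 * (K + 1))"
          have \<eta>: "0 < \<eta>" using y K by (simp add: \<eta>_def)
          have "((\<lambda>s. sqrt (1 - s)) \<longlongrightarrow> sqrt (1 - \<tau> \<omega>)) (at_left (\<tau> \<omega>))"
            by (intro tendsto_intros)
          then have "\<forall>\<^sub>F s in at_left (\<tau> \<omega>). sqrt (1 - s) < sqrt (1 - \<tau> \<omega>) + \<eta>"
            by (rule order_tendstoD(2)) (use \<eta> in simp)
          moreover have "\<forall>\<^sub>F s in at_left (\<tau> \<omega>). s \<in> {\<sigma> \<omega><..<\<tau> \<omega>}"
            by (rule eventually_at_left_real[OF st])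
          ultimately have "\<forall>\<^sub>F s in at_left (\<tau> \<omega>). sqrt (1 - s) < sqrt (1 - \<tau> \<omega>) + \<eta> \<and> s \<in> {\<sigma> \<omega><..<\<tau> \<omega>}"
            by (rule eventually_conj)
          then obtain s0 where s0: "sqrt (1 - s0) < sqrt (1 - \<tau> \<omega>) + \<eta>" "\<sigma> \<omega> < s0" "s0 < \<tau> \<omega>"
            using eventually_happens'[OF trivial_limit_at_left_real] by fastforce
          \<comment> \<open>Compactness of \<open>[\<sigma>, s0]\<close> gives a positive minimum
            \<open>m\<close> of \<open>d\<close> along the path. No such bound is available up to
            \<open>\<tau>\<close>, where \<open>d\<close> may vanish, so the split point
            \<open>s0\<close> is fixed before the limit in \<open>n\<close> is taken.\<close>
          have "continuous_on {\<sigma> \<omega>..s0} (\<lambda>s. d (Z s \<omega>))"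
            by (rule continuous_on_compose2[OF d continuous_on_subset[OF Z_continuous[OF \<omega>(1)]]])
               (use \<omega> s0 in auto)
          then obtain sm where sm: "sm \<in> {\<sigma> \<omega>..s0}" "\<And>s. s \<in> {\<sigma> \<omega>..s0} \<Longrightarrow> d (Z sm \<omega>) \<le> d (Z s \<omega>)"
            using continuous_attains_inf[of "{\<sigma> \<omega>..s0}" "\<lambda>s. d (Z s \<omega>)"] s0 by auto
          define m where "m = d (Z sm \<omega>)"
          have m: "0 < m" unfolding m_def using pos[OF \<omega>(1,2), of sm] sm(1) s0 \<omega> by simp
          have b: "D n \<omega> \<le> 2 * K * (1 - rho (n + n0)) / m\<^sup>2 * sqrt (1 - t)
              + 2 * K * (sqrt (1 - s0) - sqrt (rho (n + n0)) * sqrt (1 - \<tau> \<omega>))" for n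
            unfolding D_def
          proof (rule B.defect_split_bound[where K=K and m=m])
            show "0 \<le> K" "0 < m" "\<omega> \<in> space M" "s0 \<le> \<tau> \<omega>" "\<tau> \<omega> < 1" using s0 K m \<omega> by auto
            fix k assume k: "\<sigma> \<omega> \<le> B.tk (n + n0) k"
            define z where "z = Z (B.tk (n + n0) k) \<omega>"
            show "G (Z (B.tk (n + n0) k) \<omega>) - ou (1 - rho (n + n0)) G (Z (B.tk (n + n0) k) \<omega>) \<le> K * (1 - rho (n + n0))"
              if "B.tk (n + n0) k < \<tau> \<omega>"
              using harm[OF e pos[OF \<omega>(1,2) k that \<omega>(4)]] by simp
            assume k0: "B.tk (n + n0) k \<le> s0"
            have mz: "m \<le> d z" unfolding m_def z_def using sm(2) k k0 by simp
            have "G z - ou (1 - rho (n + n0)) G z \<le> K * (1 - rho (n + n0))\<^sup>2 / (d z)\<^sup>2"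
              using harm[OF e, of z n] mz m by simp
            also have "\<dots> \<le> K * (1 - rho (n + n0))\<^sup>2 / m\<^sup>2"
              using K m mz by (intro divide_left_mono power_mono mult_pos_pos zero_less_power) auto
            finally show "G (Z (B.tk (n + n0) k) \<omega>) - ou (1 - rho (n + n0)) G (Z (B.tk (n + n0) k) \<omega>)
                \<le> K * (1 - rho (n + n0))\<^sup>2 / m\<^sup>2" by (simp add: z_def)
          qed
          have r: "(\<lambda>n. rho (n + n0)) \<longlonglongrightarrow> 1" by (rule LIMSEQ_ignore_initial_segment[OF rho_tendsto])
          have "(\<lambda>n. 2 * K * (1 - rho (n + n0)) / m\<^sup>2 * sqrt (1 - t)
              + 2 * K * (sqrt (1 - s0) - sqrt (rho (n + n0)) * sqrt (1 - \<tau> \<omega>)))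
            \<longlonglongrightarrow> 2 * K * (1 - 1) / m\<^sup>2 * sqrt (1 - t) + 2 * K * (sqrt (1 - s0) - sqrt 1 * sqrt (1 - \<tau> \<omega>))"
            using m by (intro tendsto_intros r) auto
          moreover have "2 * K * (1 - 1) / m\<^sup>2 * sqrt (1 - t) + 2 * K * (sqrt (1 - s0) - sqrt 1 * sqrt (1 - \<tau> \<omega>)) < y"
          proof -
            have "2 * K * (sqrt (1 - s0) - sqrt (1 - \<tau> \<omega>)) \<le> 2 * K * \<eta>"
              using s0 K by (intro mult_left_mono) auto
            also have "\<dots> < 2 * (K + 1) * \<eta>" using \<eta> by simp
            also have "\<dots> = y" using K by (simp add: \<eta>_def)
            finally show ?thesis by simp
          qed
          ultimately have "\<forall>\<^sub>F n in sequentially. 2 * K * (1 - rho (n + n0)) / m\<^sup>2 * sqrt (1 - t)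
              + 2 * K * (sqrt (1 - s0) - sqrt (rho (n + n0)) * sqrt (1 - \<tau> \<omega>)) < y"
            by (rule order_tendstoD(2))
          then show "\<forall>\<^sub>F n in sequentially. D n \<omega> < y"
            by eventually_elim (rule le_less_trans[OF b])
        qed
      qed
    qed
  qed auto
  moreover have "(\<lambda>n. expectation (D n)) \<longlonglongrightarrow> expectation (val G \<sigma>) - expectation (val G \<tau>)"
    using LIMSEQ_ignore_initial_segment[OF expectation_defect_tendsto[OF \<sigma> \<tau> le cont lin a], of n0]
    by (simp add: D_def[abs_def])
  ultimately have "expectation (\<lambda>\<omega>. 0) = expectation (val G \<sigma>) - expectation (val G \<tau>)"
    by (rule LIMSEQ_unique)
  then show ?thesis by simp
qed

end

section \<open>The hitting times\<close>

text \<open>Strictness comes from positivity of the density; it makes the failure probability in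
  \<open>hitting_prob_bound\<close> a genuine contraction factor.\<close>

lemma Phi_less_1: "Phi c < 1"
proof -
  have "\<exists>y>- c - 1. y < - c \<and> Phi (- c) - Phi (- c - 1) = (- c - (- c - 1)) * std_normal_density y"
    by (rule MVT2) (auto intro: Phi_has_real_derivative)
  then obtain y where "Phi (- c) - Phi (- c - 1) = std_normal_density y" by auto
  then have "0 < Phi (- c)" using Phi_nonneg[of "- c - 1"] std_normal_density_pos[of y] by linarith
  then show ?thesis by (simp add: Phi_uminus)
qed

lemma integral_std_normal_indicator_le:
  assumes "sg = 1 \<or> sg = - 1"
  shows "(\<integral>y. indicator {y. sg * y \<le> c} y \<partial>std_normal_distribution) = Phi c"
proof -
  have 1: "(\<integral>y. indicator {..c} y \<partial>std_normal_distribution) = Phi c"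
    by (subst integral_std_normal) (auto simp: Phi_def set_lebesgue_integral_def mult.commute)
  have "(\<integral>y. indicator {..c} (- y) \<partial>std_normal_distribution) = (\<integral>y. indicator {..c} y \<partial>std_normal_distribution :: real)"
    by (rule integral_std_normal_uminus) simp
  then have 2: "(\<integral>y. indicator {y. - y \<le> c} y \<partial>std_normal_distribution) = Phi c"
    using 1 by (simp add: indicator_def)
  have 3: "{y. 1 * y \<le> c} = {..c}" by auto
  show ?thesis using assms 1 2 unfolding 3 by (auto simp: atMost_def)
qed

section \<open>Pathwise properties of first hitting times\<close>

lemma hit_ge: "a \<le> 1 \<Longrightarrow> a \<le> hit a P"
  unfolding hit_def by (auto intro!: cInf_greatest)

lemma hit_le_1: "hit a P \<le> 1"
proof (cases "{s \<in> {a..<1}. P s} = {}")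
  case False
  then obtain s where s: "s \<in> {s \<in> {a..<1}. P s}" by blast
  then have "Inf {s \<in> {a..<1}. P s} \<le> s" by (intro cInf_lower) auto
  then show ?thesis using s False by (simp add: hit_def)
qed (simp add: hit_def)

lemma hit_le: "a \<le> s \<Longrightarrow> s < 1 \<Longrightarrow> P s \<Longrightarrow> hit a P \<le> s"
  unfolding hit_def by (auto intro!: cInf_lower)

lemma not_before_hit: "a \<le> s \<Longrightarrow> s < hit a P \<Longrightarrow> \<not> P s"
  using hit_le[of a s P] hit_le_1[of a P] by (meson less_le_trans not_le)

text \<open>Along a continuous path \<open>0 \<le> \<phi> s\<close> is a closed condition: a
  negative value at the infimum would persist just after it, leaving no nearby points of the
  set.\<close>

lemma hit_attained:
  fixes \<phi> :: "real \<Rightarrow> real"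
  assumes cont: "continuous_on {a..<1} \<phi>" and P: "\<And>s. a \<le> s \<Longrightarrow> s < 1 \<Longrightarrow> P s \<longleftrightarrow> 0 \<le> \<phi> s"
    and hit: "hit a P < 1"
  shows "a \<le> hit a P" "P (hit a P)"
proof -
  define S where "S = {s \<in> {a..<1}. P s}"
  have ne: "S \<noteq> {}"
  proof
    assume "S = {}"
    then show False using hit unfolding hit_def S_def[symmetric] by simp
  qed
  have r: "hit a P = Inf S" unfolding hit_def S_def[symmetric] using ne by simp
  show ar: "a \<le> hit a P" unfolding r using ne by (intro cInf_greatest) (auto simp: S_def)
  define r where "r = hit a P"
  have r1: "a \<le> r" "r < 1" "r = Inf S" using ar hit r by (auto simp: r_def)
  have "0 \<le> \<phi> r"
  proof (rule ccontr)
    assume "\<not> 0 \<le> \<phi> r"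
    then have "0 < - \<phi> r" by simp
    then obtain \<delta> where \<delta>: "\<delta> > 0" "\<And>s. s \<in> {a..<1} \<Longrightarrow> dist s r < \<delta> \<Longrightarrow> dist (\<phi> s) (\<phi> r) < - \<phi> r"
      using cont r1 unfolding continuous_on_iff by (metis atLeastLessThan_iff)
    have "Inf S < r + \<delta>" using \<delta> r1 by simp
    then obtain s where s: "s \<in> S" "s < r + \<delta>" using cInf_lessD[OF ne] by blast
    have "r \<le> s" unfolding r1(3) by (rule cInf_lower[OF s(1)]) (auto simp: S_def bdd_below_def intro: exI[of _ a])
    then have "dist (\<phi> s) (\<phi> r) < - \<phi> r" using \<delta>(2)[of s] s by (auto simp: S_def dist_real_def)
    then have "\<phi> s < 0" by (simp add: dist_real_def abs_if split: if_splits)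
    then show False using s(1) P[of s] by (simp add: S_def)
  qed
  then show "P (hit a P)" using P[of r] r1 by (simp add: r_def)
qed

context bridge
begin

text \<open>With \<open>\<rho> = 1 / L\<^sup>2\<close> the chain forgets its position in one step as long as \<open>\<bar>Z\<bar> \<le> L\<close>.\<close>
lemma hitting_prob_bound:
  assumes s0: "t \<le> s0" "s0 < 1" and b: "0 < b" and sg: "sg = 1 \<or> sg = - 1"
  defines "q \<equiv> Phi (2 * (b + 1))" and "C \<equiv> x\<^sup>2 / (1 - t) + 1"
  obtains N where "N \<in> sets M" "\<And>\<omega>. \<omega> \<in> space M \<Longrightarrow> \<forall>s\<in>{s0..<1}. sg * Z s \<omega> < b \<Longrightarrow> \<omega> \<in> N"
    and "prob N \<le> q ^ (n + 1) + C / (real n + 2)"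
proof -
  define L where "L = real n + 2"
  have L: "2 \<le> L" by (simp add: L_def)
  define \<rho> where "\<rho> = (1 / L)\<^sup>2"
  have L2: "1 < L\<^sup>2" using L by (intro one_less_power) auto
  have \<rho>: "0 < \<rho>" "\<rho> < 1" "sqrt \<rho> = 1 / L"
  proof -
    show "0 < \<rho>" "\<rho> < 1" using L L2 by (auto simp: \<rho>_def power_divide)
    show "sqrt \<rho> = 1 / L" unfolding \<rho>_def using L by (intro real_sqrt_unique) auto
  qed
  have \<rho>4: "\<rho> \<le> 3 / 4"
  proof -
    have "1 / L \<le> 1 / 2" using L by (intro frac_le) auto
    then have "(1 / L)\<^sup>2 \<le> (1 / 2)\<^sup>2" using L by (intro power_mono) auto
    then show ?thesis by (simp add: \<rho>_def power_divide)
  qed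
  define e where "e = 1 - \<rho>"
  have e: "1 / 2 \<le> sqrt e" using \<rho>4 by (intro real_le_rsqrt) (simp add: e_def power2_eq_square)
  define g where "g k = grid s0 \<rho> k" for k
  have g: "g k \<in> {t..<1}" "s0 \<le> g k" "g k < g (Suc k)" "(g (Suc k) - g k) / (1 - g k) = e" for k
    unfolding g_def e_def using s0 grid_ge[OF s0(2) \<rho>(1,2)] grid_less_1[OF s0(2) \<rho>(1,2)]
      grid_less_Suc[OF s0(2) \<rho>(1,2)] grid_ratio[OF s0(2) \<rho>(1,2)] by (auto intro: order_trans)
  have g_mono: "g k \<le> g l" if "k \<le> l" for k l
    unfolding g_def using grid_mono[OF s0(2) \<rho>(1,2) that] .
  \<comment> \<open>No hit at grid points \<open>1\<close> to \<open>k\<close>. Staying below the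
    barrier at all times of \<open>{s0..<1}\<close> is merely contained in these events, which
    suffices and avoids its measurability.\<close>
  define A where "A k = {\<omega> \<in> space M. \<forall>j\<in>{..<k}. sg * Z (g (Suc j)) \<omega> < b}" for k
  have A: "A k \<in> sets (F (g k))" for k
  proof -
    have "A k = {\<omega> \<in> space (F (g k)). \<forall>j\<in>{..<k}. sg * Z (g (Suc j)) \<omega> < b}"
      by (simp add: A_def space_F)
    moreover have "{\<omega> \<in> space (F (g k)). \<forall>j\<in>{..<k}. sg * Z (g (Suc j)) \<omega> < b} \<in> sets (F (g k))"
    proof (intro sets.sets_Collect_finite_All)
      fix j assume j: "j \<in> {..<k}"
      have [measurable]: "Z (g (Suc j)) \<in> borel_measurable (F (g k))"
        using g(1)[of "Suc j"] g_mono[of "Suc j" k] j by (intro Z_measurable_F) auto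
      show "{\<omega> \<in> space (F (g k)). sg * Z (g (Suc j)) \<omega> < b} \<in> sets (F (g k))" by measurable
    qed auto
    ultimately show ?thesis by simp
  qed
  have AM: "A k \<in> sets M" for k using A sets_F_subset by blast
  define G where "G = (indicator {z. sg * z < b} :: real \<Rightarrow> real)"
  have G [measurable]: "G \<in> borel_measurable borel" unfolding G_def by measurable
  have G1: "\<bar>G z\<bar> \<le> 1 * (1 + z\<^sup>2)" for z by (auto simp: G_def indicator_def)
  have G01: "0 \<le> G z" "G z \<le> 1" for z by (auto simp: G_def indicator_def)
  define \<psi> where "\<psi> z = (\<integral>y. G (sqrt (1 - e) * z + sqrt e * y) \<partial>std_normal_distribution)" for z
  interpret SN: prob_space std_normal_distribution by (rule prob_space_std_normal)
  have \<psi>m [measurable]: "\<psi> \<in> borel_measurable borel" unfolding \<psi>_def[abs_def] by measurable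
  have iG: "integrable std_normal_distribution (\<lambda>y. G (sqrt (1 - e) * z + sqrt e * y))" for z
    by (rule SN.integrable_const_bound[where B=1]) (use G01 in auto)
  have \<psi>1: "\<psi> z \<le> 1" for z
  proof -
    have "\<psi> z \<le> (\<integral>y. 1 \<partial>std_normal_distribution)"
      unfolding \<psi>_def by (intro integral_mono iG) (use G01 in auto)
    then show ?thesis using SN.prob_space by simp
  qed
  have \<psi>0: "0 \<le> \<psi> z" for z unfolding \<psi>_def using G01 by (intro Bochner_Integration.integral_nonneg) auto
  have q01: "0 \<le> q" "q < 1" unfolding q_def by (rule Phi_nonneg, rule Phi_less_1)
  \<comment> \<open>For such \<open>z\<close> the old position contributes at most \<open>1\<close>
    in absolute value and \<open>sqrt e \<ge> 1 / 2\<close>, so missing the barrier forces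
    \<open>sg * y \<le> 2 * (b + 1)\<close>.\<close>
  have \<psi>q: "\<psi> z \<le> q" if "\<bar>z\<bar> \<le> L" for z
  proof -
    have "\<psi> z \<le> (\<integral>y. indicator {y. sg * y \<le> 2 * (b + 1)} y \<partial>std_normal_distribution)"
      unfolding \<psi>_def
    proof (rule integral_mono[OF iG])
      show "integrable std_normal_distribution (indicator {y. sg * y \<le> 2 * (b + 1)} :: real \<Rightarrow> real)"
        by (rule SN.integrable_const_bound[where B=1]) (auto simp: indicator_def)
      fix y
      have "sg * y \<le> 2 * (b + 1)" if h: "sg * (sqrt (1 - e) * z + sqrt e * y) < b"
      proof (rule ccontr)
        assume "\<not> sg * y \<le> 2 * (b + 1)"
        then have y: "2 * (b + 1) < sg * y" by simp
        have "\<bar>sg * (sqrt (1 - e) * z)\<bar> \<le> 1"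
          using sg \<open>\<bar>z\<bar> \<le> L\<close> L by (auto simp: e_def \<rho>(3) abs_mult)
        moreover have "b + 1 \<le> sqrt e * (sg * y)"
          using mult_mono[OF e less_imp_le[OF y]] b \<rho>(2) by (simp add: e_def)
        moreover have "sg * (sqrt (1 - e) * z + sqrt e * y) = sg * (sqrt (1 - e) * z) + sqrt e * (sg * y)"
          by (simp add: algebra_simps)
        ultimately show False using h by linarith
      qed
      then show "G (sqrt (1 - e) * z + sqrt e * y) \<le> indicator {y. sg * y \<le> 2 * (b + 1)} y"
        by (auto simp: G_def indicator_def)
    qed
    then show ?thesis unfolding q_def integral_std_normal_indicator_le[OF sg] .
  qed
  \<comment> \<open>A pointwise Chebyshev bound: outside \<open>\<bar>z\<bar> \<le> L\<close> the
    added term is at least \<open>1\<close>.\<close>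
  have \<psi>le: "\<psi> z \<le> q + z\<^sup>2 / L\<^sup>2" for z
  proof (cases "\<bar>z\<bar> \<le> L")
    case True
    have "0 \<le> z\<^sup>2 / L\<^sup>2" by simp
    then show ?thesis using \<psi>q[OF True] by linarith
  next
    case False
    then have "L\<^sup>2 \<le> \<bar>z\<bar>\<^sup>2" using L by (intro power_mono) auto
    then have "1 \<le> z\<^sup>2 / L\<^sup>2" using L by simp
    then show ?thesis using \<psi>1[of z] q01 by linarith
  qed
  have step: "prob (A (Suc k)) \<le> q * prob (A k) + C / L\<^sup>2" for k
  proof -
    have [measurable]: "Z (g k) \<in> borel_measurable M" by (rule Z_measurable[OF g(1)])
    have "prob (A (Suc k)) = expectation (indicator (A (Suc k)))" using AM by simp
    also have "\<dots> = expectation (\<lambda>\<omega>. indicator (A k) \<omega> * G (Z (g (Suc k)) \<omega>))"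
      by (intro Bochner_Integration.integral_cong refl)
         (auto simp: A_def G_def indicator_def less_Suc_eq)
    also have "\<dots> = expectation (\<lambda>\<omega>. indicator (A k) \<omega> * \<psi> (Z (g k) \<omega>))"
      using markov_step[OF _ g(3) _ A G G1, of k] g(1)[of k] g(1)[of "Suc k"] unfolding g(4) \<psi>_def by simp
    also have "\<dots> \<le> expectation (\<lambda>\<omega>. q * indicator (A k) \<omega> + (Z (g k) \<omega>)\<^sup>2 / L\<^sup>2)"
    proof (rule integral_mono)
      have "(\<lambda>\<omega>. indicator (A k) \<omega> * \<psi> (Z (g k) \<omega>)) \<in> borel_measurable M" using AM by measurable
      then show "integrable M (\<lambda>\<omega>. indicator (A k) \<omega> * \<psi> (Z (g k) \<omega>))"
        by (rule integrable_bounded_real[where c=1]) (use \<psi>0 \<psi>1 in \<open>auto simp: indicator_def\<close>)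
      show "integrable M (\<lambda>\<omega>. q * indicator (A k) \<omega> + (Z (g k) \<omega>)\<^sup>2 / L\<^sup>2)"
        using integrable_Z_square[OF g(1)] AM by (intro Bochner_Integration.integrable_add) (auto simp: emeasure_eq_measure)
      show "indicator (A k) \<omega> * \<psi> (Z (g k) \<omega>) \<le> q * indicator (A k) \<omega> + (Z (g k) \<omega>)\<^sup>2 / L\<^sup>2" for \<omega>
        using \<psi>le[of "Z (g k) \<omega>"] by (auto simp: indicator_def)
    qed
    also have "\<dots> = q * prob (A k) + expectation (\<lambda>\<omega>. (Z (g k) \<omega>)\<^sup>2) / L\<^sup>2"
      using integrable_Z_square[OF g(1)] AM by (subst Bochner_Integration.integral_add) (auto simp: emeasure_eq_measure)
    also have "\<dots> \<le> q * prob (A k) + C / L\<^sup>2"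
      unfolding C_def by (intro add_left_mono divide_right_mono expectation_Z_square_le g(1)) auto
    finally show ?thesis .
  qed
  have C0: "0 \<le> C" unfolding C_def using t1 by simp
  have ind: "prob (A k) \<le> q ^ k + real k * (C / L\<^sup>2)" for k
  proof (induction k)
    case (Suc k)
    have "prob (A (Suc k)) \<le> q * (q ^ k + real k * (C / L\<^sup>2)) + C / L\<^sup>2"
      using step[of k] mult_left_mono[OF Suc q01(1)] by linarith
    also have "q * (q ^ k + real k * (C / L\<^sup>2)) \<le> q ^ Suc k + 1 * (real k * (C / L\<^sup>2))"
      unfolding distrib_left using q01 C0 by (intro add_mono mult_right_mono) auto
    finally show ?case by (simp add: algebra_simps add_divide_distrib)
  qed simp
  show ?thesis
  \<comment> \<open>With \<open>n + 1 < L\<close> steps the Chebyshev errors add up to at most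
    \<open>C / L\<close>, while \<open>q ^ (n + 1)\<close> decays; both vanish as \<open>n\<close>
    grows.\<close>
  proof (rule that[of "A (n + 1)"])
    show "A (n + 1) \<in> sets M" by (rule AM)
    show "\<omega> \<in> A (n + 1)" if "\<omega> \<in> space M" "\<forall>s\<in>{s0..<1}. sg * Z s \<omega> < b" for \<omega>
    proof -
      have "g (Suc j) \<in> {s0..<1}" for j using g(1,2)[of "Suc j"] by auto
      then show ?thesis using that by (auto simp: A_def)
    qed
    have "real (n + 1) * (C / L\<^sup>2) \<le> L * (C / L\<^sup>2)"
      using C0 by (intro mult_right_mono) (auto simp: L_def)
    also have "\<dots> = C / L" using L by (simp add: power2_eq_square)
    finally show "prob (A (n + 1)) \<le> q ^ (n + 1) + C / (real n + 2)"
      using ind[of "n + 1"] by (simp add: L_def)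
  qed
qed

lemma AE_hits:
  assumes s0: "t \<le> s0" "s0 < 1" and b: "0 < b" and sg: "sg = 1 \<or> sg = - 1"
  shows "AE \<omega> in M. \<exists>s\<in>{s0..<1}. b \<le> sg * Z s \<omega>"
proof -
  define q where "q = Phi (2 * (b + 1))"
  define C where "C = x\<^sup>2 / (1 - t) + 1"
  have "\<forall>n. \<exists>N. N \<in> sets M \<and> (\<forall>\<omega>\<in>space M. (\<forall>s\<in>{s0..<1}. sg * Z s \<omega> < b) \<longrightarrow> \<omega> \<in> N)
      \<and> prob N \<le> q ^ (n + 1) + C / (real n + 2)"
    using hitting_prob_bound[OF s0 b sg] unfolding q_def C_def by metis
  then obtain N where N: "\<And>n. N n \<in> sets M" "\<And>n \<omega>. \<omega> \<in> space M \<Longrightarrow> \<forall>s\<in>{s0..<1}. sg * Z s \<omega> < b \<Longrightarrow> \<omega> \<in> N n"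
    "\<And>n. prob (N n) \<le> q ^ (n + 1) + C / (real n + 2)"
    by metis
  have q: "0 \<le> q" "q < 1" unfolding q_def by (rule Phi_nonneg, rule Phi_less_1)
  define N0 where "N0 = (\<Inter>n. N n)"
  have N0: "N0 \<in> sets M" unfolding N0_def using N(1) by auto
  have "(\<lambda>n. q * q ^ n + C * (1 / (real n + 2))) \<longlonglongrightarrow> q * 0 + C * 0"
    by (intro tendsto_intros LIMSEQ_realpow_zero q inverse_add_2_tendsto)
  moreover have "prob N0 \<le> q * q ^ n + C * (1 / (real n + 2))" for n
  proof -
    have "prob N0 \<le> prob (N n)" using N(1) by (intro finite_measure_mono) (auto simp: N0_def)
    then show ?thesis using N(3)[of n] by simp
  qed
  ultimately have "prob N0 \<le> 0"
    by (intro LIMSEQ_le_const[of _ "0"]) auto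
  then have "prob N0 = 0" using measure_nonneg[of M N0] by linarith
  then have "emeasure M N0 = 0" by (simp add: emeasure_eq_measure)
  then show ?thesis
    using N0 N(2) by (intro AE_I[where N=N0]) (auto simp: N0_def not_le)
qed

text \<open>The second barrier is sought from the random time \<open>\<tau>1\<close>, so the
  exceptional set must not depend on the starting time. Countably many starting times tending to
  \<open>1\<close> suffice, since a hit after a later start is also one after an earlier
  start.\<close>

lemma AE_hits_eventually:
  assumes b: "0 < b" and sg: "sg = 1 \<or> sg = - 1"
  shows "AE \<omega> in M. \<forall>r\<in>{t..<1}. \<exists>s\<in>{r..<1}. b \<le> sg * Z s \<omega>"
proof -
  define r where "r n = 1 - (1 - t) * (1 / (real n + 2))" for n
  have r: "t \<le> r n" "r n < 1" for n
  proof -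
    have "(1 - t) * (1 / (real n + 2)) \<le> (1 - t) * 1" using t1 by (intro mult_left_mono) auto
    then show "t \<le> r n" by (simp add: r_def)
    show "r n < 1" using t1 by (simp add: r_def)
  qed
  have lim: "r \<longlonglongrightarrow> 1 - (1 - t) * 0"
    unfolding r_def[abs_def] by (intro tendsto_intros inverse_add_2_tendsto)
  have "AE \<omega> in M. \<forall>n. \<exists>s\<in>{r n..<1}. b \<le> sg * Z s \<omega>"
    unfolding AE_all_countable using AE_hits[OF r b sg] by blast
  then show ?thesis
  proof (rule eventually_mono, intro ballI)
    fix \<omega> p assume h: "\<forall>n. \<exists>s\<in>{r n..<1}. b \<le> sg * Z s \<omega>" and p: "p \<in> {t..<1}"
    have "\<forall>\<^sub>F n in sequentially. p < r n" by (rule order_tendstoD(1)[OF lim]) (use p in simp)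
    then obtain n where "p < r n" using eventually_happens'[OF sequentially_bot] by blast
    then show "\<exists>s\<in>{p..<1}. b \<le> sg * Z s \<omega>" using h[rule_format, of n] by (auto intro: order_trans less_imp_le)
  qed
qed

text \<open>By compactness the condition says that the maximum of the path is nonnegative, which by
  continuity can be tested on a countable dense set of times with thresholds
  \<open>- (1 / (real n + 2))\<close>. The point \<open>a\<close> is put into that set to cover
  \<open>a = s\<close>.\<close>

lemma exists_ge_in_F:
  fixes \<phi> :: "real \<Rightarrow> 'a \<Rightarrow> real"
  assumes a: "t \<le> a" "a \<le> s" "s < 1"
    and meas: "\<And>r. r \<in> {a..s} \<Longrightarrow> \<phi> r \<in> borel_measurable (F s)"
    and cont: "\<And>\<omega>. \<omega> \<in> space M \<Longrightarrow> continuous_on {a..s} (\<lambda>r. \<phi> r \<omega>)"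
  shows "{\<omega> \<in> space M. \<exists>r\<in>{a..s}. 0 \<le> \<phi> r \<omega>} \<in> sets (F s)"
proof -
  define D where "D = insert a ({a..s} \<inter> \<rat>)"
  have D: "countable D" "D \<subseteq> {a..s}" using a by (auto simp: D_def countable_rat)
  have dense: "\<exists>r\<in>D. dist r r0 < \<delta>" if r0: "r0 \<in> {a..s}" and \<delta>: "0 < \<delta>" for r0 \<delta>
  proof (cases "a = s")
    case True
    then show ?thesis using r0 \<delta> by (auto simp: D_def)
  next
    case False
    then have "max a (r0 - \<delta>) < min s (r0 + \<delta>)" using r0 \<delta> a by auto
    then obtain r where r: "r \<in> \<rat>" "max a (r0 - \<delta>) < r" "r < min s (r0 + \<delta>)" using Rats_dense_in_real by blast
    then show ?thesis by (intro bexI[of _ r]) (auto simp: D_def dist_real_def)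
  qed
  have eq: "{\<omega> \<in> space M. \<exists>r\<in>{a..s}. 0 \<le> \<phi> r \<omega>} = (\<Inter>n. \<Union>r\<in>D. {\<omega> \<in> space (F s). - (1 / (real n + 2)) < \<phi> r \<omega>})"
  proof (intro set_eqI iffI)
    fix \<omega> assume "\<omega> \<in> {\<omega> \<in> space M. \<exists>r\<in>{a..s}. 0 \<le> \<phi> r \<omega>}"
    then obtain r0 where \<omega>: "\<omega> \<in> space M" and r0: "r0 \<in> {a..s}" "0 \<le> \<phi> r0 \<omega>" by auto
    show "\<omega> \<in> (\<Inter>n. \<Union>r\<in>D. {\<omega> \<in> space (F s). - (1 / (real n + 2)) < \<phi> r \<omega>})"
    proof
      fix n
      have "0 < 1 / (real n + 2)" by simp
      then obtain \<delta> where \<delta>: "\<delta> > 0" "\<And>r. r \<in> {a..s} \<Longrightarrow> dist r r0 < \<delta> \<Longrightarrow> dist (\<phi> r \<omega>) (\<phi> r0 \<omega>) < 1 / (real n + 2)"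
        using cont[OF \<omega>] r0(1) unfolding continuous_on_iff by metis
      obtain r where r: "r \<in> D" "dist r r0 < \<delta>" using dense[OF r0(1) \<delta>(1)] by blast
      have "dist (\<phi> r \<omega>) (\<phi> r0 \<omega>) < 1 / (real n + 2)" using \<delta>(2)[of r] r D(2) by blast
      then have "- (1 / (real n + 2)) < \<phi> r \<omega>" using r0(2) unfolding dist_real_def by linarith
      then show "\<omega> \<in> (\<Union>r\<in>D. {\<omega> \<in> space (F s). - (1 / (real n + 2)) < \<phi> r \<omega>})"
        using r(1) \<omega> by (auto simp: space_F)
    qed
  next
    fix \<omega> assume h: "\<omega> \<in> (\<Inter>n. \<Union>r\<in>D. {\<omega> \<in> space (F s). - (1 / (real n + 2)) < \<phi> r \<omega>})"
    then have \<omega>: "\<omega> \<in> space M" by (auto simp: space_F)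
    obtain rm where rm: "rm \<in> {a..s}" "\<And>r. r \<in> {a..s} \<Longrightarrow> \<phi> r \<omega> \<le> \<phi> rm \<omega>"
      using continuous_attains_sup[OF compact_Icc _ cont[OF \<omega>]] a by auto
    have "- (1 / (real n + 2)) \<le> \<phi> rm \<omega>" for n
    proof -
      obtain r where "r \<in> D" "- (1 / (real n + 2)) < \<phi> r \<omega>" using h by blast
      then show ?thesis using rm(2)[of r] D(2) by force
    qed
    moreover have "(\<lambda>n. - (1 / (real n + 2))) \<longlonglongrightarrow> - 0" by (intro tendsto_minus inverse_add_2_tendsto)
    ultimately have "- 0 \<le> \<phi> rm \<omega>" by (intro LIMSEQ_le_const2) auto
    then show "\<omega> \<in> {\<omega> \<in> space M. \<exists>r\<in>{a..s}. 0 \<le> \<phi> r \<omega>}" using \<omega> rm(1) by auto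
  qed
  have "{\<omega> \<in> space (F s). - (1 / (real n + 2)) < \<phi> r \<omega>} \<in> sets (F s)" if "r \<in> D" for n r
  proof -
    have [measurable]: "\<phi> r \<in> borel_measurable (F s)" using meas that D(2) by blast
    show ?thesis by measurable
  qed
  then show ?thesis
    unfolding eq using D(1) by (intro sets.countable_INT image_subsetI sets.countable_UN'') auto
qed

section \<open>The two barriers and their hitting times\<close>

definition lower :: "real \<Rightarrow> 'a \<Rightarrow> real" where "lower s \<omega> = Cstar * sqrt (1 - s) - X s \<omega>"

definition upper :: "real \<Rightarrow> 'a \<Rightarrow> real" where "upper s \<omega> = X s \<omega> - Bstar * sqrt (1 - s)"

lemma lower_upper_continuous:
  assumes "\<omega> \<in> space M" "S \<subseteq> {t..<1}"
  shows "continuous_on S (\<lambda>s. lower s \<omega>)" "continuous_on S (\<lambda>s. upper s \<omega>)"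
  unfolding lower_def upper_def
  by (intro continuous_intros continuous_on_subset[OF X_continuous[OF assms(1)] assms(2)])+

lemma lower_upper_measurable:
  assumes "t \<le> r" "r \<le> s" "r < 1"
  shows "lower r \<in> borel_measurable (F s)" "upper r \<in> borel_measurable (F s)"
  unfolding lower_def[abs_def] upper_def[abs_def] using X_measurable_F[OF assms] by measurable

lemma lower_iff: "s < 1 \<Longrightarrow> 0 \<le> lower s \<omega> \<longleftrightarrow> Z s \<omega> \<le> Cstar"
  by (simp add: lower_def Z_def pos_divide_le_eq)

lemma upper_iff: "s < 1 \<Longrightarrow> 0 \<le> upper s \<omega> \<longleftrightarrow> Bstar \<le> Z s \<omega>"
  by (simp add: upper_def Z_def pos_le_divide_eq)

abbreviation "\<tau>1 \<equiv> tau1star t X"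

abbreviation "\<tau>2 \<equiv> tau2star t X"

lemma tau1_eq: "\<tau>1 \<omega> = hit t (\<lambda>s. 0 \<le> lower s \<omega>)"
  by (simp add: tau1star_def lower_def)

lemma tau2_eq: "\<tau>2 \<omega> = hit (\<tau>1 \<omega>) (\<lambda>s. 0 \<le> upper s \<omega>)"
  by (simp add: tau2star_def upper_def)

lemma tau1_bounds: "t \<le> \<tau>1 \<omega>" "\<tau>1 \<omega> \<le> 1"
  unfolding tau1_eq using t1 by (auto intro: hit_ge hit_le_1)

lemma tau2_bounds: "\<tau>1 \<omega> \<le> \<tau>2 \<omega>" "\<tau>2 \<omega> \<le> 1"
  unfolding tau2_eq using tau1_bounds by (auto intro: hit_ge hit_le_1)

lemma tau1_attained: "\<omega> \<in> space M \<Longrightarrow> \<tau>1 \<omega> < 1 \<Longrightarrow> 0 \<le> lower (\<tau>1 \<omega>) \<omega>"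
  unfolding tau1_eq
  by (rule hit_attained(2)[where \<phi>="\<lambda>s. lower s \<omega>"]) (auto intro: lower_upper_continuous)

lemma tau2_attained: "\<omega> \<in> space M \<Longrightarrow> \<tau>2 \<omega> < 1 \<Longrightarrow> 0 \<le> upper (\<tau>2 \<omega>) \<omega>"
  unfolding tau2_eq
  by (rule hit_attained(2)[where \<phi>="\<lambda>s. upper s \<omega>"]) (auto intro!: lower_upper_continuous order_trans[OF tau1_bounds(1)])

lemma Cstar_less_Bstar: "Cstar < 0" "Cstar < Bstar"
  using c_star_bounds by (auto simp: Cstar_eq)

lemma tau1_le_iff:
  assumes "\<omega> \<in> space M" "s < 1"
  shows "\<tau>1 \<omega> \<le> s \<longleftrightarrow> (\<exists>r\<in>{t..s}. 0 \<le> lower r \<omega>)"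
proof
  assume "\<tau>1 \<omega> \<le> s"
  then show "\<exists>r\<in>{t..s}. 0 \<le> lower r \<omega>"
    using tau1_attained[OF assms(1)] tau1_bounds assms(2) by (intro bexI[of _ "\<tau>1 \<omega>"]) auto
next
  assume "\<exists>r\<in>{t..s}. 0 \<le> lower r \<omega>"
  then obtain r where "t \<le> r" "r \<le> s" "0 \<le> lower r \<omega>" by auto
  then have "\<tau>1 \<omega> \<le> r" unfolding tau1_eq using assms(2) by (intro hit_le) auto
  then show "\<tau>1 \<omega> \<le> s" using \<open>r \<le> s\<close> by simp
qed

text \<open>The two barriers are disjoint, so a rational time separates \<open>\<tau>1\<close> from \<open>\<tau>2\<close>.\<close>
lemma tau2_le_iff:
  assumes "\<omega> \<in> space M" "s < 1"
  shows "\<tau>2 \<omega> \<le> s \<longleftrightarrow> (\<exists>p\<in>{t..s} \<inter> \<rat>. (\<exists>r\<in>{t..p}. 0 \<le> lower r \<omega>) \<and> (\<exists>r\<in>{p..s}. 0 \<le> upper r \<omega>))"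
proof
  assume le: "\<tau>2 \<omega> \<le> s"
  then have l: "\<tau>1 \<omega> < 1" "\<tau>2 \<omega> < 1" using tau2_bounds(1)[of \<omega>] assms by auto
  \<comment> \<open>At a common time \<open>Z\<close> would be both at most \<open>Cstar\<close> and
    at least \<open>Bstar\<close>.\<close>
  have "\<tau>1 \<omega> \<noteq> \<tau>2 \<omega>"
    using tau1_attained[OF assms(1) l(1)] tau2_attained[OF assms(1) l(2)] lower_iff[OF l(1)] upper_iff[OF l(2)]
      Cstar_less_Bstar by auto
  then have "\<tau>1 \<omega> < \<tau>2 \<omega>" using tau2_bounds(1)[of \<omega>] by simp
  then obtain p where p: "p \<in> \<rat>" "\<tau>1 \<omega> < p" "p < \<tau>2 \<omega>" using Rats_dense_in_real by blast
  have "\<exists>r\<in>{t..p}. 0 \<le> lower r \<omega>"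
    using tau1_attained[OF assms(1) l(1)] tau1_bounds p by (intro bexI[of _ "\<tau>1 \<omega>"]) auto
  moreover have "\<exists>r\<in>{p..s}. 0 \<le> upper r \<omega>"
    using tau2_attained[OF assms(1) l(2)] le p by (intro bexI[of _ "\<tau>2 \<omega>"]) auto
  moreover have "p \<in> {t..s} \<inter> \<rat>" using p le tau1_bounds(1)[of \<omega>] by auto
  ultimately show "\<exists>p\<in>{t..s} \<inter> \<rat>. (\<exists>r\<in>{t..p}. 0 \<le> lower r \<omega>) \<and> (\<exists>r\<in>{p..s}. 0 \<le> upper r \<omega>)" by blast
next
  assume "\<exists>p\<in>{t..s} \<inter> \<rat>. (\<exists>r\<in>{t..p}. 0 \<le> lower r \<omega>) \<and> (\<exists>r\<in>{p..s}. 0 \<le> upper r \<omega>)"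
  then obtain p r where p: "\<exists>r\<in>{t..p}. 0 \<le> lower r \<omega>" and r: "p \<le> r" "r \<le> s" "0 \<le> upper r \<omega>" by (metis atLeastAtMost_iff)
  have "\<tau>1 \<omega> \<le> p" using tau1_le_iff[OF assms(1), of p] p r assms(2) by simp
  then have "\<tau>2 \<omega> \<le> r" unfolding tau2_eq using r assms(2) by (intro hit_le) auto
  then show "\<tau>2 \<omega> \<le> s" using r by simp
qed

lemma stopping_timeI':
  assumes "\<And>s. t \<le> s \<Longrightarrow> s < 1 \<Longrightarrow> {\<omega> \<in> space M. \<tau> \<omega> \<le> s} \<in> sets (F s)"
    and "\<And>\<omega>. t \<le> \<tau> \<omega>" "\<And>\<omega>. \<tau> \<omega> \<le> 1"
  shows "stopping_time F \<tau>"
proof (rule stopping_timeI)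
  fix s
  consider "s < t" | "t \<le> s" "s < 1" | "1 \<le> s" by linarith
  then have "{\<omega> \<in> space (F s). \<tau> \<omega> \<le> s} \<in> sets (F s)"
  proof cases
    case 1
    then have "{\<omega> \<in> space (F s). \<tau> \<omega> \<le> s} = {}" using assms(2) by (auto simp: not_le intro: less_le_trans)
    then show ?thesis by (simp only: sets.empty_sets)
  next
    case 3
    then have "{\<omega> \<in> space (F s). \<tau> \<omega> \<le> s} = space (F s)" using assms(3) by (auto intro: order_trans)
    then show ?thesis by (simp only: sets.top)
  qed (use assms(1)[of s] in \<open>simp add: space_F\<close>)
  then show "Measurable.pred (F s) (\<lambda>\<omega>. \<tau> \<omega> \<le> s)" by (simp add: Measurable.pred_def)
qed

lemma lower_event: "t \<le> s \<Longrightarrow> s < 1 \<Longrightarrow> {\<omega> \<in> space M. \<exists>r\<in>{t..s}. 0 \<le> lower r \<omega>} \<in> sets (F s)"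
  by (rule exists_ge_in_F) (auto intro!: lower_upper_continuous lower_upper_measurable)

lemma upper_event: "t \<le> p \<Longrightarrow> p \<le> s \<Longrightarrow> s < 1 \<Longrightarrow> {\<omega> \<in> space M. \<exists>r\<in>{p..s}. 0 \<le> upper r \<omega>} \<in> sets (F s)"
  by (rule exists_ge_in_F) (auto intro!: lower_upper_continuous lower_upper_measurable)

lemma stopping_time_tau1: "stopping_time F \<tau>1"
proof (rule stopping_timeI'[OF _ tau1_bounds])
  fix s assume s: "t \<le> s" "s < 1"
  have "{\<omega> \<in> space M. \<tau>1 \<omega> \<le> s} = {\<omega> \<in> space M. \<exists>r\<in>{t..s}. 0 \<le> lower r \<omega>}"
    using tau1_le_iff s by blast
  then show "{\<omega> \<in> space M. \<tau>1 \<omega> \<le> s} \<in> sets (F s)" using lower_event[OF s] by simp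
qed

lemma stopping_time_tau2: "stopping_time F \<tau>2"
proof (rule stopping_timeI'[OF _ order_trans[OF tau1_bounds(1) tau2_bounds(1)] tau2_bounds(2)])
  fix s assume s: "t \<le> s" "s < 1"
  have "{\<omega> \<in> space M. \<tau>2 \<omega> \<le> s} = (\<Union>p\<in>{t..s} \<inter> \<rat>.
      {\<omega> \<in> space M. \<exists>r\<in>{t..p}. 0 \<le> lower r \<omega>} \<inter> {\<omega> \<in> space M. \<exists>r\<in>{p..s}. 0 \<le> upper r \<omega>})"
    using tau2_le_iff s by blast
  also have "\<dots> \<in> sets (F s)"
  proof (rule sets.countable_UN'')
    show "countable ({t..s} \<inter> \<rat>)" by (simp add: countable_rat)
    fix p assume p: "p \<in> {t..s} \<inter> \<rat>"
    then have "{\<omega> \<in> space M. \<exists>r\<in>{t..p}. 0 \<le> lower r \<omega>} \<in> sets (F p)" using s by (intro lower_event) auto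
    then have "{\<omega> \<in> space M. \<exists>r\<in>{t..p}. 0 \<le> lower r \<omega>} \<in> sets (F s)" using p sets_F_mono[of p s] by auto
    then show "{\<omega> \<in> space M. \<exists>r\<in>{t..p}. 0 \<le> lower r \<omega>} \<inter> {\<omega> \<in> space M. \<exists>r\<in>{p..s}. 0 \<le> upper r \<omega>} \<in> sets (F s)"
      using p s by (intro sets.Int upper_event) auto
  qed
  finally show "{\<omega> \<in> space M. \<tau>2 \<omega> \<le> s} \<in> sets (F s)" .
qed

lemma AE_tau: "AE \<omega> in M. t \<le> \<tau>1 \<omega> \<and> \<tau>1 \<omega> \<le> \<tau>2 \<omega> \<and> \<tau>2 \<omega> < 1"
proof -
  have "AE \<omega> in M. \<forall>r\<in>{t..<1}. \<exists>s\<in>{r..<1}. c_star \<le> - 1 * Z s \<omega>"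
    by (rule AE_hits_eventually[OF c_star_bounds(1)]) simp
  moreover have "AE \<omega> in M. \<forall>r\<in>{t..<1}. \<exists>s\<in>{r..<1}. Bstar \<le> 1 * Z s \<omega>"
    by (rule AE_hits_eventually[OF Bstar_pos]) simp
  ultimately show ?thesis
  proof eventually_elim
    case (elim \<omega>)
    obtain s where s: "t \<le> s" "s < 1" "c_star \<le> - 1 * Z s \<omega>" using elim(1) t1 by (meson atLeastLessThan_iff order_refl)
    then have "0 \<le> lower s \<omega>" using lower_iff[OF s(2)] by (simp add: Cstar_eq)
    then have "\<tau>1 \<omega> \<le> s" unfolding tau1_eq using s by (intro hit_le) auto
    then have 1: "\<tau>1 \<omega> < 1" using s by simp
    then obtain r where r: "\<tau>1 \<omega> \<le> r" "r < 1" "Bstar \<le> 1 * Z r \<omega>"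
      using elim(2) tau1_bounds(1)[of \<omega>] by (meson atLeastLessThan_iff)
    then have "0 \<le> upper r \<omega>" using upper_iff[OF r(2)] by simp
    then have "\<tau>2 \<omega> \<le> r" unfolding tau2_eq using r by (intro hit_le) auto
    then show ?case using r tau1_bounds tau2_bounds by simp
  qed
qed

lemma admissible_tau: "admissible M t X \<tau>1 \<tau>2"
  unfolding admissible_def using stopping_time_tau1 stopping_time_tau2 AE_tau by blast

section \<open>Verification: upper bound and attainment\<close>

lemma proc_at_eq_val: "proc_at t X \<tau> \<omega> = val (\<lambda>z. z) \<tau> \<omega>"
  by (simp add: proc_at_def val_def Z_def)

lemma val_mono:
  assumes "\<And>z. G z \<le> H z"
  shows "val G \<tau> \<omega> \<le> val H \<tau> \<omega>"
  using assms by (auto simp: val_def intro!: mult_left_mono)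

lemma AE_X_start: "AE \<omega> in M. X t \<omega> = x"
proof -
  have tin: "t \<in> {t..<1}" using t1 by simp
  have [measurable]: "X t \<in> borel_measurable M" by (rule X_measurable[OF tin])
  have "distr M borel (X t) = return borel x"
    using distr_X_single[OF tin] t1 by (simp add: normal_law_def bb_mean_def bb_cov_def)
  moreover have "AE y in return borel x. y = x" by (subst AE_return) auto
  ultimately have "AE y in distr M borel (X t). y = x" by (simp only:)
  then show ?thesis by (subst (asm) AE_distr_iff) auto
qed

lemma expectation_val_start:
  assumes [measurable]: "G \<in> borel_measurable borel"
  shows "expectation (val G (\<lambda>_. t)) = sqrt (1 - t) * G (x / sqrt (1 - t))"
proof -
  have [measurable]: "Z t \<in> borel_measurable M" using t1 by (intro Z_measurable) simp
  have eq: "val G (\<lambda>_. t) = (\<lambda>\<omega>. sqrt (1 - t) * G (Z t \<omega>))" using t1 by (auto simp: val_def fun_eq_iff)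
  have "expectation (val G (\<lambda>_. t)) = expectation (\<lambda>\<omega>. sqrt (1 - t) * G (x / sqrt (1 - t)))"
    unfolding eq
  proof (rule integral_cong_AE)
    show "AE \<omega> in M. sqrt (1 - t) * G (Z t \<omega>) = sqrt (1 - t) * G (x / sqrt (1 - t))"
      using AE_X_start by eventually_elim (simp add: Z_def)
  qed auto
  then show ?thesis by (simp add: prob_space)
qed

lemma GU_linear: "\<bar>GU z\<bar> \<le> 1 + \<bar>z\<bar>"
  using GU_nonneg[of z] GU_le[of z] by simp

lemma GV_linear: "\<bar>GV z\<bar> \<le> (psi c_star + psi 0) + \<bar>z\<bar>"
  using GV_nonneg[of z] GV_le[of z] by simp

lemma GV_const_nonneg: "0 \<le> psi c_star + psi 0"
  using psi_nonneg[of c_star] psi_nonneg[of 0] by simp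

lemma measurable_GV: "GV \<in> borel_measurable borel"
  by (rule borel_measurable_continuous_onI[OF continuous_on_GV])

lemma Vstar_eq_expectation: "Vstar t x = expectation (val GV (\<lambda>_. t))"
  using expectation_val_start[OF measurable_GV] Vstar_eq[OF t1] by simp

lemma gain_eq:
  assumes "stopping_time F \<sigma>" "stopping_time F \<tau>" "AE \<omega> in M. t \<le> \<sigma> \<omega> \<and> \<sigma> \<omega> \<le> \<tau> \<omega> \<and> \<tau> \<omega> < 1"
  shows "gain M t X \<sigma> \<tau> = expectation (val (\<lambda>z. z) \<tau>) - expectation (val (\<lambda>z. z) \<sigma>)"
proof -
  note AEs = AE_stopping_pair[OF assms(3)]
  have "integrable M (val (\<lambda>z. z) \<sigma>)" "integrable M (val (\<lambda>z. z) \<tau>)"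
    by (rule integrable_val[where a=0]; use assms AEs in \<open>auto intro: continuous_intros\<close>)+
  then show ?thesis unfolding gain_def proc_at_eq_val by simp
qed

text \<open>Three comparisons are chained: the identity lies below the superharmonic
  \<open>GU\<close>, which bounds the second stop; \<open>GU z - z\<close> lies below the
  superharmonic \<open>GV\<close>; and \<open>GV\<close> is then traced back from
  \<open>\<sigma>\<close> to the starting time.\<close>

lemma gain_le:
  assumes adm: "admissible M t X \<sigma> \<tau>"
  shows "gain M t X \<sigma> \<tau> \<le> Vstar t x"
proof -
  have \<sigma>: "stopping_time F \<sigma>" and \<tau>: "stopping_time F \<tau>"
    and le: "AE \<omega> in M. t \<le> \<sigma> \<omega> \<and> \<sigma> \<omega> \<le> \<tau> \<omega> \<and> \<tau> \<omega> < 1"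
    using adm by (auto simp: admissible_def)
  note AEs = AE_stopping_pair[OF le]
  have iI: "integrable M (val (\<lambda>z. z) \<sigma>)" "integrable M (val (\<lambda>z. z) \<tau>)"
    by (rule integrable_val[where a=0]; use \<sigma> \<tau> AEs in \<open>auto intro: continuous_intros\<close>)+
  have iU: "integrable M (val GU \<sigma>)" "integrable M (val GU \<tau>)"
    by (rule integrable_val[OF _ _ continuous_on_GU GU_linear]; use \<sigma> \<tau> AEs in auto)+
  have iV: "integrable M (val GV \<sigma>)"
    by (rule integrable_val[OF \<sigma> AEs(1) continuous_on_GV GV_linear GV_const_nonneg])
  have "expectation (val (\<lambda>z. z) \<tau>) \<le> expectation (val GU \<tau>)"
    by (intro integral_mono iI iU val_mono GU_ge)
  also have "\<dots> \<le> expectation (val GU \<sigma>)"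
    by (rule superharmonic_stopping[OF \<sigma> \<tau> le continuous_on_GU GU_linear _ superharmonic_GU]) simp
  finally have "gain M t X \<sigma> \<tau> \<le> expectation (val GU \<sigma>) - expectation (val (\<lambda>z. z) \<sigma>)"
    unfolding gain_eq[OF \<sigma> \<tau> le] by simp
  also have "\<dots> = expectation (\<lambda>\<omega>. val GU \<sigma> \<omega> - val (\<lambda>z. z) \<sigma> \<omega>)" using iU iI by simp
  also have "\<dots> \<le> expectation (val GV \<sigma>)"
  proof (intro integral_mono iV Bochner_Integration.integrable_diff iU iI)
    fix \<omega>
    have "val GU \<sigma> \<omega> - val (\<lambda>z. z) \<sigma> \<omega> = val (\<lambda>z. GU z - z) \<sigma> \<omega>" by (simp add: val_def right_diff_distrib)
    also have "\<dots> \<le> val GV \<sigma> \<omega>" by (intro val_mono GU_minus_id_le_GV)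
    finally show "val GU \<sigma> \<omega> - val (\<lambda>z. z) \<sigma> \<omega> \<le> val GV \<sigma> \<omega>" .
  qed
  also have "\<dots> \<le> expectation (val GV (\<lambda>_. t))"
    by (rule superharmonic_stopping[OF stopping_time_const \<sigma> _ continuous_on_GV GV_linear GV_const_nonneg superharmonic_GV])
       (use AEs(1) in simp)
  finally show ?thesis by (simp add: Vstar_eq_expectation)
qed

text \<open>Every inequality in \<open>gain_le\<close> is an equality here: at
  \<open>\<tau>2\<close> the process has reached the set where \<open>GU\<close> is the identity, at
  \<open>\<tau>1\<close> the set where \<open>GV z = GU z - z\<close>, and before these times it
  stays in the respective continuation region, where \<open>harmonic_stopping\<close>
  applies.\<close>

lemma gain_tau: "gain M t X \<tau>1 \<tau>2 = Vstar t x"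
proof -
  note \<sigma> = stopping_time_tau1 and \<tau> = stopping_time_tau2 and le = AE_tau
  note AEs = AE_stopping_pair[OF le]
  have iI: "integrable M (val (\<lambda>z. z) \<tau>1)" "integrable M (val (\<lambda>z. z) \<tau>2)"
    by (rule integrable_val[where a=0]; use \<sigma> \<tau> AEs in \<open>auto intro: continuous_intros\<close>)+
  have iU: "integrable M (val GU \<tau>1)"
    by (rule integrable_val[OF \<sigma> AEs(1) continuous_on_GU GU_linear]) simp
  \<comment> \<open>On the null event \<open>\<tau>2 \<omega> = 1\<close> both sides are
    \<open>0\<close> by the default value in \<open>val\<close>, so the equality holds for every
    path.\<close>
  have "val (\<lambda>z. z) \<tau>2 \<omega> = val GU \<tau>2 \<omega>" if "\<omega> \<in> space M" for \<omega>
    using tau2_attained[OF that] upper_iff[of "\<tau>2 \<omega>" \<omega>] by (auto simp: val_def GU_def)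
  then have "expectation (val (\<lambda>z. z) \<tau>2) = expectation (val GU \<tau>2)"
    by (intro Bochner_Integration.integral_cong) auto
  also have "\<dots> = expectation (val GU \<tau>1)"
  proof (rule harmonic_stopping[OF \<sigma> \<tau> le continuous_on_GU GU_linear _ harmonic_where_GU])
    show "continuous_on UNIV (\<lambda>z. min (Bstar - z) Bstar)" by (intro continuous_intros)
    show "0 < min (Bstar - Z s \<omega>) Bstar" if "\<tau>1 \<omega> \<le> s" "s < \<tau>2 \<omega>" "\<tau>2 \<omega> < 1" for \<omega> s
    proof -
      have "\<not> 0 \<le> upper s \<omega>" using that unfolding tau2_eq by (intro not_before_hit) auto
      then show ?thesis using upper_iff[of s \<omega>] that Bstar_pos by auto
    qed
  qed simp
  finally have "gain M t X \<tau>1 \<tau>2 = expectation (\<lambda>\<omega>. val GU \<tau>1 \<omega> - val (\<lambda>z. z) \<tau>1 \<omega>)"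
    using gain_eq[OF \<sigma> \<tau> le] iU iI by simp
  also have "\<dots> = expectation (val GV \<tau>1)"
  proof (intro Bochner_Integration.integral_cong refl)
    fix \<omega> assume "\<omega> \<in> space M"
    then have "Z (\<tau>1 \<omega>) \<omega> \<le> Cstar" if "\<tau>1 \<omega> < 1" using tau1_attained lower_iff that by blast
    then show "val GU \<tau>1 \<omega> - val (\<lambda>z. z) \<tau>1 \<omega> = val GV \<tau>1 \<omega>"
      using Cstar_less_Bstar by (auto simp: val_def GU_def GV_def right_diff_distrib)
  qed
  also have "\<dots> = expectation (val GV (\<lambda>_. t))"
  proof (rule harmonic_stopping[OF stopping_time_const \<sigma> _ continuous_on_GV GV_linear GV_const_nonneg harmonic_where_GV])
    show "AE \<omega> in M. t \<le> t \<and> t \<le> \<tau>1 \<omega> \<and> \<tau>1 \<omega> < 1" using AEs(1) by simp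
    show "continuous_on UNIV (\<lambda>z. min (z - Cstar) c_star)" by (intro continuous_intros)
    show "0 < min (Z s \<omega> - Cstar) c_star" if "t \<le> s" "s < \<tau>1 \<omega>" "\<tau>1 \<omega> < 1" for \<omega> s
    proof -
      have "\<not> 0 \<le> lower s \<omega>" using that unfolding tau1_eq by (intro not_before_hit) auto
      then show ?thesis using lower_iff[of s \<omega>] that c_star_bounds by auto
    qed
  qed
  finally show ?thesis by (simp add: Vstar_eq_expectation)
qed

end

theorem theorem3p5:
  fixes M :: "'a measure" and X :: "real \<Rightarrow> 'a \<Rightarrow> real" and t x :: real
  assumes "0 \<le> t" and "t < 1"
    and "brownian_bridge M t x X"
  shows "V M t X = ereal (Vstar t x)
     \<and> admissible M t X (tau1star t X) (tau2star t X)
     \<and> gain M t X (tau1star t X) (tau2star t X) = Vstar t x"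
proof -
  interpret bridge M t x X
    using assms by (auto simp: bridge_def bridge_axioms_def brownian_bridge_def)
  have "V M t X = ereal (Vstar t x)"
    unfolding V_def
  proof (rule antisym)
    show "(SUP p\<in>{(\<tau>1, \<tau>2). admissible M t X \<tau>1 \<tau>2}. ereal (gain M t X (fst p) (snd p))) \<le> ereal (Vstar t x)"
      by (intro SUP_least) (auto intro: gain_le)
    show "ereal (Vstar t x) \<le> (SUP p\<in>{(\<tau>1, \<tau>2). admissible M t X \<tau>1 \<tau>2}. ereal (gain M t X (fst p) (snd p)))"
      using admissible_tau gain_tau by (intro SUP_upper2[of "(tau1star t X, tau2star t X)"]) auto
  qed
  then show ?thesis using admissible_tau gain_tau by blast
qed

end
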